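(* Let $G^P$ be a Sobolev-type metric on $\mathrm{Imm}(M,N)$. The reparametrization momentum, which is the momentum mapping corresponding to the action of $\mathrm{Diff}(M)$ on $\mathrm{Imm}(M,N)$, is conserved along any geodesic $f$ in $\mathrm{Imm}(M,N)$: for all $X\in\mathfrak X(M)$, $$\int_M \bar g( Tf.X,Pf_t )\, \mathrm{vol}(g)$$ is constant along $f$, or equivalently $$g\big((Pf_t )^\top\big)\, \mathrm{vol}(g) \in\Gamma(T^*M\otimes_M\mathrm{vol}(M))$$ is constant along $f$.
   Context: $M,N$ are connected smooth manifolds without boundary of finite dimension, $\dim M\le\dim N$, $M$ compact, $N$ with a fixed Riemannian metric $\bar g$. $\mathrm{Imm}(M,N)$ is the Fréchet manifold of smooth immersions, $T_f\mathrm{Imm}=\Gamma(f^*TN)$; $\mathrm{Diff}(M)$ acts by composition from the right. For $f\in\mathrm{Imm}$: $g=f^*\bar g$, $\mathrm{vol}(g)$ is its volume density, $\mathrm{vol}(M)$ denotes the density bundle of $M$, and $h=Tf.h^\top+h^\bot$ is the splitting of $h\in\Gamma(f^*TN)$ into tangential ($h^\top\in\mathfrak X(M)$) and normal parts; $g(X)$ for $X\in\mathfrak X(M)$ denotes the 1-form $g(X,\cdot)$. Standing assumptions on $P$: $P$ is a smooth section of $L(T\mathrm{Imm};T\mathrm{Imm})$ such that each $P_f:T_f\mathrm{Imm}\to T_f\mathrm{Imm}$ is an elliptic pseudo-differential operator, symmetric and positive with respect to $H^0_f(h,k)=\int_M\bar g(h,k)\,\mathrm{vol}(g)$; $P$ is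 $\mathrm{Diff}(M)$-invariant, $P_f(h)\circ\varphi=P_{f\circ\varphi}(h\circ\varphi)$ for all $\varphi\in\mathrm{Diff}(M)$; and there exists a smooth section $\mathrm{Adj}(\nabla P)$ of $L^2(T\mathrm{Imm};T\mathrm{Imm})$ with $\int_M\bar g((\nabla_mP)h,k)\,\mathrm{vol}(g)=\int_M\bar g(m,\mathrm{Adj}(\nabla P)(h,k))\,\mathrm{vol}(g)$, where $(\nabla_mP)(h)=\nabla_m(P(h))-P(\nabla_mh)$ and $\nabla$ on $\mathrm{Imm}$ is induced pointwise by the Levi-Civita connection of $(N,\bar g)$. The Sobolev-type metric is $G^P_f(h,k)=\int_M\bar g(P_fh,k)\,\mathrm{vol}(g)$; geodesics are critical points of the energy $\frac12\int G^P_f(f_t,f_t)\,dt$ for fixed endpoints. *)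

theory Defs
  imports "HOL-Analysis.Analysis"
begin

section \<open>Smooth functions on open subsets of normed spaces\<close>

fun Ck_on :: "nat \<Rightarrow> 'a::real_normed_vector set \<Rightarrow> ('a \<Rightarrow> 'b::real_normed_vector) \<Rightarrow> bool" where
  "Ck_on 0 S f \<longleftrightarrow> continuous_on S f"
| "Ck_on (Suc k) S f \<longleftrightarrow>
     (\<forall>x\<in>S. f differentiable (at x)) \<and> (\<forall>v. Ck_on k S (\<lambda>x. frechet_derivative f (at x) v))"

definition smooth_on :: "'a::real_normed_vector set \<Rightarrow> ('a \<Rightarrow> 'b::real_normed_vector) \<Rightarrow> bool" where
  "smooth_on S f \<longleftrightarrow> (\<forall>k. Ck_on k S f)"

fun iter_deriv :: "'a::real_normed_vector list \<Rightarrow> ('a \<Rightarrow> 'b::real_normed_vector) \<Rightarrow> 'a \<Rightarrow> 'b" where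
  "iter_deriv [] f = f"
| "iter_deriv (v # vs) f = (\<lambda>x. frechet_derivative (iter_deriv vs f) (at x) v)"


section \<open>Manifolds\<close>

text \<open>A manifold is a (Hausdorff, second countable) type together with a smooth atlas. A chart is a
  pair of its domain and its coordinate map; the values of the map outside the domain are
  irrelevant. Atlases need not be maximal.\<close>

type_synonym ('m, 'k) chart = "'m set \<times> ('m \<Rightarrow> real^'k)"

abbreviation cdom :: "('m, 'k::finite) chart \<Rightarrow> 'm set" where "cdom \<equiv> fst"
abbreviation cmap :: "('m, 'k::finite) chart \<Rightarrow> 'm \<Rightarrow> real^'k" where "cmap \<equiv> snd"
abbreviation cinv :: "('m, 'k::finite) chart \<Rightarrow> real^'k \<Rightarrow> 'm" where
  "cinv c \<equiv> inv_into (cdom c) (cmap c)"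
abbreviation cimg :: "('m, 'k::finite) chart \<Rightarrow> (real^'k) set" where
  "cimg c \<equiv> cmap c ` cdom c"

definition smooth_atlas :: "('m::topological_space, 'k::finite) chart set \<Rightarrow> bool" where
  "smooth_atlas A \<longleftrightarrow>
     (\<forall>c\<in>A. open (cdom c) \<and> open (cimg c) \<and> homeomorphism (cdom c) (cimg c) (cmap c) (cinv c)) \<and>
     (\<Union>c\<in>A. cdom c) = UNIV \<and>
     (\<forall>c\<in>A. \<forall>c'\<in>A. smooth_on (cmap c ` (cdom c \<inter> cdom c')) (cmap c' \<circ> cinv c))"

definition smooth_scalar :: "('m::topological_space, 'k::finite) chart set \<Rightarrow> ('m \<Rightarrow> real) \<Rightarrow> bool" where
  "smooth_scalar A \<eta> \<longleftrightarrow> (\<forall>c\<in>A. smooth_on (cimg c) (\<eta> \<circ> cinv c))"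

definition smooth_map ::
  "('m::topological_space, 'k::finite) chart set \<Rightarrow> ('n::topological_space, 'l::finite) chart set
    \<Rightarrow> ('m \<Rightarrow> 'n) \<Rightarrow> bool" where
  "smooth_map A B f \<longleftrightarrow> continuous_on UNIV f \<and>
     (\<forall>c\<in>A. \<forall>d\<in>B. smooth_on (cmap c ` (cdom c \<inter> f -` cdom d)) (cmap d \<circ> f \<circ> cinv c))"

text \<open>\<open>F\<close> is smooth as a map from the product of the open set \<open>U\<close> with the source manifold.\<close>

definition smooth_family ::
  "('m::topological_space, 'k::finite) chart set \<Rightarrow> ('n::topological_space, 'l::finite) chart set
    \<Rightarrow> 'p::real_normed_vector set \<Rightarrow> ('p \<Rightarrow> 'm \<Rightarrow> 'n) \<Rightarrow> bool" where
  "smooth_family A B U F \<longleftrightarrow> continuous_on (U \<times> UNIV) (\<lambda>(p, x). F p x) \<and>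
     (\<forall>c\<in>A. \<forall>d\<in>B. smooth_on {(p, y). p \<in> U \<and> y \<in> cimg c \<and> F p (cinv c y) \<in> cdom d}
                        (\<lambda>(p, y). cmap d (F p (cinv c y))))"

definition diffeos :: "('m::topological_space, 'k::finite) chart set \<Rightarrow> ('m \<Rightarrow> 'm) set" where
  "diffeos A = {\<phi>. bij \<phi> \<and> smooth_map A A \<phi> \<and> smooth_map A A (inv \<phi>)}"


section \<open>Tangent vectors and sections\<close>

text \<open>A tangent vector at a point is the family of its coordinate vectors in all charts around the
  point, related by the derivatives of the chart transitions. It is \<open>0\<close> at all other
  charts, so that tangent vectors are determined by their coordinates and the vector space
  operations are pointwise.\<close>

type_synonym ('m, 'k) tvec = "('m, 'k) chart \<Rightarrow> real^'k"

definition tangent_space ::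
  "('m::topological_space, 'k::finite) chart set \<Rightarrow> 'm \<Rightarrow> ('m, 'k) tvec set" where
  "tangent_space A p = {v.
     (\<forall>c. \<not> (c \<in> A \<and> p \<in> cdom c) \<longrightarrow> v c = 0) \<and>
     (\<forall>c\<in>A. \<forall>c'\<in>A. p \<in> cdom c \<inter> cdom c' \<longrightarrow>
        v c' = frechet_derivative (cmap c' \<circ> cinv c) (at (cmap c p)) (v c))}"

definition lincomb :: "real \<Rightarrow> ('m, 'k::finite) tvec \<Rightarrow> real \<Rightarrow> ('m, 'k) tvec \<Rightarrow> ('m, 'k) tvec" where
  "lincomb a v b w = (\<lambda>c. a *\<^sub>R v c + b *\<^sub>R w c)"

text \<open>The tangent vector at \<open>p\<close> with coordinates \<open>a\<close> in the chart \<open>c\<close>.\<close>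

definition coord_vec ::
  "('m::topological_space, 'k::finite) chart set \<Rightarrow> ('m, 'k) chart \<Rightarrow> 'm \<Rightarrow> real^'k \<Rightarrow> ('m, 'k) tvec" where
  "coord_vec A c p a = (\<lambda>c'. if c' \<in> A \<and> p \<in> cdom c'
     then frechet_derivative (cmap c' \<circ> cinv c) (at (cmap c p)) a else 0)"

definition tangent_map ::
  "('m::topological_space, 'k::finite) chart set \<Rightarrow> ('n::topological_space, 'l::finite) chart set
    \<Rightarrow> ('m \<Rightarrow> 'n) \<Rightarrow> 'm \<Rightarrow> ('m, 'k) tvec \<Rightarrow> ('n, 'l) tvec" where
  "tangent_map A B f x v = (\<lambda>d. if d \<in> B \<and> f x \<in> cdom d
     then let c = (SOME c. c \<in> A \<and> x \<in> cdom c)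
          in frechet_derivative (cmap d \<circ> f \<circ> cinv c) (at (cmap c x)) (v c)
     else 0)"

definition velocity ::
  "('n::topological_space, 'l::finite) chart set \<Rightarrow> (real \<Rightarrow> 'm \<Rightarrow> 'n) \<Rightarrow> real \<Rightarrow> 'm \<Rightarrow> ('n, 'l) tvec" where
  "velocity B F t x = (\<lambda>d. if d \<in> B \<and> F t x \<in> cdom d
     then vector_derivative (\<lambda>\<tau>. cmap d (F \<tau> x)) (at t) else 0)"

text \<open>The space of smooth sections of the pullback bundle of the tangent bundle along \<open>f\<close>.\<close>

definition sections_along ::
  "('m::topological_space, 'k::finite) chart set \<Rightarrow> ('n::topological_space, 'l::finite) chart set
    \<Rightarrow> ('m \<Rightarrow> 'n) \<Rightarrow> ('m \<Rightarrow> ('n, 'l) tvec) set" where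
  "sections_along A B f = {h. (\<forall>x. h x \<in> tangent_space B (f x)) \<and>
     (\<forall>c\<in>A. \<forall>d\<in>B. smooth_on (cmap c ` (cdom c \<inter> f -` cdom d)) (\<lambda>y. h (cinv c y) d))}"

definition vector_fields ::
  "('m::topological_space, 'k::finite) chart set \<Rightarrow> ('m \<Rightarrow> ('m, 'k) tvec) set" where
  "vector_fields A = sections_along A A id"

definition smooth_section_family ::
  "('m::topological_space, 'k::finite) chart set \<Rightarrow> ('n::topological_space, 'l::finite) chart set
    \<Rightarrow> 'p::real_normed_vector set \<Rightarrow> ('p \<Rightarrow> 'm \<Rightarrow> 'n) \<Rightarrow> ('p \<Rightarrow> 'm \<Rightarrow> ('n, 'l) tvec) \<Rightarrow> bool" where
  "smooth_section_family A B U F h \<longleftrightarrow>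
     (\<forall>p\<in>U. \<forall>x. h p x \<in> tangent_space B (F p x)) \<and>
     (\<forall>c\<in>A. \<forall>d\<in>B. smooth_on {(p, y). p \<in> U \<and> y \<in> cimg c \<and> F p (cinv c y) \<in> cdom d}
                        (\<lambda>(p, y). h p (cinv c y) d))"

definition immersions ::
  "('m::topological_space, 'k::finite) chart set \<Rightarrow> ('n::topological_space, 'l::finite) chart set
    \<Rightarrow> ('m \<Rightarrow> 'n) set" where
  "immersions A B = {f. smooth_map A B f \<and>
     (\<forall>x. inj_on (tangent_map A B f x) (tangent_space A x))}"


section \<open>Riemannian metric, Levi-Civita connection, volume\<close>

type_synonym ('n, 'l) metric = "'n \<Rightarrow> ('n, 'l) tvec \<Rightarrow> ('n, 'l) tvec \<Rightarrow> real"

definition metric_coord ::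
  "('n::topological_space, 'l::finite) chart set \<Rightarrow> ('n, 'l) metric \<Rightarrow> ('n, 'l) chart
    \<Rightarrow> real^'l \<Rightarrow> real^'l \<Rightarrow> real^'l \<Rightarrow> real" where
  "metric_coord B gb d y a b = gb (cinv d y) (coord_vec B d (cinv d y) a) (coord_vec B d (cinv d y) b)"

definition riemannian_metric ::
  "('n::topological_space, 'l::finite) chart set \<Rightarrow> ('n, 'l) metric \<Rightarrow> bool" where
  "riemannian_metric B gb \<longleftrightarrow>
     (\<forall>q. \<forall>u \<in> tangent_space B q. \<forall>v \<in> tangent_space B q.
        gb q u v = gb q v u \<and>
        (\<forall>w \<in> tangent_space B q. \<forall>a b. gb q (lincomb a u b v) w = a * gb q u w + b * gb q v w) \<and>
        (u \<noteq> (\<lambda>_. 0) \<longrightarrow> gb q u u > 0)) \<and>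
     (\<forall>d\<in>B. \<forall>a b. smooth_on (cimg d) (\<lambda>y. metric_coord B gb d y a b))"

text \<open>Christoffel map of the Levi-Civita connection in the chart \<open>d\<close>: the unique bilinear map that
  is symmetric (no torsion) and for which the connection is metric.\<close>

definition levi_civita ::
  "('n::topological_space, 'l::finite) chart set \<Rightarrow> ('n, 'l) metric \<Rightarrow> ('n, 'l) chart
    \<Rightarrow> real^'l \<Rightarrow> real^'l \<Rightarrow> real^'l \<Rightarrow> real^'l" where
  "levi_civita B gb d y = (THE \<Gamma>. bilinear \<Gamma> \<and> (\<forall>a b. \<Gamma> a b = \<Gamma> b a) \<and>
     (\<forall>e a b. frechet_derivative (\<lambda>z. metric_coord B gb d z a b) (at y) e
        = metric_coord B gb d y (\<Gamma> e a) b + metric_coord B gb d y a (\<Gamma> e b)))"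

text \<open>The covariant derivative in the parameter \<open>t\<close> of a curve \<open>h\<close> of vector fields along the
  curve \<open>F\<close> of maps, taken pointwise in \<open>x\<close>.\<close>

definition cov_deriv ::
  "('n::topological_space, 'l::finite) chart set \<Rightarrow> ('n, 'l) metric \<Rightarrow> (real \<Rightarrow> 'm \<Rightarrow> 'n)
    \<Rightarrow> (real \<Rightarrow> 'm \<Rightarrow> ('n, 'l) tvec) \<Rightarrow> real \<Rightarrow> 'm \<Rightarrow> ('n, 'l) tvec" where
  "cov_deriv B gb F h t x = (\<lambda>d. if d \<in> B \<and> F t x \<in> cdom d
     then vector_derivative (\<lambda>\<tau>. h \<tau> x d) (at t)
          + levi_civita B gb d (cmap d (F t x)) (velocity B F t x d) (h t x d)
     else 0)"

definition pullback_metric ::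
  "('m::topological_space, 'k::finite) chart set \<Rightarrow> ('n::topological_space, 'l::finite) chart set
    \<Rightarrow> ('n, 'l) metric \<Rightarrow> ('m \<Rightarrow> 'n) \<Rightarrow> ('m, 'k) metric" where
  "pullback_metric A B gb f x v w = gb (f x) (tangent_map A B f x v) (tangent_map A B f x w)"

text \<open>A density at a point is the family of its coefficients with respect to the Lebesgue measures
  of the charts around the point.\<close>

type_synonym ('m, 'k) dens = "('m, 'k) chart \<Rightarrow> real"

definition vol ::
  "('m::topological_space, 'k::finite) chart set \<Rightarrow> ('m, 'k) metric \<Rightarrow> 'm \<Rightarrow> ('m, 'k) dens" where
  "vol A g x = (\<lambda>c. if c \<in> A \<and> x \<in> cdom c
     then sqrt (det (\<chi> i j. metric_coord A g c (cmap c x) (axis i 1) (axis j 1))) else 0)"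

text \<open>Integral of a density over a compact manifold: cut the manifold along a finite list of charts
  into disjoint Borel pieces and integrate over the pieces in coordinates. By the change of
  variables formula the value does not depend on the list.\<close>

definition chart_cover :: "('m::topological_space, 'k::finite) chart set \<Rightarrow> ('m, 'k) chart list" where
  "chart_cover A = (SOME cs. set cs \<subseteq> A \<and> (\<Union>c\<in>set cs. cdom c) = UNIV)"

definition density_integral ::
  "('m::topological_space, 'k::finite) chart set \<Rightarrow> ('m \<Rightarrow> ('m, 'k) dens) \<Rightarrow> real" where
  "density_integral A \<mu> = (let cs = chart_cover A in
     \<Sum>i<length cs. LINT y : cmap (cs ! i) ` (cdom (cs ! i) - (\<Union>j<i. cdom (cs ! j))) | lborel.
       \<mu> (cinv (cs ! i) y) (cs ! i))"

text \<open>The $H^0$-metric: the integral of \<open>gb h k\<close> against the volume density of the pullback metric.\<close>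

definition H0 ::
  "('m::topological_space, 'k::finite) chart set \<Rightarrow> ('n::topological_space, 'l::finite) chart set
    \<Rightarrow> ('n, 'l) metric \<Rightarrow> ('m \<Rightarrow> 'n) \<Rightarrow> ('m \<Rightarrow> ('n, 'l) tvec) \<Rightarrow> ('m \<Rightarrow> ('n, 'l) tvec) \<Rightarrow> real" where
  "H0 A B gb f h k =
     density_integral A (\<lambda>x c. gb (f x) (h x) (k x) * vol A (pullback_metric A B gb f) x c)"


section \<open>Elliptic pseudo-differential operators\<close>

text \<open>Matrix valued symbols of class $S^r_{1,0}$ on $\mathbb{R}^k \times \mathbb{R}^k$, and the
  operator $\mathrm{Op}(a)u(x) = (2\pi)^{-k} \int e^{i x\cdot\xi} a(x,\xi)\, \hat u(\xi)\, d\xi$.\<close>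

definition symbol_class :: "real \<Rightarrow> ((real^'k) \<times> (real^'k) \<Rightarrow> complex^'l^'l) set" where
  "symbol_class r = {a. smooth_on UNIV a \<and>
     (\<forall>vs ws. set vs \<subseteq> Basis \<longrightarrow> set ws \<subseteq> Basis \<longrightarrow>
       (\<exists>C. \<forall>x \<xi>. norm (iter_deriv (map (\<lambda>v. (v, 0)) vs @ map (\<lambda>w. (0, w)) ws) a (x, \<xi>))
                  \<le> C * (1 + norm \<xi>) powr (r - real (length ws))))}"

definition fourier :: "(real^'k \<Rightarrow> real^'l) \<Rightarrow> real^'k \<Rightarrow> complex^'l" where
  "fourier u \<xi> = (\<chi> j. LINT y|lborel. cis (- (y \<bullet> \<xi>)) * of_real (u y $ j))"

definition pdo_apply ::
  "((real^'k) \<times> (real^'k) \<Rightarrow> complex^'l^'l) \<Rightarrow> (real^'k \<Rightarrow> real^'l) \<Rightarrow> real^'k \<Rightarrow> complex^'l" where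
  "pdo_apply a u y = (\<chi> i. of_real (1 / (2 * pi) ^ CARD('k)) *
     (LINT \<xi>|lborel. cis (y \<bullet> \<xi>) * ((a (y, \<xi>) *v fourier u \<xi>) $ i)))"

definition test_fun :: "(real^'k \<Rightarrow> real^'l) \<Rightarrow> bool" where
  "test_fun u \<longleftrightarrow> smooth_on UNIV u \<and> compact (closure {y. u y \<noteq> 0})"

definition supp :: "('m::topological_space \<Rightarrow> real) \<Rightarrow> 'm set" where
  "supp \<eta> = closure {x. \<eta> x \<noteq> 0}"

definition cutoff ::
  "('m::topological_space, 'k::finite) chart set \<Rightarrow> ('m \<Rightarrow> 'n) \<Rightarrow> ('m, 'k) chart \<Rightarrow> ('n, 'l::finite) chart
    \<Rightarrow> ('m \<Rightarrow> real) \<Rightarrow> bool" where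
  "cutoff A f c d \<eta> \<longleftrightarrow> smooth_scalar A \<eta> \<and> supp \<eta> \<subseteq> cdom c \<inter> f -` cdom d"

text \<open>The section along \<open>f\<close> with coordinate expression \<open>\<eta> u\<close> in the charts \<open>c\<close> and \<open>d\<close>,
  extended by zero.\<close>

definition local_section ::
  "('n::topological_space, 'l::finite) chart set \<Rightarrow> ('m \<Rightarrow> 'n) \<Rightarrow> ('m, 'k::finite) chart
    \<Rightarrow> ('n, 'l) chart \<Rightarrow> ('m \<Rightarrow> real) \<Rightarrow> (real^'k \<Rightarrow> real^'l) \<Rightarrow> 'm \<Rightarrow> ('n, 'l) tvec" where
  "local_section B f c d \<eta> u x = (if x \<in> cdom c \<inter> f -` cdom d
     then coord_vec B d (f x) (\<eta> x *\<^sub>R u (cmap c x)) else (\<lambda>_. 0))"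

text \<open>\<open>Q\<close> is an elliptic pseudo-differential operator of order \<open>r\<close> on the sections along \<open>f\<close>: off
  the diagonal the kernel is smooth; near the diagonal each localisation $\eta_1 Q \eta_2$ to a chart
  and a local frame has a symbol in $S^r_{1,0}$, which is invertible for large $\xi$ with inverse of
  order \<open>-r\<close>, locally uniformly where $\eta_1\eta_2 \neq 0$.\<close>

definition elliptic_pdo ::
  "('m::topological_space, 'k::finite) chart set \<Rightarrow> ('n::topological_space, 'l::finite) chart set
    \<Rightarrow> ('m \<Rightarrow> 'n) \<Rightarrow> real \<Rightarrow> (('m \<Rightarrow> ('n, 'l) tvec) \<Rightarrow> 'm \<Rightarrow> ('n, 'l) tvec) \<Rightarrow> bool" where
  "elliptic_pdo A B f r Q \<longleftrightarrow>
     (\<forall>c\<in>A. \<forall>d\<in>B. \<forall>c'\<in>A. \<forall>d'\<in>B. \<forall>\<eta>\<^sub>1 \<eta>\<^sub>2.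
        cutoff A f c d \<eta>\<^sub>1 \<longrightarrow> cutoff A f c' d' \<eta>\<^sub>2 \<longrightarrow> supp \<eta>\<^sub>1 \<inter> supp \<eta>\<^sub>2 = {} \<longrightarrow>
        (\<exists>K :: (real^'k) \<times> (real^'k) \<Rightarrow> real^'l^'l. smooth_on UNIV K \<and>
           (\<forall>u. test_fun u \<longrightarrow> (\<forall>x \<in> cdom c \<inter> f -` cdom d.
              \<eta>\<^sub>1 x *\<^sub>R Q (local_section B f c' d' \<eta>\<^sub>2 u) x d
              = (\<chi> i. LINT z|lborel. (K (cmap c x, z) *v u z) $ i))))) \<and>
     (\<forall>c\<in>A. \<forall>d\<in>B. \<forall>\<eta>\<^sub>1 \<eta>\<^sub>2. cutoff A f c d \<eta>\<^sub>1 \<longrightarrow> cutoff A f c d \<eta>\<^sub>2 \<longrightarrow>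
        (\<exists>a \<in> symbol_class r.
           (\<forall>u. test_fun u \<longrightarrow> (\<forall>x \<in> cdom c \<inter> f -` cdom d.
              (\<chi> i. of_real (\<eta>\<^sub>1 x * Q (local_section B f c d \<eta>\<^sub>2 u) x d $ i))
              = pdo_apply a u (cmap c x))) \<and>
           (\<forall>K. compact K \<longrightarrow> K \<subseteq> {x. \<eta>\<^sub>1 x * \<eta>\<^sub>2 x \<noteq> 0} \<longrightarrow>
              (\<exists>C>0. \<exists>R>0. \<forall>x\<in>K. \<forall>\<xi>. norm \<xi> \<ge> R \<longrightarrow>
                 (\<forall>v. C * norm \<xi> powr r * norm v \<le> norm (a (cmap c x, \<xi>) *v v))))))"


section \<open>The operator field P\<close>

text \<open>Smooth curves in the Frechet manifolds \<open>Imm(M, N)\<close> and \<open>T Imm(M, N)\<close>; since \<open>M\<close> is compact they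
  are the smooth maps on the product of the line with \<open>M\<close>. A map between such manifolds is smooth
  (in the convenient calculus) iff it maps smooth curves to smooth curves.\<close>

definition imm_curve ::
  "('m::topological_space, 'k::finite) chart set \<Rightarrow> ('n::topological_space, 'l::finite) chart set
    \<Rightarrow> (real \<Rightarrow> 'm \<Rightarrow> 'n) \<Rightarrow> bool" where
  "imm_curve A B F \<longleftrightarrow> smooth_family A B UNIV F \<and> (\<forall>t. F t \<in> immersions A B)"

definition linear_on_sections ::
  "('m \<Rightarrow> ('n, 'l::finite) tvec) set \<Rightarrow> (('m \<Rightarrow> ('n, 'l) tvec) \<Rightarrow> 'm \<Rightarrow> ('n, 'l) tvec) \<Rightarrow> bool" where
  "linear_on_sections \<S> L \<longleftrightarrow> (\<forall>h\<in>\<S>. L h \<in> \<S>) \<and>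
     (\<forall>h\<in>\<S>. \<forall>k\<in>\<S>. \<forall>a b. L (\<lambda>x. lincomb a (h x) b (k x)) = (\<lambda>x. lincomb a (L h x) b (L k x)))"

type_synonym ('m, 'n, 'l) operator_field =
  "('m \<Rightarrow> 'n) \<Rightarrow> ('m \<Rightarrow> ('n, 'l) tvec) \<Rightarrow> ('m \<Rightarrow> ('n, 'l) tvec)"

text \<open>A smooth section of the bundle of linear endomorphisms of \<open>T Imm\<close>.\<close>

definition smooth_operator_field ::
  "('m::topological_space, 'k::finite) chart set \<Rightarrow> ('n::topological_space, 'l::finite) chart set
    \<Rightarrow> ('m, 'n, 'l) operator_field \<Rightarrow> bool" where
  "smooth_operator_field A B P \<longleftrightarrow>
     (\<forall>f \<in> immersions A B. linear_on_sections (sections_along A B f) (P f)) \<and>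
     (\<forall>F h. imm_curve A B F \<longrightarrow> smooth_section_family A B UNIV F h \<longrightarrow>
        smooth_section_family A B UNIV F (\<lambda>t. P (F t) (h t)))"

text \<open>A smooth section of the bundle of bilinear maps from \<open>T Imm \<times> T Imm\<close> to \<open>T Imm\<close>.\<close>

definition smooth_bilinear_field ::
  "('m::topological_space, 'k::finite) chart set \<Rightarrow> ('n::topological_space, 'l::finite) chart set
    \<Rightarrow> (('m \<Rightarrow> 'n) \<Rightarrow> ('m \<Rightarrow> ('n, 'l) tvec) \<Rightarrow> ('m \<Rightarrow> ('n, 'l) tvec) \<Rightarrow> ('m \<Rightarrow> ('n, 'l) tvec)) \<Rightarrow> bool" where
  "smooth_bilinear_field A B T \<longleftrightarrow>
     (\<forall>f \<in> immersions A B. \<forall>h \<in> sections_along A B f.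
        linear_on_sections (sections_along A B f) (\<lambda>k. T f h k) \<and>
        linear_on_sections (sections_along A B f) (\<lambda>k. T f k h)) \<and>
     (\<forall>F h k. imm_curve A B F \<longrightarrow> smooth_section_family A B UNIV F h \<longrightarrow>
        smooth_section_family A B UNIV F k \<longrightarrow>
        smooth_section_family A B UNIV F (\<lambda>t. T (F t) (h t) (k t)))"

text \<open>$(\nabla_m P)(h) = \nabla_m(P(h)) - P(\nabla_m h)$ along a curve \<open>F\<close> of immersions, with
  $m = \partial_t F$.\<close>

definition nabla_op ::
  "('n::topological_space, 'l::finite) chart set \<Rightarrow> ('n, 'l) metric \<Rightarrow> ('m, 'n, 'l) operator_field
    \<Rightarrow> (real \<Rightarrow> 'm \<Rightarrow> 'n) \<Rightarrow> (real \<Rightarrow> 'm \<Rightarrow> ('n, 'l) tvec) \<Rightarrow> real \<Rightarrow> 'm \<Rightarrow> ('n, 'l) tvec" where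
  "nabla_op B gb P F h t x =
     lincomb 1 (cov_deriv B gb F (\<lambda>\<tau>. P (F \<tau>) (h \<tau>)) t x)
             (-1) (P (F t) (cov_deriv B gb F h t) x)"

definition is_adjoint_nabla ::
  "('m::topological_space, 'k::finite) chart set \<Rightarrow> ('n::topological_space, 'l::finite) chart set
    \<Rightarrow> ('n, 'l) metric \<Rightarrow> ('m, 'n, 'l) operator_field
    \<Rightarrow> (('m \<Rightarrow> 'n) \<Rightarrow> ('m \<Rightarrow> ('n, 'l) tvec) \<Rightarrow> ('m \<Rightarrow> ('n, 'l) tvec) \<Rightarrow> ('m \<Rightarrow> ('n, 'l) tvec)) \<Rightarrow> bool" where
  "is_adjoint_nabla A B gb P Adj \<longleftrightarrow>
     (\<forall>F h t. imm_curve A B F \<longrightarrow> smooth_section_family A B UNIV F h \<longrightarrow>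
        (\<forall>k \<in> sections_along A B (F t).
           H0 A B gb (F t) (nabla_op B gb P F h t) k
           = H0 A B gb (F t) (velocity B F t) (Adj (F t) (h t) k)))"

definition sobolev_operator ::
  "('m::topological_space, 'k::finite) chart set \<Rightarrow> ('n::topological_space, 'l::finite) chart set
    \<Rightarrow> ('n, 'l) metric \<Rightarrow> ('m, 'n, 'l) operator_field \<Rightarrow> bool" where
  "sobolev_operator A B gb P \<longleftrightarrow>
     smooth_operator_field A B P \<and>
     (\<forall>f \<in> immersions A B.
        (\<exists>r. elliptic_pdo A B f r (P f)) \<and>
        (\<forall>h \<in> sections_along A B f. \<forall>k \<in> sections_along A B f.
           H0 A B gb f (P f h) k = H0 A B gb f h (P f k)) \<and>
        (\<forall>h \<in> sections_along A B f. h \<noteq> (\<lambda>_ _. 0) \<longrightarrow> H0 A B gb f (P f h) h > 0) \<and>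
        (\<forall>\<phi> \<in> diffeos A. \<forall>h \<in> sections_along A B f. P f h \<circ> \<phi> = P (f \<circ> \<phi>) (h \<circ> \<phi>))) \<and>
     (\<exists>Adj. smooth_bilinear_field A B Adj \<and> is_adjoint_nabla A B gb P Adj)"


section \<open>Geodesics and momenta\<close>

definition sobolev_metric ::
  "('m::topological_space, 'k::finite) chart set \<Rightarrow> ('n::topological_space, 'l::finite) chart set
    \<Rightarrow> ('n, 'l) metric \<Rightarrow> ('m, 'n, 'l) operator_field
    \<Rightarrow> ('m \<Rightarrow> 'n) \<Rightarrow> ('m \<Rightarrow> ('n, 'l) tvec) \<Rightarrow> ('m \<Rightarrow> ('n, 'l) tvec) \<Rightarrow> real" where
  "sobolev_metric A B gb P f h k = H0 A B gb f (P f h) k"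

definition energy ::
  "('m::topological_space, 'k::finite) chart set \<Rightarrow> ('n::topological_space, 'l::finite) chart set
    \<Rightarrow> ('n, 'l) metric \<Rightarrow> ('m, 'n, 'l) operator_field \<Rightarrow> real \<Rightarrow> real \<Rightarrow> (real \<Rightarrow> 'm \<Rightarrow> 'n) \<Rightarrow> real" where
  "energy A B gb P a b f =
     1/2 * integral {a..b} (\<lambda>t. sobolev_metric A B gb P (f t) (velocity B f t) (velocity B f t))"

text \<open>Smoothness on a closed time interval is smoothness on an open neighbourhood of it.\<close>

definition imm_path ::
  "('m::topological_space, 'k::finite) chart set \<Rightarrow> ('n::topological_space, 'l::finite) chart set
    \<Rightarrow> real \<Rightarrow> real \<Rightarrow> (real \<Rightarrow> 'm \<Rightarrow> 'n) \<Rightarrow> bool" where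
  "imm_path A B a b f \<longleftrightarrow>
     (\<exists>e>0. smooth_family A B {a-e<..<b+e} f) \<and> (\<forall>t\<in>{a..b}. f t \<in> immersions A B)"

definition variation ::
  "('m::topological_space, 'k::finite) chart set \<Rightarrow> ('n::topological_space, 'l::finite) chart set
    \<Rightarrow> real \<Rightarrow> real \<Rightarrow> (real \<Rightarrow> 'm \<Rightarrow> 'n) \<Rightarrow> (real \<Rightarrow> real \<Rightarrow> 'm \<Rightarrow> 'n) \<Rightarrow> bool" where
  "variation A B a b f F \<longleftrightarrow>
     (\<exists>e>0. smooth_family A B ({-e<..<e} \<times> {a-e<..<b+e}) (\<lambda>(s, t). F s t) \<and>
        (\<forall>s\<in>{-e<..<e}. (\<forall>t\<in>{a..b}. F s t \<in> immersions A B) \<and> F s a = f a \<and> F s b = f b)) \<and>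
     (\<forall>t\<in>{a..b}. F 0 t = f t)"

definition geodesic ::
  "('m::topological_space, 'k::finite) chart set \<Rightarrow> ('n::topological_space, 'l::finite) chart set
    \<Rightarrow> ('n, 'l) metric \<Rightarrow> ('m, 'n, 'l) operator_field \<Rightarrow> real \<Rightarrow> real \<Rightarrow> (real \<Rightarrow> 'm \<Rightarrow> 'n) \<Rightarrow> bool" where
  "geodesic A B gb P a b f \<longleftrightarrow> imm_path A B a b f \<and>
     (\<forall>F. variation A B a b f F \<longrightarrow>
        ((\<lambda>s. energy A B gb P a b (F s)) has_real_derivative 0) (at 0))"

text \<open>The tangential part $h^\top \in \mathfrak{X}(M)$ of a section \<open>h\<close> along the immersion \<open>f\<close>.\<close>

definition tan_part ::
  "('m::topological_space, 'k::finite) chart set \<Rightarrow> ('n::topological_space, 'l::finite) chart set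
    \<Rightarrow> ('n, 'l) metric \<Rightarrow> ('m \<Rightarrow> 'n) \<Rightarrow> ('m \<Rightarrow> ('n, 'l) tvec) \<Rightarrow> 'm \<Rightarrow> ('m, 'k) tvec" where
  "tan_part A B gb f h x = (THE v. v \<in> tangent_space A x \<and>
     (\<forall>w \<in> tangent_space A x.
        gb (f x) (lincomb 1 (h x) (-1) (tangent_map A B f x v)) (tangent_map A B f x w) = 0))"

text \<open>$g(Y)\,\mathrm{vol}(g)$ as a section of $T^*M \otimes \mathrm{vol}(M)$, whose fibre at \<open>x\<close> is
  the space of linear maps from the tangent space to the densities at \<open>x\<close> (set to \<open>0\<close> outside the
  tangent space).\<close>

definition flat_vol ::
  "('m::topological_space, 'k::finite) chart set \<Rightarrow> ('m, 'k) metric \<Rightarrow> ('m \<Rightarrow> ('m, 'k) tvec)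
    \<Rightarrow> 'm \<Rightarrow> ('m, 'k) tvec \<Rightarrow> ('m, 'k) dens" where
  "flat_vol A g Y x v = (\<lambda>c. if v \<in> tangent_space A x then g x (Y x) v * vol A g x c else 0)"

text \<open>\<open>\<phi>\<close> is a smooth curve in \<open>Diff(M)\<close> through the identity with initial velocity \<open>X\<close>.\<close>

definition diff_curve ::
  "('m::topological_space, 'k::finite) chart set \<Rightarrow> (real \<Rightarrow> 'm \<Rightarrow> 'm) \<Rightarrow> ('m \<Rightarrow> ('m, 'k) tvec) \<Rightarrow> bool" where
  "diff_curve A \<phi> X \<longleftrightarrow>
     (\<exists>e>0. smooth_family A A {-e<..<e} \<phi> \<and> (\<forall>s\<in>{-e<..<e}. \<phi> s \<in> diffeos A)) \<and>
     \<phi> 0 = id \<and> velocity A \<phi> 0 = X"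

text \<open>The momentum mapping of the right action of \<open>Diff(M)\<close> on \<open>Imm(M, N)\<close> at the tangent vector \<open>h\<close>
  with foot point \<open>f\<close>, paired with the generator of the curve \<open>\<phi>\<close>: the inner product of the
  infinitesimal action $\partial_s|_0 (f \circ \varphi_s)$ with \<open>h\<close>.\<close>

definition reparam_momentum ::
  "('m::topological_space, 'k::finite) chart set \<Rightarrow> ('n::topological_space, 'l::finite) chart set
    \<Rightarrow> ('n, 'l) metric \<Rightarrow> ('m, 'n, 'l) operator_field
    \<Rightarrow> ('m \<Rightarrow> 'n) \<Rightarrow> ('m \<Rightarrow> ('n, 'l) tvec) \<Rightarrow> (real \<Rightarrow> 'm \<Rightarrow> 'm) \<Rightarrow> real" where
  "reparam_momentum A B gb P f h \<phi> = sobolev_metric A B gb P f (velocity B (\<lambda>s. f \<circ> \<phi> s) 0) h"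

end

theory Submission
  imports Defs "HOL-Real_Asymp.Real_Asymp"
begin

text \<open>
  The conservation law is Noether's theorem for the right action of \<open>Diff(M)\<close>. Reparametrizing a
  path of immersions by a fixed diffeomorphism does not change its energy, so a reparametrization
  that depends on time changes the energy only through its time derivative.

  Let $\varphi_\sigma$ be a curve of diffeomorphisms with $\varphi_0 = id$, put
  $Y_\sigma = (\partial_\sigma \varphi_\sigma) \circ \varphi_\sigma^{-1}$, and let $\eta$ be a
  function of time that vanishes at \<open>a\<close> and \<open>b\<close>. The variation
  $F(s,t) = f(t) \circ \varphi_{s\eta(t)}$ of the geodesic \<open>f\<close> has fixed endpoints and
  $\partial_t F = (f_t + s\,\eta'\,Tf.Y_{s\eta}) \circ \varphi_{s\eta}$ (lemma \<open>velocity_comp\<close>).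
  Invariance of the metric (\<open>G_invariant\<close>) removes the outer $\varphi_{s\eta}$, and positivity
  (\<open>G_tangent_bound\<close>) gives
  $$G(\partial_t F, \partial_t F) \ge G(f_t, f_t)
      + 2 s\,\eta' \int_M \bar g(P f_t, Tf.Y_{s\eta})\,vol(g).$$
  Positivity thus takes the place of a bound on the term quadratic in \<open>s\<close>, in which \<open>P\<close> is
  evaluated along a two-parameter family. Replacing $Y_{s\eta}$ by $Y_0$ costs a multiple of $s^2$.
  With $m(t)$ the momentum of $f_t$ paired with $Y_0$, the energy therefore lies above a parabola in
  \<open>s\<close> that touches it at 0 with slope $\int \eta' m$. The energy is critical at 0, so this
  slope vanishes (\<open>smeared_momentum_stationary\<close>); as $\eta$ is arbitrary, \<open>m\<close> is constant
  (\<open>du_bois_reymond\<close>).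

  It suffices to do this for the fields $Y_0 = \omega e$ with a bump function $\omega$ and a constant
  vector \<open>e\<close> in a chart. For these, $\varphi_\sigma(y) = y + \sigma\,\omega(y)\,e$ is explicit and
  no flow has to be integrated (\<open>chart_push_exists\<close>). Concentrating the bump at a point shows that the
  coefficients of the density $g((P f_t)^\top)\,vol(g)$ are constant in time
  (\<open>momentum_density_conserved\<close>). This is the second form of the claim, and the first one follows from it
  by integration over \<open>M\<close>.

  The integral over \<open>M\<close> is defined by cutting along charts. That it is invariant under
  diffeomorphisms and can be computed in a single chart when the density is supported there follows
  from the change of variables formula on a common refinement of two partitions
  (\<open>density_integral_pullback\<close>).
\<close>

section \<open>Calculus of smooth functions on normed spaces\<close>

lemma Ck_on_cong:
  assumes "open S" "\<And>x. x \<in> S \<Longrightarrow> f x = g x" "Ck_on k S f"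
  shows "Ck_on k S g"
  using assms(2,3)
proof (induction k arbitrary: f g)
  case 0
  then show ?case by (auto intro: continuous_on_eq)
next
  case (Suc k)
  have d: "(g has_derivative frechet_derivative f (at x)) (at x)" if "x \<in> S" for x
  proof (rule has_derivative_transform_within_open[OF _ \<open>open S\<close> that])
    show "(f has_derivative frechet_derivative f (at x)) (at x)"
      using Suc.prems(2) that by (simp flip: frechet_derivative_works)
  qed (rule Suc.prems(1))
  then have e: "frechet_derivative g (at x) = frechet_derivative f (at x)" if "x \<in> S" for x
    using that frechet_derivative_at by metis
  have "Ck_on k S (\<lambda>x. frechet_derivative g (at x) v)" for v
    by (rule Suc.IH[of "\<lambda>x. frechet_derivative f (at x) v"]) (use Suc.prems(2) e in auto)
  moreover have "g differentiable (at x)" if "x \<in> S" for x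
    using d[OF that] by (auto simp: differentiable_def)
  ultimately show ?case by simp
qed

lemma Ck_on_SucI:
  assumes "open S" "\<And>x. x \<in> S \<Longrightarrow> (f has_derivative f' x) (at x)" "\<And>v. Ck_on k S (\<lambda>x. f' x v)"
  shows "Ck_on (Suc k) S f"
proof -
  have "frechet_derivative f (at x) = f' x" if "x \<in> S" for x
    using assms(2)[OF that] frechet_derivative_at by metis
  then have "Ck_on k S (\<lambda>x. frechet_derivative f (at x) v)" for v
    by (intro Ck_on_cong[OF \<open>open S\<close> _ assms(3)]) auto
  moreover have "f differentiable (at x)" if "x \<in> S" for x
    using assms(2)[OF that] by (auto simp: differentiable_def)
  ultimately show ?thesis by simp
qed

lemma Ck_on_deriv:
  assumes "Ck_on (Suc k) S f" "x \<in> S"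
  shows "(f has_derivative frechet_derivative f (at x)) (at x)"
  using assms by (simp add: frechet_derivative_works)

lemma Ck_on_mono: "T \<subseteq> S \<Longrightarrow> Ck_on k S f \<Longrightarrow> Ck_on k T f"
proof (induction k arbitrary: f)
  case 0
  then show ?case using continuous_on_subset by auto
next
  case (Suc k)
  then show ?case by (simp add: subset_iff)
qed

lemma Ck_on_SucD: "Ck_on (Suc k) S f \<Longrightarrow> Ck_on k S f"
proof (induction k arbitrary: f)
  case 0
  then show ?case
    by (simp add: continuous_at_imp_continuous_on differentiable_imp_continuous_within)
next
  case (Suc k)
  have "Ck_on k S (\<lambda>x. frechet_derivative f (at x) v)" for v
    using Suc.prems by (intro Suc.IH) (auto simp only: Ck_on.simps)
  then show ?case using Suc.prems by simp
qed

lemma Ck_on_local: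
  assumes "\<And>x. x \<in> S \<Longrightarrow> \<exists>T. open T \<and> x \<in> T \<and> Ck_on k T f"
  shows "Ck_on k S f"
  using assms
proof (induction k arbitrary: f)
  case 0
  then show ?case
    by (metis Ck_on.simps(1) continuous_at_imp_continuous_on continuous_on_eq_continuous_at)
next
  case (Suc k)
  have "Ck_on k S (\<lambda>x. frechet_derivative f (at x) v)" for v
  proof (rule Suc.IH)
    fix x assume "x \<in> S"
    then obtain T where "open T" "x \<in> T" "Ck_on (Suc k) T f" using Suc.prems by blast
    then show "\<exists>T. open T \<and> x \<in> T \<and> Ck_on k T (\<lambda>x. frechet_derivative f (at x) v)" by auto
  qed
  moreover have "f differentiable (at x)" if "x \<in> S" for x
    using Suc.prems[OF that] by auto
  ultimately show ?case by simp
qed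

lemma Ck_on_const: "open S \<Longrightarrow> Ck_on k S (\<lambda>x. c)"
proof (induction k arbitrary: c)
  case (Suc k)
  then show ?case by (intro Ck_on_SucI[where f'="\<lambda>_ _. 0"]) (auto intro!: derivative_eq_intros)
qed auto

lemma Ck_on_bounded_linear: "bounded_linear L \<Longrightarrow> open S \<Longrightarrow> Ck_on k S L"
proof (induction k)
  case 0
  then show ?case by (simp add: linear_continuous_on)
next
  case (Suc k)
  then show ?case
    by (intro Ck_on_SucI[where f'="\<lambda>_. L"] Ck_on_const) (auto intro: bounded_linear_imp_has_derivative)
qed

lemma Ck_on_linear_compose:
  assumes "bounded_linear L" "open S" "Ck_on k S f"
  shows "Ck_on k S (\<lambda>x. L (f x))"
  using assms(3)
proof (induction k arbitrary: f)
  case 0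
  then show ?case
    using assms(1) by (auto intro: continuous_on_compose2[OF linear_continuous_on[of L UNIV]])
next
  case (Suc k)
  show ?case
    using Suc.prems by (intro Ck_on_SucI[OF \<open>open S\<close>, where f'="\<lambda>x v. L (frechet_derivative f (at x) v)"] Suc.IH)
       (auto intro!: bounded_linear.has_derivative[OF assms(1)] simp: frechet_derivative_works)
qed

lemma Ck_on_add:
  assumes "open S" "Ck_on k S f" "Ck_on k S g"
  shows "Ck_on k S (\<lambda>x. f x + g x)"
  using assms(2,3)
proof (induction k arbitrary: f g)
  case 0
  then show ?case by (auto intro: continuous_on_add)
next
  case (Suc k)
  show ?case
    using Suc.prems by (intro Ck_on_SucI[OF \<open>open S\<close>,
      where f'="\<lambda>x v. frechet_derivative f (at x) v + frechet_derivative g (at x) v"] Suc.IH)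
       (auto intro!: has_derivative_add simp: frechet_derivative_works)
qed

lemma Ck_on_Pair:
  assumes "open S" "Ck_on k S f" "Ck_on k S g"
  shows "Ck_on k S (\<lambda>x. (f x, g x))"
  using assms(2,3)
proof (induction k arbitrary: f g)
  case 0
  then show ?case by (auto intro: continuous_on_Pair)
next
  case (Suc k)
  show ?case
    using Suc.prems by (intro Ck_on_SucI[OF \<open>open S\<close>,
      where f'="\<lambda>x v. (frechet_derivative f (at x) v, frechet_derivative g (at x) v)"] Suc.IH)
       (auto intro!: has_derivative_Pair simp: frechet_derivative_works)
qed

lemma Ck_on_sum:
  assumes "open S" "\<And>i. i \<in> I \<Longrightarrow> Ck_on k S (f i)"
  shows "Ck_on k S (\<lambda>x. \<Sum>i\<in>I. f i x)"
  using assms(2)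
  by (induction I rule: infinite_finite_induct) (auto intro: Ck_on_const Ck_on_add assms(1))

lemma Ck_on_scaleR:
  fixes f :: "_ \<Rightarrow> real"
  assumes "open S" "Ck_on k S f" "Ck_on k S g"
  shows "Ck_on k S (\<lambda>x. f x *\<^sub>R g x)"
  using assms(2,3)
proof (induction k arbitrary: f g)
  case 0
  then show ?case by (auto intro: continuous_on_scaleR)
next
  case (Suc k)
  have "Ck_on k S f" "Ck_on k S g" using Suc.prems Ck_on_SucD by blast+
  then show ?case
    using Suc.prems by (intro Ck_on_SucI[OF \<open>open S\<close>,
      where f'="\<lambda>x v. f x *\<^sub>R frechet_derivative g (at x) v + frechet_derivative f (at x) v *\<^sub>R g x"]
      Ck_on_add[OF \<open>open S\<close>] Suc.IH)
       (auto intro!: has_derivative_scaleR simp: frechet_derivative_works)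
qed

text \<open>The derivative of \<open>g \<circ> f\<close> in a fixed direction is expanded over a basis of
  the middle space, so that every summand is a product of functions to which the induction
  hypothesis applies.\<close>

lemma Ck_on_compose:
  fixes f :: "'a::real_normed_vector \<Rightarrow> 'b::euclidean_space"
  assumes "open S" "Ck_on k S f" "Ck_on k T g" "\<And>x. x \<in> S \<Longrightarrow> f x \<in> T"
  shows "Ck_on k S (\<lambda>x. g (f x))"
  using assms(2,3)
proof (induction k arbitrary: g)
  case 0
  then show ?case using assms(4) by (auto intro: continuous_on_compose2)
next
  case (Suc k)
  define f' where "f' = (\<lambda>x. frechet_derivative f (at x))"
  define g' where "g' = (\<lambda>x. frechet_derivative g (at x))"
  have f': "(f has_derivative f' x) (at x)" if "x \<in> S" for x
    using Suc.prems(1) that Ck_on_deriv f'_def by blast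
  have g': "(g has_derivative g' x) (at x)" if "x \<in> T" for x
    using Suc.prems(2) that Ck_on_deriv g'_def by blast
  show ?case
  proof (rule Ck_on_SucI[OF \<open>open S\<close>, where f'="\<lambda>x v. \<Sum>b\<in>Basis. (f' x v \<bullet> b) *\<^sub>R g' (f x) b"])
    fix x assume x: "x \<in> S"
    have "((\<lambda>x. g (f x)) has_derivative (\<lambda>v. g' (f x) (f' x v))) (at x)"
      using f'[OF x] g'[OF assms(4)[OF x]] by (rule has_derivative_compose)
    moreover have "g' (f x) w = (\<Sum>b\<in>Basis. (w \<bullet> b) *\<^sub>R g' (f x) b)" for w
    proof -
      interpret bounded_linear "g' (f x)"
        using g'[OF assms(4)[OF x]] by (rule has_derivative_bounded_linear)
      have "g' (f x) w = g' (f x) (\<Sum>b\<in>Basis. (w \<bullet> b) *\<^sub>R b)" by (simp add: euclidean_representation)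
      then show ?thesis by (simp add: sum scale)
    qed
    ultimately show "((\<lambda>x. g (f x)) has_derivative (\<lambda>v. \<Sum>b\<in>Basis. (f' x v \<bullet> b) *\<^sub>R g' (f x) b)) (at x)"
      by (rule has_derivative_eq_rhs[OF _ ext])
  next
    fix v
    have "Ck_on k S (\<lambda>x. f' x v \<bullet> b)" for b
      using Suc.prems(1) by (intro Ck_on_linear_compose[OF bounded_linear_inner_left \<open>open S\<close>]) (simp add: f'_def)
    moreover have "Ck_on k S (\<lambda>x. g' (f x) b)" for b
      by (rule Suc.IH[OF Ck_on_SucD[OF Suc.prems(1)]]) (use Suc.prems(2) in \<open>simp add: g'_def\<close>)
    ultimately show "Ck_on k S (\<lambda>x. \<Sum>b\<in>Basis. (f' x v \<bullet> b) *\<^sub>R g' (f x) b)"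
      by (intro Ck_on_sum Ck_on_scaleR \<open>open S\<close>)
  qed
qed

lemma Ck_on_inverse:
  "Ck_on k {x::real. x \<noteq> 0} inverse"
proof (induction k)
  case 0
  then show ?case by (auto intro!: continuous_intros)
next
  case (Suc k)
  have o: "open {x::real. x \<noteq> 0}" by (simp add: open_Collect_neq)
  show ?case
  proof (rule Ck_on_SucI[OF o, where f'="\<lambda>x v. inverse x *\<^sub>R (- v) *\<^sub>R inverse x"])
    show "(inverse has_derivative (\<lambda>v. inverse x *\<^sub>R (- v) *\<^sub>R inverse x)) (at x)"
      if "x \<in> {x::real. x \<noteq> 0}" for x
      using that by (auto intro!: derivative_eq_intros)
    show "Ck_on k {x. x \<noteq> 0} (\<lambda>x. inverse x *\<^sub>R (- v) *\<^sub>R inverse x)" for v :: real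
      by (intro Ck_on_scaleR o Ck_on_const Suc)
  qed
qed

lemma smooth_on_cong: "open S \<Longrightarrow> (\<And>x. x \<in> S \<Longrightarrow> f x = g x) \<Longrightarrow> smooth_on S f \<Longrightarrow> smooth_on S g"
  unfolding smooth_on_def using Ck_on_cong by blast
lemma smooth_on_mono: "T \<subseteq> S \<Longrightarrow> smooth_on S f \<Longrightarrow> smooth_on T f"
  unfolding smooth_on_def using Ck_on_mono by blast
lemma smooth_on_local: "(\<And>x. x \<in> S \<Longrightarrow> \<exists>T. open T \<and> x \<in> T \<and> smooth_on T f) \<Longrightarrow> smooth_on S f"
  unfolding smooth_on_def by (meson Ck_on_local)
lemma smooth_on_const: "open S \<Longrightarrow> smooth_on S (\<lambda>x. c)"
  unfolding smooth_on_def using Ck_on_const by blast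
lemma smooth_on_bounded_linear: "bounded_linear L \<Longrightarrow> open S \<Longrightarrow> smooth_on S L"
  unfolding smooth_on_def using Ck_on_bounded_linear by blast
lemma smooth_on_linear_compose: "bounded_linear L \<Longrightarrow> open S \<Longrightarrow> smooth_on S f \<Longrightarrow> smooth_on S (\<lambda>x. L (f x))"
  unfolding smooth_on_def using Ck_on_linear_compose by blast
lemma smooth_on_add: "open S \<Longrightarrow> smooth_on S f \<Longrightarrow> smooth_on S g \<Longrightarrow> smooth_on S (\<lambda>x. f x + g x)"
  unfolding smooth_on_def using Ck_on_add by blast
lemma smooth_on_Pair: "open S \<Longrightarrow> smooth_on S f \<Longrightarrow> smooth_on S g \<Longrightarrow> smooth_on S (\<lambda>x. (f x, g x))"
  unfolding smooth_on_def using Ck_on_Pair by blast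
lemma smooth_on_sum: "open S \<Longrightarrow> (\<And>i. i \<in> I \<Longrightarrow> smooth_on S (f i)) \<Longrightarrow> smooth_on S (\<lambda>x. \<Sum>i\<in>I. f i x)"
  unfolding smooth_on_def by (simp add: Ck_on_sum)
lemma smooth_on_scaleR: "open S \<Longrightarrow> smooth_on S f \<Longrightarrow> smooth_on S g \<Longrightarrow> smooth_on S (\<lambda>x. (f x :: real) *\<^sub>R g x)"
  unfolding smooth_on_def using Ck_on_scaleR by blast
lemma smooth_on_compose:
  fixes f :: "'a::real_normed_vector \<Rightarrow> 'b::euclidean_space"
  shows "open S \<Longrightarrow> smooth_on S f \<Longrightarrow> smooth_on T g \<Longrightarrow> (\<And>x. x \<in> S \<Longrightarrow> f x \<in> T) \<Longrightarrow> smooth_on S (\<lambda>x. g (f x))"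
  unfolding smooth_on_def using Ck_on_compose by blast
lemma smooth_on_inverse: "smooth_on {x::real. x \<noteq> 0} inverse"
  unfolding smooth_on_def using Ck_on_inverse by blast

lemma smooth_on_ident: "open S \<Longrightarrow> smooth_on S (\<lambda>x. x)"
  by (rule smooth_on_bounded_linear[OF bounded_linear_ident])

lemma smooth_on_imp_continuous: "smooth_on S f \<Longrightarrow> continuous_on S f"
  unfolding smooth_on_def by (metis Ck_on.simps(1))

lemma smooth_on_deriv:
  "smooth_on S f \<Longrightarrow> x \<in> S \<Longrightarrow> (f has_derivative frechet_derivative f (at x)) (at x)"
  unfolding smooth_on_def using Ck_on_deriv by blast

lemma smooth_on_frechet: "smooth_on S f \<Longrightarrow> smooth_on S (\<lambda>x. frechet_derivative f (at x) v)"
  unfolding smooth_on_def by (metis Ck_on.simps(2))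

lemma smooth_onI:
  assumes "open S" "\<And>x. x \<in> S \<Longrightarrow> (f has_derivative f' x) (at x)" "\<And>v. smooth_on S (\<lambda>x. f' x v)"
  shows "smooth_on S f"
  unfolding smooth_on_def
proof
  fix k
  have "Ck_on (Suc k) S f"
    using assms by (intro Ck_on_SucI) (auto simp: smooth_on_def)
  then show "Ck_on k S f" by (rule Ck_on_SucD)
qed

text \<open>Smoothness is defined through derivatives in constant directions; expanding the direction over a
  basis reduces variable directions to constant ones. The next lemma does the same for
  continuity.\<close>

lemma smooth_on_frechet_dir:
  fixes f :: "'a::euclidean_space \<Rightarrow> 'b::real_normed_vector"
  assumes "open S" "smooth_on S f" "smooth_on S w"
  shows "smooth_on S (\<lambda>x. frechet_derivative f (at x) (w x))"
proof (rule smooth_on_cong[OF \<open>open S\<close>])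
  fix x assume x: "x \<in> S"
  interpret bounded_linear "frechet_derivative f (at x)"
    using smooth_on_deriv[OF assms(2) x] by (rule has_derivative_bounded_linear)
  have "frechet_derivative f (at x) (w x) = frechet_derivative f (at x) (\<Sum>b\<in>Basis. (w x \<bullet> b) *\<^sub>R b)"
    by (simp add: euclidean_representation)
  then show "(\<Sum>b\<in>Basis. (w x \<bullet> b) *\<^sub>R frechet_derivative f (at x) b) = frechet_derivative f (at x) (w x)"
    by (simp add: sum scale)
next
  show "smooth_on S (\<lambda>x. \<Sum>b\<in>Basis. (w x \<bullet> b) *\<^sub>R frechet_derivative f (at x) b)"
    using assms by (intro smooth_on_sum smooth_on_scaleR smooth_on_frechet
        smooth_on_linear_compose[OF bounded_linear_inner_left]) auto
qed

lemma continuous_on_linear_dir: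
  fixes L :: "'q::topological_space \<Rightarrow> 'a::euclidean_space \<Rightarrow> 'b::real_normed_vector"
  assumes "\<And>x. x \<in> S \<Longrightarrow> bounded_linear (L x)" "\<And>v. continuous_on S (\<lambda>x. L x v)" "continuous_on S w"
  shows "continuous_on S (\<lambda>x. L x (w x))"
proof (rule continuous_on_eq)
  fix x assume x: "x \<in> S"
  interpret bounded_linear "L x" by (rule assms(1)[OF x])
  have "L x (w x) = L x (\<Sum>b\<in>Basis. (w x \<bullet> b) *\<^sub>R b)"
    by (simp add: euclidean_representation)
  then show "(\<Sum>b\<in>Basis. (w x \<bullet> b) *\<^sub>R L x b) = L x (w x)"
    by (simp add: sum scale)
next
  show "continuous_on S (\<lambda>x. \<Sum>b\<in>Basis. (w x \<bullet> b) *\<^sub>R L x b)"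
    using assms by (intro continuous_intros) auto
qed

section \<open>Bump functions\<close>

text \<open>The functions $e^{-1/r} r^{-n}$, extended by 0. The exponent \<open>n\<close> is a parameter
  because the family is closed under differentiation while no single member is.\<close>

definition flat_exp :: "nat \<Rightarrow> real \<Rightarrow> real" where
  "flat_exp n r = (if r > 0 then exp (- (1/r)) / r ^ n else 0)"

text \<open>Because the derivative stays in the family, smoothness of all its members follows by a single
  induction. Only the derivative at 0, where the exponential beats every power, is not
  elementary.\<close>

lemma flat_exp_deriv:
  "(flat_exp n has_real_derivative (flat_exp (n+2) r - n * flat_exp (n+1) r)) (at r)"
proof -
  consider "r > 0" | "r < 0" | "r = 0" by linarith
  then show ?thesis
  proof cases
    case 1
    have "((\<lambda>r. exp (- (1/r)) / r ^ n) has_real_derivative (flat_exp (n+2) r - n * flat_exp (n+1) r)) (at r)"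
      using 1 by (auto intro!: derivative_eq_intros simp: flat_exp_def field_simps power2_eq_square)
         (cases n; simp add: field_simps)
    then show ?thesis
      using 1 by (elim has_field_derivative_transform_within_open[of _ _ _ "{0<..}"]) (auto simp: flat_exp_def)
  next
    case 2
    have "((\<lambda>r. 0) has_real_derivative (flat_exp (n+2) r - n * flat_exp (n+1) r)) (at r)"
      using 2 by (auto simp: flat_exp_def)
    then show ?thesis
      using 2 by (elim has_field_derivative_transform_within_open[of _ _ _ "{..<0}"]) (auto simp: flat_exp_def)
  next
    case 3
    have R: "((\<lambda>h. flat_exp n h / h) \<longlongrightarrow> 0) (at_right 0)"
    proof (rule Lim_transform_eventually)
      show "((\<lambda>h::real. exp (- (1/h)) / h ^ n / h) \<longlongrightarrow> 0) (at_right 0)" by real_asymp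
      show "\<forall>\<^sub>F h in at_right 0. exp (- (1/h)) / h ^ n / h = flat_exp n h / h"
        by (auto simp: eventually_at_filter flat_exp_def)
    qed
    have L: "((\<lambda>h. flat_exp n h / h) \<longlongrightarrow> 0) (at_left 0)"
      by (rule Lim_transform_eventually[OF tendsto_const]) (auto simp: eventually_at_filter flat_exp_def)
    have "((\<lambda>h. flat_exp n h / h) \<longlongrightarrow> 0) (at 0)"
      using L R filterlim_split_at by blast
    then show ?thesis using 3 by (simp add: has_field_derivative_iff flat_exp_def)
  qed
qed

lemma smooth_flat_exp: "smooth_on UNIV (flat_exp n)"
  unfolding smooth_on_def
proof
  fix k show "Ck_on k UNIV (flat_exp n)"
  proof (induction k arbitrary: n)
    case 0
    then show ?case using flat_exp_deriv
      by (auto intro!: continuous_at_imp_continuous_on DERIV_isCont)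
  next
    case (Suc k)
    show ?case
    proof (rule Ck_on_SucI[where f'="\<lambda>r v. (flat_exp (n+2) r + (- real n) *\<^sub>R flat_exp (n+1) r) *\<^sub>R v"])
      show "(flat_exp n has_derivative (\<lambda>v. (flat_exp (n+2) r + (- real n) *\<^sub>R flat_exp (n+1) r) *\<^sub>R v)) (at r)" for r
        using flat_exp_deriv[of n r] by (simp add: has_field_derivative_def)
      show "Ck_on k UNIV (\<lambda>r. (flat_exp (n+2) r + (- real n) *\<^sub>R flat_exp (n+1) r) *\<^sub>R v)" for v
        by (intro Ck_on_scaleR Ck_on_add Ck_on_const Suc open_UNIV)
    qed simp
  qed
qed

definition bump :: "'a::euclidean_space \<Rightarrow> real \<Rightarrow> 'a \<Rightarrow> real" where
  "bump y0 \<delta> y = flat_exp 0 (\<delta>\<^sup>2 - (norm (y - y0))\<^sup>2)"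

lemma smooth_bump: "smooth_on UNIV (bump y0 \<delta>)"
proof -
  have sq: "smooth_on UNIV (\<lambda>y::'a. y \<bullet> y)"
    by (rule smooth_onI[where f'="\<lambda>y v. y \<bullet> v + v \<bullet> y"])
      (auto intro!: derivative_eq_intros smooth_on_bounded_linear bounded_linear_add
         bounded_linear_inner_left bounded_linear_inner_right)
  have "smooth_on UNIV (\<lambda>y. y + (- y0))"
    by (intro smooth_on_add smooth_on_ident smooth_on_const) auto
  then have "smooth_on UNIV (\<lambda>y. (y + (- y0)) \<bullet> (y + (- y0)))"
    by (rule smooth_on_compose[OF open_UNIV _ sq]) auto
  then have "smooth_on UNIV (\<lambda>y. - ((y + (- y0)) \<bullet> (y + (- y0))))"
    by (rule smooth_on_linear_compose[OF bounded_linear_minus[OF bounded_linear_ident] open_UNIV])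
  then have "smooth_on UNIV (\<lambda>y. \<delta>\<^sup>2 + - ((y + (- y0)) \<bullet> (y + (- y0))))"
    by (intro smooth_on_add smooth_on_const) auto
  then have "smooth_on UNIV (\<lambda>y. flat_exp 0 (\<delta>\<^sup>2 + - ((y + (- y0)) \<bullet> (y + (- y0)))))"
    by (rule smooth_on_compose[OF open_UNIV _ smooth_flat_exp]) auto
  moreover have "bump y0 \<delta> = (\<lambda>y. flat_exp 0 (\<delta>\<^sup>2 + - ((y + (- y0)) \<bullet> (y + (- y0)))))"
    by (simp add: bump_def fun_eq_iff power2_norm_eq_inner)
  ultimately show ?thesis by simp
qed

lemma bump_nonneg: "bump y0 \<delta> y \<ge> 0"
  by (simp add: bump_def flat_exp_def)

lemma bump_pos: "norm (y - y0) < \<delta> \<Longrightarrow> bump y0 \<delta> y > 0"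
  by (auto simp: bump_def flat_exp_def intro!: power_strict_mono)

lemma bump_outside: "\<delta> \<ge> 0 \<Longrightarrow> norm (y - y0) \<ge> \<delta> \<Longrightarrow> bump y0 \<delta> y = 0"
proof -
  assume "\<delta> \<ge> 0" "norm (y - y0) \<ge> \<delta>"
  then have "\<delta>\<^sup>2 \<le> (norm (y - y0))\<^sup>2" by (simp add: power_mono)
  then show ?thesis by (simp add: bump_def flat_exp_def)
qed

section \<open>Charts and tangent maps\<close>

lemma cmap_cinv: "y \<in> cimg c \<Longrightarrow> cmap c (cinv c y) = y"
  by (simp add: f_inv_into_f)

lemma cinv_in: "y \<in> cimg c \<Longrightarrow> cinv c y \<in> cdom c"
  by (simp add: inv_into_into)

lemma
  assumes "smooth_atlas A"
  shows atlas_open: "c \<in> A \<Longrightarrow> open (cdom c)"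
    and atlas_open_img: "c \<in> A \<Longrightarrow> open (cimg c)"
    and cinv_cmap: "c \<in> A \<Longrightarrow> x \<in> cdom c \<Longrightarrow> cinv c (cmap c x) = x"
    and cont_cmap: "c \<in> A \<Longrightarrow> continuous_on (cdom c) (cmap c)"
    and cont_cinv: "c \<in> A \<Longrightarrow> continuous_on (cimg c) (cinv c)"
    and atlas_cover: "\<exists>c\<in>A. x \<in> cdom c"
  using assms by (auto simp: smooth_atlas_def homeomorphism_def)

lemma chart_image_eq:
  assumes "smooth_atlas A" "c \<in> A"
  shows "cmap c ` (cdom c \<inter> V) = {y \<in> cimg c. cinv c y \<in> V}"
  using cinv_cmap[OF assms] by (force simp: cmap_cinv cinv_in)

lemma open_chart_image:
  assumes "smooth_atlas A" "c \<in> A" "open V"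
  shows "open (cmap c ` (cdom c \<inter> V))"
proof -
  have "cmap c ` (cdom c \<inter> V) = cimg c \<inter> cinv c -` V"
    unfolding chart_image_eq[OF assms(1,2)] by auto
  then show ?thesis
    using continuous_open_preimage[OF cont_cinv[OF assms(1,2)] atlas_open_img[OF assms(1,2)] assms(3)] by simp
qed

lemma chart_compact:
  assumes "smooth_atlas A" "c \<in> A" and K: "compact K" "K \<subseteq> cimg c"
  shows "compact (cinv c ` K)" "cinv c ` K \<subseteq> cdom c" "cmap c ` cinv c ` K = K"
    and "x \<in> cdom c \<Longrightarrow> x \<notin> cinv c ` K \<Longrightarrow> cmap c x \<notin> K"
proof -
  show "compact (cinv c ` K)"
    by (rule compact_continuous_image[OF continuous_on_subset[OF cont_cinv[OF assms(1,2)] K(2)] K(1)])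
  show "cinv c ` K \<subseteq> cdom c" by (rule image_subsetI, rule cinv_in, rule subsetD[OF K(2)])
  show "cmap c ` cinv c ` K = K" using cmap_cinv[OF subsetD[OF K(2)]] by (simp add: image_image)
  show "cmap c x \<notin> K" if "x \<in> cdom c" "x \<notin> cinv c ` K"
    using that cinv_cmap[OF assms(1,2) that(1)] by (metis imageI)
qed

text \<open>The Jacobian of \<open>f\<close> in coordinates. The calculus of tangent vectors reduces to its
  chain rule \<open>tdiff_comp\<close>.\<close>

definition tdiff :: "('m, 'k::finite) chart \<Rightarrow> ('n, 'l::finite) chart \<Rightarrow> ('m \<Rightarrow> 'n) \<Rightarrow> 'm \<Rightarrow> real^'k \<Rightarrow> real^'l" where
  "tdiff c d f x = frechet_derivative (cmap d \<circ> f \<circ> cinv c) (at (cmap c x))"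

lemma smooth_mapD:
  assumes "smooth_map A B f" "c \<in> A" "d \<in> B"
  shows "smooth_on (cmap c ` (cdom c \<inter> f -` cdom d)) (cmap d \<circ> f \<circ> cinv c)"
  using assms by (auto simp: smooth_map_def)

lemma smooth_map_open:
  assumes "smooth_atlas A" "smooth_atlas B" "smooth_map A B f" "c \<in> A" "d \<in> B"
  shows "open (cmap c ` (cdom c \<inter> f -` cdom d))"
  using assms by (intro open_chart_image) (auto simp: smooth_map_def atlas_open open_vimage)

lemma tdiff_has:
  assumes "smooth_map A B f" "c \<in> A" "d \<in> B" "x \<in> cdom c" "f x \<in> cdom d"
  shows "(cmap d \<circ> f \<circ> cinv c has_derivative tdiff c d f x) (at (cmap c x))"
  unfolding tdiff_def using assms by (intro smooth_on_deriv[OF smooth_mapD[OF assms(1-3)]]) auto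

lemma tdiff_linear:
  assumes "smooth_map A B f" "c \<in> A" "d \<in> B" "x \<in> cdom c" "f x \<in> cdom d"
  shows "bounded_linear (tdiff c d f x)"
  using tdiff_has[OF assms] by (rule has_derivative_bounded_linear)

lemma tdiff_comp:
  assumes A: "smooth_atlas A" and B: "smooth_atlas B"
    and f: "smooth_map A B f" and g: "smooth_map B C g"
    and c: "c \<in> A" "d \<in> B" "e \<in> C" "x \<in> cdom c" "f x \<in> cdom d" "g (f x) \<in> cdom e"
  shows "tdiff c e (g \<circ> f) x v = tdiff d e g (f x) (tdiff c d f x v)"
proof -
  have 1: "(cmap d \<circ> f \<circ> cinv c has_derivative tdiff c d f x) (at (cmap c x))"
    using assms by (intro tdiff_has)
  have e: "(cmap d \<circ> f \<circ> cinv c) (cmap c x) = cmap d (f x)"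
    using cinv_cmap[OF A] c by simp
  have 2: "(cmap e \<circ> g \<circ> cinv d has_derivative tdiff d e g (f x)) (at ((cmap d \<circ> f \<circ> cinv c) (cmap c x)))"
    unfolding e using assms by (intro tdiff_has)
  have "((\<lambda>y. (cmap e \<circ> g \<circ> cinv d) ((cmap d \<circ> f \<circ> cinv c) y)) has_derivative
      (\<lambda>v. tdiff d e g (f x) (tdiff c d f x v))) (at (cmap c x))"
    by (rule has_derivative_compose[OF 1 2])
  then have "(cmap e \<circ> (g \<circ> f) \<circ> cinv c has_derivative
      (\<lambda>v. tdiff d e g (f x) (tdiff c d f x v))) (at (cmap c x))"
  proof (rule has_derivative_transform_within_open[OF _ smooth_map_open[OF A B f c(1,2)]])
    show "cmap c x \<in> cmap c ` (cdom c \<inter> f -` cdom d)" using c by auto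
    fix y assume "y \<in> cmap c ` (cdom c \<inter> f -` cdom d)"
    then show "(cmap e \<circ> g \<circ> cinv d) ((cmap d \<circ> f \<circ> cinv c) y) = (cmap e \<circ> (g \<circ> f) \<circ> cinv c) y"
      using cinv_cmap[OF A c(1)] cinv_cmap[OF B c(2)] by auto
  qed
  then have "(\<lambda>v. tdiff d e g (f x) (tdiff c d f x v)) = tdiff c e (g \<circ> f) x"
    unfolding tdiff_def[of c e] by (rule frechet_derivative_at)
  then show ?thesis by metis
qed

lemma smooth_map_id:
  assumes "smooth_atlas A" shows "smooth_map A A id"
  using assms by (auto simp: smooth_map_def smooth_atlas_def)

lemma tdiff_id_same:
  assumes A: "smooth_atlas A" and c: "c \<in> A" "x \<in> cdom c"
  shows "tdiff c c id x v = v"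
proof -
  have "(cmap c \<circ> id \<circ> cinv c has_derivative (\<lambda>v. v)) (at (cmap c x))"
    by (rule has_derivative_transform_within_open[OF has_derivative_ident atlas_open_img[OF A c(1)]])
       (use c in \<open>auto simp: cmap_cinv\<close>)
  then show ?thesis unfolding tdiff_def by (metis frechet_derivative_at)
qed

lemma tangent_space_iff:
  "v \<in> tangent_space A p \<longleftrightarrow> (\<forall>c. \<not> (c \<in> A \<and> p \<in> cdom c) \<longrightarrow> v c = 0) \<and>
     (\<forall>c\<in>A. \<forall>c'\<in>A. p \<in> cdom c \<longrightarrow> p \<in> cdom c' \<longrightarrow> v c' = tdiff c c' id p (v c))"
  by (auto simp: tangent_space_def tdiff_def)

lemma tangentI:
  assumes "\<And>c. \<not> (c \<in> A \<and> p \<in> cdom c) \<Longrightarrow> v c = 0"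
    and "\<And>c c'. c \<in> A \<Longrightarrow> c' \<in> A \<Longrightarrow> p \<in> cdom c \<Longrightarrow> p \<in> cdom c' \<Longrightarrow> v c' = tdiff c c' id p (v c)"
  shows "v \<in> tangent_space A p"
  unfolding tangent_space_iff using assms by blast

lemma tangentD:
  assumes "v \<in> tangent_space A p"
  shows "\<not> (c \<in> A \<and> p \<in> cdom c) \<Longrightarrow> v c = 0"
    and "c \<in> A \<Longrightarrow> c' \<in> A \<Longrightarrow> p \<in> cdom c \<Longrightarrow> p \<in> cdom c' \<Longrightarrow> v c' = tdiff c c' id p (v c)"
  using assms unfolding tangent_space_iff by blast+

lemma coord_vec_eq:
  "coord_vec A c p a = (\<lambda>c'. if c' \<in> A \<and> p \<in> cdom c' then tdiff c c' id p a else 0)"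
  by (simp add: coord_vec_def tdiff_def o_def cong: if_cong)

lemma coord_vec_same:
  "smooth_atlas A \<Longrightarrow> c \<in> A \<Longrightarrow> p \<in> cdom c \<Longrightarrow> coord_vec A c p a c = a"
  by (simp add: coord_vec_eq tdiff_id_same)

lemma coord_vec_in:
  assumes A: "smooth_atlas A" and c: "c \<in> A" "p \<in> cdom c"
  shows "coord_vec A c p a \<in> tangent_space A p"
proof (rule tangentI)
  fix c1 c2 assume *: "c1 \<in> A" "c2 \<in> A" "p \<in> cdom c1" "p \<in> cdom c2"
  show "coord_vec A c p a c2 = tdiff c1 c2 id p (coord_vec A c p a c1)"
    using tdiff_comp[OF A A smooth_map_id[OF A] smooth_map_id[OF A] c(1) *(1,2) c(2), of a] *
    by (simp add: coord_vec_eq)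
qed (auto simp: coord_vec_eq)

lemma tangent_eqI:
  assumes "u \<in> tangent_space A p" "v \<in> tangent_space A p" "c \<in> A" "p \<in> cdom c" "u c = v c"
  shows "u = v"
proof
  fix c' show "u c' = v c'"
  proof (cases "c' \<in> A \<and> p \<in> cdom c'")
    case True
    then show ?thesis
      using tangentD(2)[OF assms(1,3), of c'] tangentD(2)[OF assms(2,3), of c'] assms(4,5) by metis
  next
    case False
    then show ?thesis using tangentD(1)[OF assms(1)] tangentD(1)[OF assms(2)] by metis
  qed
qed

lemma tangent_eq_coord_vec:
  assumes "smooth_atlas A" "v \<in> tangent_space A p" "c \<in> A" "p \<in> cdom c"
  shows "v = coord_vec A c p (v c)"
  using assms by (intro tangent_eqI[OF assms(2) coord_vec_in]) (auto simp: coord_vec_same)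

lemma lincomb_in:
  assumes A: "smooth_atlas A" and "u \<in> tangent_space A p" "v \<in> tangent_space A p"
  shows "lincomb a u b v \<in> tangent_space A p"
proof -
  have "tdiff c c' id p (a *\<^sub>R x + b *\<^sub>R y) = a *\<^sub>R tdiff c c' id p x + b *\<^sub>R tdiff c c' id p y"
    if "c \<in> A" "c' \<in> A" "p \<in> cdom c" "p \<in> cdom c'" for c c' x y
  proof -
    interpret bounded_linear "tdiff c c' id p"
      using that by (intro tdiff_linear[OF smooth_map_id[OF A]]) auto
    show ?thesis by (simp add: add scale)
  qed
  then show ?thesis
    using tangentD[OF assms(2)] tangentD[OF assms(3)] unfolding lincomb_def
    by (intro tangentI) (metis scaleR_zero_right add_0_right)+
qed

lemma zero_in: assumes "smooth_atlas A" shows "(\<lambda>_. 0) \<in> tangent_space A p"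
proof -
  obtain c where c: "c \<in> A" "p \<in> cdom c" using atlas_cover[OF assms] by blast
  have "lincomb 0 (coord_vec A c p 0) 0 (coord_vec A c p 0) \<in> tangent_space A p"
    by (intro lincomb_in coord_vec_in assms c)
  then show ?thesis by (simp add: lincomb_def)
qed

lemma coord_vec_lincomb:
  assumes "smooth_atlas A" "c \<in> A" "p \<in> cdom c"
  shows "coord_vec A c p (a *\<^sub>R u + b *\<^sub>R v) = lincomb a (coord_vec A c p u) b (coord_vec A c p v)"
  using assms by (intro tangent_eqI[OF coord_vec_in lincomb_in[OF _ coord_vec_in coord_vec_in] assms(2,3)])
     (auto simp: coord_vec_same lincomb_def)

text \<open>The definition of \<open>tangent_map\<close> picks some chart of the source; by the transition
  law of tangent vectors every other chart gives the same value.\<close>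

lemma tangent_map_at:
  assumes A: "smooth_atlas A" and B: "smooth_atlas B" and f: "smooth_map A B f"
    and v: "v \<in> tangent_space A x"
    and c: "c \<in> A" "d \<in> B" "x \<in> cdom c" "f x \<in> cdom d"
  shows "tangent_map A B f x v d = tdiff c d f x (v c)"
proof -
  define c' where "c' = (SOME c. c \<in> A \<and> x \<in> cdom c)"
  have c': "c' \<in> A" "x \<in> cdom c'"
    using someI[of "\<lambda>c. c \<in> A \<and> x \<in> cdom c" c] c by (auto simp: c'_def)
  have "v c' = tdiff c c' id x (v c)" by (rule tangentD(2)[OF v c(1) c'(1) c(3) c'(2)])
  then have "tdiff c' d f x (v c') = tdiff c d (f \<circ> id) x (v c)"
    using tdiff_comp[OF A A smooth_map_id[OF A] f c(1) c'(1) c(2,3)] c' c by simp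
  moreover have "tangent_map A B f x v d = tdiff c' d f x (v c')"
    using c by (simp add: tangent_map_def Let_def c'_def tdiff_def)
  ultimately show ?thesis by simp
qed

lemma tangent_map_in:
  assumes A: "smooth_atlas A" and B: "smooth_atlas B" and f: "smooth_map A B f"
    and v: "v \<in> tangent_space A x"
  shows "tangent_map A B f x v \<in> tangent_space B (f x)"
proof -
  obtain c where c: "c \<in> A" "x \<in> cdom c" using atlas_cover[OF A] by blast
  have "tangent_map A B f x v d' = tdiff d d' id (f x) (tangent_map A B f x v d)"
    if "d \<in> B" "d' \<in> B" "f x \<in> cdom d" "f x \<in> cdom d'" for d d'
    using tdiff_comp[OF A B f smooth_map_id[OF B] c(1) that(1,2) c(2), of "v c"] that
    by (simp add: tangent_map_at[OF A B f v c(1) _ c(2)])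
  then show ?thesis by (rule tangentI[rotated]) (auto simp: tangent_map_def)
qed

lemma tangent_map_comp:
  assumes A: "smooth_atlas A" and B: "smooth_atlas B" and C: "smooth_atlas C"
    and f: "smooth_map A B f" and g: "smooth_map B C g" and gf: "smooth_map A C (g \<circ> f)"
    and v: "v \<in> tangent_space A x"
  shows "tangent_map A C (g \<circ> f) x v = tangent_map B C g (f x) (tangent_map A B f x v)"
proof -
  obtain c where c: "c \<in> A" "x \<in> cdom c" using atlas_cover[OF A] by blast
  obtain d where d: "d \<in> B" "f x \<in> cdom d" using atlas_cover[OF B] by blast
  obtain e where e: "e \<in> C" "g (f x) \<in> cdom e" using atlas_cover[OF C] by blast
  have e': "(g \<circ> f) x \<in> cdom e" using e by simp
  have "tangent_map A C (g \<circ> f) x v e = tangent_map B C g (f x) (tangent_map A B f x v) e"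
    using tdiff_comp[OF A B f g c(1) d(1) e(1) c(2) d(2) e(2), of "v c"]
    by (simp del: o_apply add: tangent_map_at[OF A C gf v c(1) e(1) c(2) e']
       tangent_map_at[OF B C g tangent_map_in[OF A B f v] d(1) e(1) d(2) e(2)]
       tangent_map_at[OF A B f v c(1) d(1) c(2) d(2)])
  moreover have "tangent_map A C (g \<circ> f) x v \<in> tangent_space C (g (f x))"
    using tangent_map_in[OF A C gf v] by simp
  ultimately show ?thesis
    by (intro tangent_eqI[OF _ tangent_map_in[OF B C g tangent_map_in[OF A B f v]] e])
qed

lemma tangent_map_lincomb:
  assumes A: "smooth_atlas A" and B: "smooth_atlas B" and f: "smooth_map A B f"
    and v: "v \<in> tangent_space A x" "w \<in> tangent_space A x"
  shows "tangent_map A B f x (lincomb a v b w) = lincomb a (tangent_map A B f x v) b (tangent_map A B f x w)"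
proof -
  obtain c where c: "c \<in> A" "x \<in> cdom c" using atlas_cover[OF A] by blast
  obtain d where d: "d \<in> B" "f x \<in> cdom d" using atlas_cover[OF B] by blast
  interpret bounded_linear "tdiff c d f x"
    using c d by (intro tdiff_linear[OF f]) auto
  have "tangent_map A B f x (lincomb a v b w) d = lincomb a (tangent_map A B f x v) b (tangent_map A B f x w) d"
    using tangent_map_at[OF A B f v(1) c(1) d(1) c(2) d(2)] tangent_map_at[OF A B f v(2) c(1) d(1) c(2) d(2)]
      tangent_map_at[OF A B f lincomb_in[OF A v] c(1) d(1) c(2) d(2)]
    by (simp add: lincomb_def add scale)
  then show ?thesis
    by (intro tangent_eqI[OF tangent_map_in[OF A B f lincomb_in[OF A v]] _ d]
       lincomb_in[OF B] tangent_map_in[OF A B f] v)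
qed

section \<open>Smooth families\<close>

abbreviation fset :: "('m, 'k::finite) chart \<Rightarrow> ('n, 'l::finite) chart \<Rightarrow> 'p set \<Rightarrow> ('p \<Rightarrow> 'm \<Rightarrow> 'n)
    \<Rightarrow> ('p \<times> (real^'k)) set" where
  "fset c d U F \<equiv> {(p, y). p \<in> U \<and> y \<in> cimg c \<and> F p (cinv c y) \<in> cdom d}"

abbreviation frep :: "('m, 'k::finite) chart \<Rightarrow> ('n, 'l::finite) chart \<Rightarrow> ('p \<Rightarrow> 'm \<Rightarrow> 'n)
    \<Rightarrow> 'p \<times> (real^'k) \<Rightarrow> real^'l" where
  "frep c d F \<equiv> (\<lambda>(p, y). cmap d (F p (cinv c y)))"

lemma family_cont_chart:
  assumes A: "smooth_atlas A" and F: "continuous_on (U \<times> UNIV) (\<lambda>(p, x). F p x)" and c: "c \<in> A"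
  shows "continuous_on (U \<times> cimg c) (\<lambda>(p, y). F p (cinv c y))"
proof -
  have "continuous_on (U \<times> cimg c) (\<lambda>z. (fst z, cinv c (snd z)))"
    by (intro continuous_intros continuous_on_compose2[OF cont_cinv[OF A c]]) auto
  then have "continuous_on (U \<times> cimg c) (\<lambda>z. (\<lambda>(p, x). F p x) (fst z, cinv c (snd z)))"
    by (rule continuous_on_compose2[OF F]) auto
  then show ?thesis by (simp add: case_prod_beta')
qed

lemma fset_open:
  assumes A: "smooth_atlas A" and B: "smooth_atlas B"
    and F: "continuous_on (U \<times> UNIV) (\<lambda>(p, x). F p x)" and c: "c \<in> A" "d \<in> B" and U: "open U"
  shows "open (fset c d U F)"
proof -
  have "fset c d U F = (U \<times> cimg c) \<inter> (\<lambda>(p, y). F p (cinv c y)) -` cdom d" by auto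
  then show ?thesis
    using continuous_open_preimage[OF family_cont_chart[OF A F c(1)] open_Times[OF U atlas_open_img[OF A c(1)]]
       atlas_open[OF B c(2)]] by simp
qed

lemma smooth_familyD:
  assumes "smooth_family A B U F"
  shows "continuous_on (U \<times> UNIV) (\<lambda>(p, x). F p x)"
    and "c \<in> A \<Longrightarrow> d \<in> B \<Longrightarrow> smooth_on (fset c d U F) (frep c d F)"
  using assms by (auto simp: smooth_family_def)

lemma section_familyD:
  assumes "smooth_section_family A B U F h"
  shows "p \<in> U \<Longrightarrow> h p x \<in> tangent_space B (F p x)"
    and "c \<in> A \<Longrightarrow> d \<in> B \<Longrightarrow> smooth_on (fset c d U F) (\<lambda>(p, y). h p (cinv c y) d)"
  using assms by (auto simp: smooth_section_family_def)

lemma family_slice: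
  fixes U :: "'p::euclidean_space set"
  assumes A: "smooth_atlas A" and B: "smooth_atlas B" and F: "smooth_family A B U F" and p: "p \<in> U"
  shows "smooth_map A B (F p)"
  unfolding smooth_map_def
proof (intro conjI ballI)
  have "continuous_on UNIV (\<lambda>x. (\<lambda>(p, x). F p x) (p, x))"
    by (rule continuous_on_compose2[OF smooth_familyD(1)[OF F]]) (use p in \<open>auto intro!: continuous_intros\<close>)
  then show C: "continuous_on UNIV (F p)" by simp
  fix c d assume c: "c \<in> A" "d \<in> B"
  have o: "open (cmap c ` (cdom c \<inter> F p -` cdom d))"
    using C by (intro open_chart_image[OF A c(1)] open_vimage atlas_open[OF B c(2)]) auto
  have "smooth_on (cmap c ` (cdom c \<inter> F p -` cdom d)) (\<lambda>y. frep c d F (p, y))"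
    by (rule smooth_on_compose[OF o _ smooth_familyD(2)[OF F c]])
       (use p in \<open>auto intro!: smooth_on_Pair smooth_on_const smooth_on_ident o simp: cinv_cmap[OF A c(1)]\<close>)
  then show "smooth_on (cmap c ` (cdom c \<inter> F p -` cdom d)) (cmap d \<circ> F p \<circ> cinv c)"
    by (simp add: o_def)
qed

lemma section_slice:
  fixes U :: "'p::euclidean_space set"
  assumes A: "smooth_atlas A" and B: "smooth_atlas B" and F: "smooth_family A B U F" and p: "p \<in> U"
    and h: "smooth_section_family A B U F h"
  shows "h p \<in> sections_along A B (F p)"
  unfolding sections_along_def
proof (intro CollectI conjI ballI allI)
  show "h p x \<in> tangent_space B (F p x)" for x by (rule section_familyD(1)[OF h p])
  fix c d assume c: "c \<in> A" "d \<in> B"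
  have o: "open (cmap c ` (cdom c \<inter> F p -` cdom d))"
    by (rule smooth_map_open[OF A B family_slice[OF A B F p] c])
  have "smooth_on (cmap c ` (cdom c \<inter> F p -` cdom d)) (\<lambda>y. (\<lambda>(p, y). h p (cinv c y) d) (p, y))"
    by (rule smooth_on_compose[OF o _ section_familyD(2)[OF h c]])
       (use p in \<open>auto intro!: smooth_on_Pair smooth_on_const smooth_on_ident o simp: cinv_cmap[OF A c(1)]\<close>)
  then show "smooth_on (cmap c ` (cdom c \<inter> F p -` cdom d)) (\<lambda>y. h p (cinv c y) d)"
    by simp
qed

lemma smooth_map_const_family:
  assumes A: "smooth_atlas A" and B: "smooth_atlas B" and f: "smooth_map A B f" and V: "open V"
  shows "smooth_family A B V (\<lambda>_::'q::euclidean_space. f)"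
  unfolding smooth_family_def
proof (intro conjI ballI)
  have "continuous_on UNIV f" using f by (simp add: smooth_map_def)
  then show C: "continuous_on (V \<times> UNIV) (\<lambda>(p, x). f x)"
    by (auto simp: case_prod_beta' intro!: continuous_on_compose2[of UNIV f] continuous_intros)
  fix c d assume c: "c \<in> A" "d \<in> B"
  have o: "open (fset c d V (\<lambda>_. f))" by (rule fset_open[OF A B C c V])
  have "smooth_on (fset c d V (\<lambda>_. f)) (\<lambda>z. (cmap d \<circ> f \<circ> cinv c) (snd z))"
    by (rule smooth_on_compose[OF o smooth_on_bounded_linear[OF bounded_linear_snd o] smooth_mapD[OF f c]])
      (auto simp: chart_image_eq[OF A c(1)])
  then show "smooth_on (fset c d V (\<lambda>_. f)) (frep c d (\<lambda>_. f))" by (simp add: case_prod_beta')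
qed

text \<open>Locally the composition passes through a chart around the intermediate point. Compositions of
  maps, reparametrizations of families and the variations used below are all instances.\<close>

lemma family_comp:
  fixes U :: "'p::euclidean_space set" and V :: "'q::euclidean_space set" and W :: "'r::euclidean_space set"
  assumes A: "smooth_atlas A" and A': "smooth_atlas A'" and B: "smooth_atlas B"
    and phi: "smooth_family A A' V \<phi>" and f: "smooth_family A' B U f"
    and o: "open U" "open V" "open W"
    and al: "smooth_on W \<alpha>" "\<And>r. r \<in> W \<Longrightarrow> \<alpha> r \<in> U"
    and be: "smooth_on W \<beta>" "\<And>r. r \<in> W \<Longrightarrow> \<beta> r \<in> V"
  shows "smooth_family A B W (\<lambda>r. f (\<alpha> r) \<circ> \<phi> (\<beta> r))"
proof -
  have ca: "continuous_on (W \<times> UNIV) (\<lambda>(r, x). (\<beta> r, x))"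
    using smooth_on_imp_continuous[OF be(1)]
    by (auto intro!: continuous_intros continuous_on_compose2[of W \<beta>] simp: case_prod_beta')
  have cp: "continuous_on (W \<times> UNIV) (\<lambda>z. (\<lambda>(p, x). \<phi> p x) ((\<lambda>(r, x). (\<beta> r, x)) z))"
    by (rule continuous_on_compose2[OF smooth_familyD(1)[OF phi] ca]) (use be in auto)
  then have cp: "continuous_on (W \<times> UNIV) (\<lambda>(r, x). \<phi> (\<beta> r) x)" by (simp add: case_prod_beta')
  have "continuous_on (W \<times> UNIV) (\<lambda>z. (\<alpha> (fst z), (\<lambda>(r, x). \<phi> (\<beta> r) x) z))"
    using smooth_on_imp_continuous[OF al(1)]
    by (intro continuous_intros cp) (auto intro!: continuous_intros continuous_on_compose2[of W \<alpha>])
  then have "continuous_on (W \<times> UNIV) (\<lambda>z. (\<lambda>(p, x). f p x) (\<alpha> (fst z), (\<lambda>(r, x). \<phi> (\<beta> r) x) z))"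
    by (rule continuous_on_compose2[OF smooth_familyD(1)[OF f]]) (use al in auto)
  then have C: "continuous_on (W \<times> UNIV) (\<lambda>(r, x). (f (\<alpha> r) \<circ> \<phi> (\<beta> r)) x)" by (simp add: case_prod_beta')
  show ?thesis unfolding smooth_family_def
  proof (intro conjI ballI C)
    fix c d assume c: "c \<in> A" "d \<in> B"
    show "smooth_on (fset c d W (\<lambda>r. f (\<alpha> r) \<circ> \<phi> (\<beta> r))) (frep c d (\<lambda>r. f (\<alpha> r) \<circ> \<phi> (\<beta> r)))"
    proof (rule smooth_on_local)
      fix z0 assume z0: "z0 \<in> fset c d W (\<lambda>r. f (\<alpha> r) \<circ> \<phi> (\<beta> r))"
      obtain r0 y0 where ry: "z0 = (r0, y0)" by fastforce
      obtain c' where c': "c' \<in> A'" "\<phi> (\<beta> r0) (cinv c y0) \<in> cdom c'"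
        using atlas_cover[OF A'] by blast
      define T where "T = fset c d W (\<lambda>r. f (\<alpha> r) \<circ> \<phi> (\<beta> r)) \<inter> fset c c' W (\<lambda>r. \<phi> (\<beta> r))"
      have T: "open T" unfolding T_def
        using C cp by (intro open_Int fset_open[OF A B _ c] fset_open[OF A A' _ c(1) c'(1)] o) auto
      have TW: "fst z \<in> W" if "z \<in> T" for z using that by (auto simp: T_def)
      have s1: "smooth_on T (\<lambda>z. \<alpha> (fst z))" "smooth_on T (\<lambda>z. \<beta> (fst z))"
        by (rule smooth_on_compose[OF T smooth_on_bounded_linear[OF bounded_linear_fst T] al(1) TW]
           smooth_on_compose[OF T smooth_on_bounded_linear[OF bounded_linear_fst T] be(1) TW]; assumption)+
      have "smooth_on T (\<lambda>z. frep c c' \<phi> (\<beta> (fst z), snd z))"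
        by (rule smooth_on_compose[OF T _ smooth_familyD(2)[OF phi c(1) c'(1)]])
          (intro smooth_on_Pair s1(2) T smooth_on_bounded_linear bounded_linear_snd, auto simp: T_def be)
      then have "smooth_on T (\<lambda>z. (\<alpha> (fst z), frep c c' \<phi> (\<beta> (fst z), snd z)))"
        by (intro smooth_on_Pair T s1(1))
      then have "smooth_on T (\<lambda>z. frep c' d f (\<alpha> (fst z), frep c c' \<phi> (\<beta> (fst z), snd z)))"
        by (rule smooth_on_compose[OF T _ smooth_familyD(2)[OF f c'(1) c(2)]])
           (auto simp: T_def al cinv_cmap[OF A' c'(1)])
      then have "smooth_on T (frep c d (\<lambda>r. f (\<alpha> r) \<circ> \<phi> (\<beta> r)))"
        by (rule smooth_on_cong[OF T, rotated]) (auto simp: T_def cinv_cmap[OF A' c'(1)])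
      then show "\<exists>T. open T \<and> z0 \<in> T \<and> smooth_on T (frep c d (\<lambda>r. f (\<alpha> r) \<circ> \<phi> (\<beta> r)))"
        using T z0 c' ry by (intro exI[of _ T]) (auto simp: T_def)
    qed
  qed
qed

lemma family_reparam:
  fixes U :: "'p::euclidean_space set" and W :: "'r::euclidean_space set"
  assumes "smooth_atlas A" "smooth_atlas B" "smooth_family A B U F" "open U" "open W"
    "smooth_on W \<alpha>" "\<And>r. r \<in> W \<Longrightarrow> \<alpha> r \<in> U"
  shows "smooth_family A B W (\<lambda>r. F (\<alpha> r))"
  using family_comp[OF assms(1) assms(1) assms(2) smooth_map_const_family[OF assms(1) assms(1) smooth_map_id[OF assms(1)] open_UNIV] assms(3,4) open_UNIV assms(5,6,7)
     smooth_on_const[OF assms(5), of "0::real"]] by simp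

lemma smooth_map_comp:
  assumes A: "smooth_atlas A" and A': "smooth_atlas A'" and B: "smooth_atlas B"
    and f: "smooth_map A A' f" and g: "smooth_map A' B g"
  shows "smooth_map A B (g \<circ> f)"
proof -
  have "smooth_family A B (UNIV :: real set) (\<lambda>_. g \<circ> f)"
    by (rule family_comp[OF A A' B smooth_map_const_family[OF A A' f open_UNIV]
          smooth_map_const_family[OF A' B g open_UNIV] open_UNIV open_UNIV open_UNIV
          smooth_on_ident[OF open_UNIV] UNIV_I smooth_on_ident[OF open_UNIV] UNIV_I])
  then show ?thesis by (rule family_slice[OF A B, of UNIV _ 0]) simp
qed

lemma section_reparam:
  fixes U :: "'p::euclidean_space set" and W :: "'r::euclidean_space set"
  assumes A: "smooth_atlas A" and B: "smooth_atlas B" and F: "smooth_family A B U F"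
    and h: "smooth_section_family A B U F h"
    and o: "open U" "open W" and al: "smooth_on W \<alpha>" "\<And>r. r \<in> W \<Longrightarrow> \<alpha> r \<in> U"
  shows "smooth_section_family A B W (\<lambda>r. F (\<alpha> r)) (\<lambda>r. h (\<alpha> r))"
  unfolding smooth_section_family_def
proof (intro conjI ballI allI)
  show "h (\<alpha> r) x \<in> tangent_space B (F (\<alpha> r) x)" if "r \<in> W" for r x
    using section_familyD(1)[OF h al(2)[OF that]] .
  fix c d assume c: "c \<in> A" "d \<in> B"
  have T: "open (fset c d W (\<lambda>r. F (\<alpha> r)))"
    by (rule fset_open[OF A B smooth_familyD(1)[OF family_reparam[OF A B F o al]] c o(2)])
  have "smooth_on (fset c d W (\<lambda>r. F (\<alpha> r))) (\<lambda>z. \<alpha> (fst z))"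
    by (rule smooth_on_compose[OF T smooth_on_bounded_linear[OF bounded_linear_fst T] al(1)]) auto
  then have "smooth_on (fset c d W (\<lambda>r. F (\<alpha> r))) (\<lambda>z. (\<alpha> (fst z), snd z))"
    by (rule smooth_on_Pair[OF T _ smooth_on_bounded_linear[OF bounded_linear_snd T]])
  then have "smooth_on (fset c d W (\<lambda>r. F (\<alpha> r))) (\<lambda>z. (\<lambda>(p, y). h p (cinv c y) d) (\<alpha> (fst z), snd z))"
    by (rule smooth_on_compose[OF T _ section_familyD(2)[OF h c]]) (auto simp: al)
  then show "smooth_on (fset c d W (\<lambda>r. F (\<alpha> r))) (\<lambda>(r, y). h (\<alpha> r) (cinv c y) d)"
    by (simp add: case_prod_beta')
qed

section \<open>Partial derivatives of smooth families\<close>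

lemma frep_deriv:
  assumes A: "smooth_atlas A" and F: "smooth_family A B U F"
    and c: "c \<in> A" "d \<in> B" "x \<in> cdom c" "F p x \<in> cdom d" "p \<in> U"
  shows "(frep c d F has_derivative frechet_derivative (frep c d F) (at (p, cmap c x))) (at (p, cmap c x))"
  using c by (intro smooth_on_deriv[OF smooth_familyD(2)[OF F c(1,2)]]) (auto simp: cinv_cmap[OF A c(1)])

lemma velocity_frep:
  fixes U :: "real set"
  assumes A: "smooth_atlas A" and F: "smooth_family A B U F"
    and c: "c \<in> A" "d \<in> B" "x \<in> cdom c" "F t x \<in> cdom d" "t \<in> U"
  shows "((\<lambda>\<tau>. cmap d (F \<tau> x)) has_vector_derivative velocity B F t x d) (at t)"
    and "velocity B F t x d = frechet_derivative (frep c d F) (at (t, cmap c x)) (1, 0)"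
proof -
  let ?D = "frechet_derivative (frep c d F) (at (t, cmap c x))"
  have 1: "((\<lambda>\<tau>. (\<tau>, cmap c x)) has_derivative (\<lambda>h. (h, 0))) (at t)"
    by (auto intro!: derivative_eq_intros)
  have "((\<lambda>\<tau>. frep c d F (\<tau>, cmap c x)) has_derivative (\<lambda>h. ?D (h, 0))) (at t)"
    by (rule has_derivative_compose[OF 1 frep_deriv[OF A F c]])
  moreover have "?D (h, 0) = h *\<^sub>R ?D (1, 0)" for h
    using linear_scale[OF has_derivative_linear[OF frep_deriv[OF A F c]], of h "(1, 0)"] by simp
  ultimately have "((\<lambda>\<tau>. frep c d F (\<tau>, cmap c x)) has_derivative (\<lambda>h. h *\<^sub>R ?D (1, 0))) (at t)"
    by (rule has_derivative_eq_rhs[OF _ ext])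
  then have v: "((\<lambda>\<tau>. cmap d (F \<tau> x)) has_vector_derivative ?D (1, 0)) (at t)"
    using cinv_cmap[OF A c(1,3)] by (simp add: has_vector_derivative_def)
  then show "velocity B F t x d = ?D (1, 0)"
    using c by (simp add: velocity_def vector_derivative_at)
  then show "((\<lambda>\<tau>. cmap d (F \<tau> x)) has_vector_derivative velocity B F t x d) (at t)"
    using v by simp
qed

lemma velocity_in:
  fixes U :: "real set"
  assumes A: "smooth_atlas A" and B: "smooth_atlas B" and F: "smooth_family A B U F" and U: "open U" "t \<in> U"
  shows "velocity B F t x \<in> tangent_space B (F t x)"
proof -
  obtain c where c: "c \<in> A" "x \<in> cdom c" using atlas_cover[OF A] by blast
  have "velocity B F t x d' = tdiff d d' id (F t x) (velocity B F t x d)"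
    if d: "d \<in> B" "d' \<in> B" "F t x \<in> cdom d" "F t x \<in> cdom d'" for d d'
  proof -
    have v: "((\<lambda>\<tau>. cmap d (F \<tau> x)) has_vector_derivative velocity B F t x d) (at t)"
      and v': "((\<lambda>\<tau>. cmap d' (F \<tau> x)) has_vector_derivative velocity B F t x d') (at t)"
      using velocity_frep(1)[OF A F c(1) _ c(2) _ U(2)] d by auto
    have T: "(cmap d' \<circ> id \<circ> cinv d has_derivative tdiff d d' id (F t x)) (at (cmap d (F t x)))"
      using d by (intro tdiff_has[OF smooth_map_id[OF B]]) auto
    have "((\<lambda>\<tau>. (cmap d' \<circ> id \<circ> cinv d) (cmap d (F \<tau> x))) has_vector_derivative
       tdiff d d' id (F t x) (velocity B F t x d)) (at t)"
      using vector_derivative_diff_chain_within[OF v has_derivative_at_withinI[OF T]] by (simp add: o_def)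
    moreover have "continuous_on U (\<lambda>t. F t x)"
      using continuous_on_compose2[OF smooth_familyD(1)[OF F], of U "\<lambda>t. (t, x)"]
      by (simp add: continuous_on_Pair image_subset_iff)
    then have "open (U \<inter> (\<lambda>t. F t x) -` cdom d)"
      by (intro continuous_open_preimage U atlas_open[OF B d(1)])
    ultimately have "((\<lambda>\<tau>. cmap d' (F \<tau> x)) has_vector_derivative
       tdiff d d' id (F t x) (velocity B F t x d)) (at t)"
      by (rule has_vector_derivative_transform_within_open)
         (use d U in \<open>auto simp: cinv_cmap[OF B d(1)]\<close>)
    then show ?thesis using v' vector_derivative_unique_at by blast
  qed
  then show ?thesis by (rule tangentI[rotated]) (auto simp: velocity_def)
qed

lemma velocity_family:
  fixes U :: "real set"
  assumes A: "smooth_atlas A" and B: "smooth_atlas B" and F: "smooth_family A B U F" and U: "open U"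
  shows "smooth_section_family A B U F (velocity B F)"
  unfolding smooth_section_family_def
proof (intro conjI ballI allI)
  show "velocity B F t x \<in> tangent_space B (F t x)" if "t \<in> U" for t x
    by (rule velocity_in[OF A B F U that])
  fix c d assume c: "c \<in> A" "d \<in> B"
  have o: "open (fset c d U F)" by (rule fset_open[OF A B smooth_familyD(1)[OF F] c U])
  have "smooth_on (fset c d U F) (\<lambda>z. frechet_derivative (frep c d F) (at z) (1, 0))"
    by (rule smooth_on_frechet[OF smooth_familyD(2)[OF F c]])
  then show "smooth_on (fset c d U F) (\<lambda>(t, y). velocity B F t (cinv c y) d)"
    by (rule smooth_on_cong[OF o, rotated])
      (auto simp: velocity_frep(2)[OF A F c] cinv_cmap[OF A c(1)])
qed

lemma tdiff_frep:
  fixes U :: "'p::euclidean_space set"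
  assumes A: "smooth_atlas A" and B: "smooth_atlas B" and F: "smooth_family A B U F"
    and c: "c \<in> A" "d \<in> B" "x \<in> cdom c" "F p x \<in> cdom d" "p \<in> U"
  shows "tdiff c d (F p) x a = frechet_derivative (frep c d F) (at (p, cmap c x)) (0, a)"
proof -
  let ?D = "frechet_derivative (frep c d F) (at (p, cmap c x))"
  have 1: "((\<lambda>y. (p, y)) has_derivative (\<lambda>a. (0, a))) (at (cmap c x))"
    by (auto intro!: derivative_eq_intros)
  have "((\<lambda>y. frep c d F (p, y)) has_derivative (\<lambda>a. ?D (0, a))) (at (cmap c x))"
    by (rule has_derivative_compose[OF 1 frep_deriv[OF A F c]])
  then have "(cmap d \<circ> F p \<circ> cinv c has_derivative (\<lambda>a. ?D (0, a))) (at (cmap c x))" by (simp add: o_def)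
  then show ?thesis unfolding tdiff_def by (metis frechet_derivative_at)
qed

lemma tangent_family:
  fixes U :: "'p::euclidean_space set"
  assumes A: "smooth_atlas A" and B: "smooth_atlas B" and F: "smooth_family A B U F" and U: "open U"
    and X: "X \<in> vector_fields A"
  shows "smooth_section_family A B U F (\<lambda>p x. tangent_map A B (F p) x (X x))"
  unfolding smooth_section_family_def
proof (intro conjI ballI allI)
  have XT: "X x \<in> tangent_space A x" for x using X by (auto simp: vector_fields_def sections_along_def)
  show "tangent_map A B (F p) x (X x) \<in> tangent_space B (F p x)" if "p \<in> U" for p x
    by (rule tangent_map_in[OF A B family_slice[OF A B F that] XT])
  fix c d assume c: "c \<in> A" "d \<in> B"
  have o: "open (fset c d U F)" by (rule fset_open[OF A B smooth_familyD(1)[OF F] c U])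
  have "smooth_on (cimg c) (\<lambda>y. X (cinv c y) c)"
    using X c by (force simp: vector_fields_def sections_along_def)
  then have "smooth_on (fset c d U F) (\<lambda>z. X (cinv c (snd z)) c)"
    by (rule smooth_on_compose[OF o smooth_on_bounded_linear[OF bounded_linear_snd o]]) auto
  then have "smooth_on (fset c d U F) (\<lambda>z. (0::'p, X (cinv c (snd z)) c))"
    by (intro smooth_on_Pair smooth_on_const o)
  then have "smooth_on (fset c d U F) (\<lambda>z. frechet_derivative (frep c d F) (at z) (0, X (cinv c (snd z)) c))"
    by (intro smooth_on_frechet_dir o smooth_familyD(2)[OF F c])
  then show "smooth_on (fset c d U F) (\<lambda>(p, y). tangent_map A B (F p) (cinv c y) (X (cinv c y)) d)"
  proof (rule smooth_on_cong[OF o, rotated])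
    fix z assume z: "z \<in> fset c d U F"
    obtain p y where py: "z = (p, y)" by fastforce
    show "frechet_derivative (frep c d F) (at z) (0, X (cinv c (snd z)) c) =
       (\<lambda>(p, y). tangent_map A B (F p) (cinv c y) (X (cinv c y)) d) z"
      using z tangent_map_at[OF A B family_slice[OF A B F] XT c cinv_in, of p y]
        tdiff_frep[OF A B F c cinv_in, of y p] by (auto simp: py cmap_cinv)
  qed
qed

text \<open>The first summand is the motion of \<open>f\<close> at a fixed point, the second one the motion
  of the point itself.\<close>

lemma velocity_comp:
  fixes U V :: "real set"
  assumes A: "smooth_atlas A" and A': "smooth_atlas A'" and B: "smooth_atlas B"
    and phi: "smooth_family A A' V \<phi>" and f: "smooth_family A' B U f"
    and o: "open U" "open V" and t: "t \<in> U" "\<theta> t \<in> V"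
    and th: "(\<theta> has_real_derivative \<theta>') (at t)"
  shows "velocity B (\<lambda>t. f t \<circ> \<phi> (\<theta> t)) t x =
     lincomb 1 (velocity B f t (\<phi> (\<theta> t) x)) \<theta>' (tangent_map A' B (f t) (\<phi> (\<theta> t) x) (velocity A' \<phi> (\<theta> t) x))"
    (is "_ = ?R")
proof
  fix d
  let ?z = "\<phi> (\<theta> t) x"
  show "velocity B (\<lambda>t. f t \<circ> \<phi> (\<theta> t)) t x d = ?R d"
  proof (cases "d \<in> B \<and> f t ?z \<in> cdom d")
    case True
    obtain c where c: "c \<in> A" "x \<in> cdom c" using atlas_cover[OF A] by blast
    obtain c' where c': "c' \<in> A'" "?z \<in> cdom c'" using atlas_cover[OF A'] by blast
    let ?D = "frechet_derivative (frep c' d f) (at (t, cmap c' ?z))"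
    let ?v = "velocity A' \<phi> (\<theta> t) x c'"
    have D: "(frep c' d f has_derivative ?D) (at (t, cmap c' ?z))"
      using True c' t by (intro frep_deriv[OF A' f]) auto
    have "((\<lambda>\<tau>. cmap c' (\<phi> \<tau> x)) has_vector_derivative ?v) (at (\<theta> t))"
      by (rule velocity_frep(1)[OF A phi c(1) c'(1) c(2) c'(2) t(2)])
    then have "((\<lambda>\<tau>. cmap c' (\<phi> \<tau> x)) has_derivative (\<lambda>h. h *\<^sub>R ?v)) (at (\<theta> t))"
      by (simp add: has_vector_derivative_def)
    moreover have "(\<theta> has_derivative (\<lambda>h. h * \<theta>')) (at t)"
      using th unfolding has_field_derivative_def by (simp add: mult.commute[of _ \<theta>'])
    ultimately have "((\<lambda>\<tau>. cmap c' (\<phi> (\<theta> \<tau>) x)) has_derivative (\<lambda>h. (h * \<theta>') *\<^sub>R ?v)) (at t)"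
      by (rule has_derivative_compose[rotated])
    then have "((\<lambda>\<tau>. (\<tau>, cmap c' (\<phi> (\<theta> \<tau>) x))) has_derivative (\<lambda>h. (h, (h * \<theta>') *\<^sub>R ?v))) (at t)"
      by (intro has_derivative_Pair has_derivative_ident)
    then have "((\<lambda>\<tau>. frep c' d f (\<tau>, cmap c' (\<phi> (\<theta> \<tau>) x))) has_derivative (\<lambda>h. ?D (h, (h * \<theta>') *\<^sub>R ?v))) (at t)"
      by (rule has_derivative_compose[where g="frep c' d f"]) (rule D)
    moreover have "?D (h, (h * \<theta>') *\<^sub>R ?v) = h *\<^sub>R (?D (1, 0) + \<theta>' *\<^sub>R ?D (0, ?v))" for h
    proof -
      interpret linear ?D by (rule has_derivative_linear[OF D])
      have "(h, (h * \<theta>') *\<^sub>R ?v) = h *\<^sub>R ((1, 0) + \<theta>' *\<^sub>R (0, ?v))" by simp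
      then show ?thesis by (simp only: scale add)
    qed
    ultimately have d: "((\<lambda>\<tau>. frep c' d f (\<tau>, cmap c' (\<phi> (\<theta> \<tau>) x))) has_vector_derivative
        (?D (1, 0) + \<theta>' *\<^sub>R ?D (0, ?v))) (at t)" by (simp add: has_vector_derivative_def)
    have "\<theta> \<midarrow>t\<rightarrow> \<theta> t" using DERIV_isCont[OF th] by (simp add: isCont_def)
    have cz: "isCont (\<lambda>\<tau>. \<phi> \<tau> x) (\<theta> t)"
      using continuous_on_compose2[OF smooth_familyD(1)[OF phi], of V "\<lambda>t. (t, x)"] o(2) t(2)
      by (auto intro!: continuous_intros simp: continuous_on_eq_continuous_at)
    have "isCont (\<lambda>\<tau>. \<phi> (\<theta> \<tau>) x) t"
      using isCont_o2[OF DERIV_isCont[OF th] cz] .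
    then have "\<forall>\<^sub>F \<tau> in at t. \<phi> (\<theta> \<tau>) x \<in> cdom c'"
      using c' atlas_open[OF A' c'(1)] by (auto simp: isCont_def elim!: topological_tendstoD)
    then have ev: "\<forall>\<^sub>F \<tau> in nhds t. frep c' d f (\<tau>, cmap c' (\<phi> (\<theta> \<tau>) x)) = cmap d ((f \<tau> \<circ> \<phi> (\<theta> \<tau>)) x)"
      using c' by (auto simp: eventually_nhds_conv_at cinv_cmap[OF A' c'(1)] elim!: eventually_mono)
    have "((\<lambda>\<tau>. cmap d ((f \<tau> \<circ> \<phi> (\<theta> \<tau>)) x)) has_vector_derivative
        (?D (1, 0) + \<theta>' *\<^sub>R ?D (0, ?v))) (at t)"
      using d has_vector_derivative_cong_ev[of UNIV "\<lambda>\<tau>. frep c' d f (\<tau>, cmap c' (\<phi> (\<theta> \<tau>) x))"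
         "\<lambda>\<tau>. cmap d ((f \<tau> \<circ> \<phi> (\<theta> \<tau>)) x)" t] eventually_mono[OF ev] eventually_nhds_x_imp_x[OF ev]
      by auto
    then have "velocity B (\<lambda>t. f t \<circ> \<phi> (\<theta> t)) t x d = ?D (1, 0) + \<theta>' *\<^sub>R ?D (0, ?v)"
      using True by (simp add: velocity_def vector_derivative_at)
    moreover have "velocity B f t ?z d = ?D (1, 0)"
      using True c' t by (intro velocity_frep(2)[OF A' f]) auto
    moreover have "tangent_map A' B (f t) ?z (velocity A' \<phi> (\<theta> t) x) d = ?D (0, ?v)"
      using True c' t tangent_map_at[OF A' B family_slice[OF A' B f t(1)]
          velocity_in[OF A A' phi o(2) t(2)] c'(1) _ c'(2)] tdiff_frep[OF A' B f c'(1) _ c'(2), of d t]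
      by simp
    ultimately show ?thesis by (simp add: lincomb_def)
  next
    case False
    then show ?thesis by (auto simp: velocity_def lincomb_def tangent_map_def)
  qed
qed

section \<open>Change of variables for Borel functions\<close>

text \<open>The theorem \<open>has_absolute_integral_change_of_variables\<close> assumes a well-ordered index type.
  The type \<open>'a idx\<close> is a well-ordered copy of the finite type \<open>'a\<close>; relabelling the coordinates by
  a bijection is compatible with determinants and with Lebesgue measure.\<close>

typedef ('a::finite) idx = "{..<CARD('a)}"
  by (rule exI[of _ 0]) simp

instance idx :: (finite) finite
proof
  have "finite (Abs_idx ` {..<CARD('a)} :: 'a idx set)" by simp
  then show "finite (UNIV :: 'a idx set)"
    using type_definition.Abs_image[OF type_definition_idx] by metis
qed

instantiation idx :: (finite) wellorder
begin

definition less_eq_idx :: "'a idx \<Rightarrow> 'a idx \<Rightarrow> bool" where "less_eq_idx i j \<longleftrightarrow> Rep_idx i \<le> Rep_idx j"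
definition less_idx :: "'a idx \<Rightarrow> 'a idx \<Rightarrow> bool" where "less_idx i j \<longleftrightarrow> Rep_idx i < Rep_idx j"

instance
proof
  fix P :: "'a idx \<Rightarrow> bool" and i
  assume H: "\<And>i. (\<And>j. j < i \<Longrightarrow> P j) \<Longrightarrow> P i"
  show "P i"
  proof (induction "Rep_idx i" arbitrary: i rule: less_induct)
    case less
    show ?case by (rule H, rule less) (simp add: less_idx_def)
  qed
qed (auto simp: less_eq_idx_def less_idx_def Rep_idx_inject)

end

lemma idx_bij: obtains \<sigma> :: "'k::finite idx \<Rightarrow> 'k" where "bij \<sigma>"
proof -
  have "CARD('k idx) = CARD('k)"
    using type_definition.card[OF type_definition_idx[where 'a='k]] by simp
  then show ?thesis
    using finite_same_card_bij[of "UNIV :: 'k idx set" "UNIV :: 'k set"] that by auto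
qed

text \<open>Conjugation with \<open>\<sigma>\<close> is a sign-preserving bijection between the permutations
  of the two index types.\<close>

lemma det_reindex:
  fixes M :: "real^'k^'k" and \<sigma> :: "'i::finite \<Rightarrow> 'k::finite"
  assumes "bij \<sigma>"
  shows "det (\<chi> i j. M $ \<sigma> i $ \<sigma> j) = det M"
proof -
  have inj: "inj \<sigma>" and bb: "bij_betw \<sigma> UNIV UNIV" using assms by (auto simp: bij_def)
  let ?h = "map_permutation UNIV \<sigma>" and ?h' = "map_permutation UNIV (inv \<sigma>)"
  have hs: "?h p (\<sigma> i) = \<sigma> (p i)" for p i
    using inj by (simp add: map_permutation_def restrict_id_def)
  have hs': "?h' q (inv \<sigma> j) = inv \<sigma> (q j)" for q j
    using bij_imp_bij_inv[OF assms] by (simp add: map_permutation_def restrict_id_def bij_is_inj bij_is_surj)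
  have h'h: "?h' (?h p) = p" for p
  proof
    fix i show "?h' (?h p) i = p i"
      using hs'[of "?h p" "\<sigma> i"] hs[of p i] inj by (simp add: inv_f_f)
  qed
  have hh': "?h (?h' q) = q" for q
  proof
    fix j show "?h (?h' q) j = q j"
      using hs[of "?h' q" "inv \<sigma> j"] hs'[of q j] assms by (simp add: bij_is_surj surj_f_inv_f)
  qed
  have "det M = (\<Sum>q | q permutes UNIV. of_int (sign q) * (\<Prod>i\<in>UNIV. M $ i $ q i))"
    by (simp add: det_def)
  also have "\<dots> = (\<Sum>p | p permutes (UNIV :: 'i set). of_int (sign (?h p)) * (\<Prod>i\<in>UNIV. M $ i $ ?h p i))"
  proof (rule sum.reindex_bij_witness[of _ ?h ?h'])
    fix p :: "'i \<Rightarrow> 'i" assume p: "p \<in> {p. p permutes UNIV}"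
    then show "?h p \<in> {q. q permutes UNIV}"
      using map_permutation_permutes[OF bb] by auto
    show "?h' (?h p) = p" by (rule h'h)
  next
    fix q :: "'k \<Rightarrow> 'k" assume q: "q \<in> {p. p permutes UNIV}"
    then show "?h' q \<in> {q. q permutes UNIV}"
      using map_permutation_permutes[of "inv \<sigma>" UNIV UNIV q] bij_imp_bij_inv[OF assms] by auto
    show "?h (?h' q) = q" by (rule hh')
    show "of_int (sign (?h (?h' q))) * (\<Prod>i\<in>UNIV. M $ i $ ?h (?h' q) i) = of_int (sign q) * (\<Prod>i\<in>UNIV. M $ i $ q i)"
      by (simp only: hh')
  qed
  also have "\<dots> = (\<Sum>p | p permutes (UNIV :: 'i set). of_int (sign p) * (\<Prod>i\<in>UNIV. M $ \<sigma> i $ \<sigma> (p i)))"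
  proof (rule sum.cong[OF refl])
    fix p :: "'i \<Rightarrow> 'i" assume p: "p \<in> {p. p permutes UNIV}"
    have "sign (?h p) = sign p" using p inj by (intro sign_map_permutation) auto
    moreover have "(\<Prod>i\<in>UNIV. M $ i $ ?h p i) = (\<Prod>i\<in>UNIV. M $ \<sigma> i $ \<sigma> (p i))"
      using prod.reindex_bij_betw[OF bb, of "\<lambda>i. M $ i $ ?h p i"] by (simp add: hs)
    ultimately show "of_int (sign (?h p)) * (\<Prod>i\<in>UNIV. M $ i $ ?h p i) = of_int (sign p) * (\<Prod>i\<in>UNIV. M $ \<sigma> i $ \<sigma> (p i))"
      by simp
  qed
  also have "\<dots> = det (\<chi> i j. M $ \<sigma> i $ \<sigma> j)" by (simp add: det_def)
  finally show ?thesis by simp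
qed

lemma prod_Basis_cart: "(\<Prod>b\<in>Basis. (x :: real^'k) \<bullet> b) = (\<Prod>i\<in>UNIV. x $ i)"
proof -
  have "(Basis :: (real^'k) set) = (\<lambda>i. axis i 1) ` UNIV" by (auto simp: Basis_vec_def)
  moreover have "inj (\<lambda>i::'k. axis i (1::real))" by (auto simp: inj_on_def axis_eq_axis)
  ultimately have "(\<Prod>b\<in>Basis. x \<bullet> b) = (\<Prod>i\<in>UNIV. x \<bullet> axis i 1)"
    using prod.reindex[of "\<lambda>i. axis i 1" UNIV "\<lambda>b. x \<bullet> b"] by (simp only: comp_def)
  then show ?thesis by (simp add: inner_axis)
qed

text \<open>Relabelling coordinates maps boxes to boxes with the same side lengths.\<close>

lemma distr_reindex:
  fixes \<sigma> :: "'i::finite \<Rightarrow> 'k::finite"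
  assumes "bij \<sigma>"
  shows "distr lborel borel (\<lambda>y::real^'k. \<chi> i. y $ \<sigma> i) = lborel"
proof (rule lborel_eqI[symmetric])
  let ?T = "\<lambda>y::real^'k. \<chi> i. y $ \<sigma> i"
  have [measurable]: "?T \<in> borel_measurable borel"
    by (intro borel_measurable_continuous_onI continuous_intros)
  fix l u :: "real^'i" assume le: "\<And>b. b \<in> Basis \<Longrightarrow> l \<bullet> b \<le> u \<bullet> b"
  let ?S = "\<lambda>z. \<chi> j. z $ inv \<sigma> j :: real^'k"
  have e: "?T -` box l u = box (?S l) (?S u)"
    using assms by (auto simp: mem_box_cart bij_is_surj surj_f_inv_f) (metis assms bij_inv_eq_iff)+
  have le': "?S l \<bullet> b \<le> ?S u \<bullet> b" if "b \<in> Basis" for b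
  proof -
    have "l $ i \<le> u $ i" for i
      using le[of "axis i 1"] by (auto simp: Basis_vec_def inner_axis)
    then show ?thesis using that by (auto simp: Basis_vec_def inner_axis)
  qed
  have "emeasure (distr lborel borel ?T) (box l u) = emeasure lborel (box (?S l) (?S u))"
    by (subst emeasure_distr) (auto simp: e)
  also have "\<dots> = (\<Prod>b\<in>Basis. (?S u - ?S l) \<bullet> b)" using le' by (intro emeasure_lborel_box)
  also have "(\<Prod>b\<in>Basis. (?S u - ?S l) \<bullet> b) = (\<Prod>j\<in>UNIV. (u - l) $ inv \<sigma> j)"
    by (subst prod_Basis_cart) simp
  also have "\<dots> = (\<Prod>i\<in>UNIV. (u - l) $ i)"
    using prod.reindex_bij_betw[of "inv \<sigma>" UNIV UNIV "\<lambda>i. (u - l) $ i"] bij_imp_bij_inv[OF assms] by simp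
  finally show "emeasure (distr lborel borel ?T) (box l u) = (\<Prod>b\<in>Basis. (u - l) \<bullet> b)"
    by (simp only: prod_Basis_cart)
qed simp

text \<open>A Borel function is integrable for Lebesgue-Borel measure iff it is for the completion, and then
  the gauge integral has the same value.\<close>

lemma set_lborel_lebesgue:
  fixes F :: "'a::euclidean_space \<Rightarrow> real"
  assumes "set_borel_measurable borel S F"
  shows "set_integrable lborel S F \<longleftrightarrow> F absolutely_integrable_on S"
    and "set_integrable lborel S F \<Longrightarrow> (LINT y:S|lborel. F y) = integral S F"
  using assms set_borel_integral_eq_integral(2)[of S F]
  by (simp_all add: set_integrable_def set_borel_measurable_def integrable_completion)

text \<open>Equality of integrals is paired with equivalence of integrability, since a function that is not
  integrable has integral 0.\<close>

definition same_int :: "'a::euclidean_space set \<Rightarrow> ('a \<Rightarrow> real) \<Rightarrow> 'b::euclidean_space set \<Rightarrow> ('b \<Rightarrow> real) \<Rightarrow> bool" where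
  "same_int S F S' F' \<longleftrightarrow> (set_integrable lborel S F \<longleftrightarrow> set_integrable lborel S' F') \<and>
     (LINT y:S|lborel. F y) = (LINT y:S'|lborel. F' y)"

lemma not_integrable_LINT: "\<not> set_integrable M S (F :: _ \<Rightarrow> real) \<Longrightarrow> (LINT y:S|M. F y) = 0"
  by (simp add: set_integrable_def set_lebesgue_integral_def not_integrable_integral_eq)

text \<open>The general theorem speaks about vector valued functions; a real function is read as one with
  values in \<open>real^1\<close>.\<close>

lemma change_of_variables_wellorder:
  fixes g :: "real^'k::{finite,wellorder} \<Rightarrow> real^'k::_" and F :: "real^'k::_ \<Rightarrow> real"
  assumes S: "S \<in> sets borel" "\<And>x. x \<in> S \<Longrightarrow> (g has_derivative g' x) (at x)" "inj_on g S"
    and F: "set_borel_measurable borel (g ` S) F" "set_borel_measurable borel S (\<lambda>x. \<bar>det (matrix (g' x))\<bar> * F (g x))"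
  shows "same_int S (\<lambda>x. \<bar>det (matrix (g' x))\<bar> * F (g x)) (g ` S) F"
proof -
  let ?V = "\<lambda>x. vec (F x) :: real^1" and ?G = "\<lambda>x. \<bar>det (matrix (g' x))\<bar> * F (g x)"
  have "S \<in> sets lebesgue" using S(1) by simp
  from has_absolute_integral_change_of_variables[OF this has_derivative_at_withinI[OF S(2)] S(3), of ?V]
  have cv: "((\<lambda>x. \<bar>det (matrix (g' x))\<bar> *\<^sub>R ?V (g x)) absolutely_integrable_on S \<and>
      integral S (\<lambda>x. \<bar>det (matrix (g' x))\<bar> *\<^sub>R ?V (g x)) = b) \<longleftrightarrow>
      ?V absolutely_integrable_on g ` S \<and> integral (g ` S) ?V = b" for b by blast
  have 1: "(\<lambda>x. \<bar>det (matrix (g' x))\<bar> *\<^sub>R ?V (g x)) absolutely_integrable_on S \<longleftrightarrow> ?G absolutely_integrable_on S"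
    by (subst absolutely_integrable_on_1_iff) simp
  have 2: "?V absolutely_integrable_on g ` S \<longleftrightarrow> F absolutely_integrable_on g ` S"
    by (subst absolutely_integrable_on_1_iff) simp
  have 3: "integral S (\<lambda>x. \<bar>det (matrix (g' x))\<bar> *\<^sub>R ?V (g x)) = vec (integral S ?G)"
    by (subst integral_on_1_eq) simp
  have 4: "integral (g ` S) ?V = vec (integral (g ` S) F)"
    by (subst integral_on_1_eq) simp
  have cv': "(?G absolutely_integrable_on S \<and> vec (integral S ?G) = b) \<longleftrightarrow>
     F absolutely_integrable_on g ` S \<and> vec (integral (g ` S) F) = b" for b :: "real^1"
    using cv[of b] unfolding 1 2 3 4 .
  have i: "set_integrable lborel S ?G \<longleftrightarrow> set_integrable lborel (g ` S) F"
    unfolding set_lborel_lebesgue(1)[OF F(1)] set_lborel_lebesgue(1)[OF F(2)] using cv' by blast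
  show ?thesis
  proof (cases "set_integrable lborel S ?G")
    case True
    then have "vec (integral S ?G) = (vec (integral (g ` S) F) :: real^1)"
      using cv' i set_lborel_lebesgue(1)[OF F(2)] by blast
    then have "integral S ?G = integral (g ` S) F" by (simp add: vec_eq_iff)
    then show ?thesis
      using True i set_lborel_lebesgue(2)[OF F(1)] set_lborel_lebesgue(2)[OF F(2)] by (simp add: same_int_def)
  next
    case False
    then show ?thesis using i not_integrable_LINT by (simp add: same_int_def not_integrable_LINT)
  qed
qed

lemma same_int_reindex:
  fixes \<sigma> :: "'i::finite \<Rightarrow> 'k::finite" and F :: "real^'k \<Rightarrow> real"
  assumes \<sigma>: "bij \<sigma>" and F: "set_borel_measurable borel S F"
  defines "T \<equiv> \<lambda>y::real^'k. \<chi> i. y $ \<sigma> i" and "T' \<equiv> \<lambda>z::real^'i. \<chi> j. z $ inv \<sigma> j"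
  shows "same_int (T ` S) (\<lambda>z. F (T' z)) S F"
    and "set_borel_measurable borel (T ` S) (\<lambda>z. F (T' z))"
proof -
  have TT: "T' (T y) = y" "T (T' z) = z" for y z
    using \<sigma> by (auto simp: T_def T'_def vec_eq_iff bij_is_surj surj_f_inv_f bij_is_inj inv_f_f)
  have Tm: "T \<in> borel_measurable borel" "T' \<in> borel_measurable borel"
    unfolding T_def T'_def by (intro borel_measurable_continuous_onI continuous_intros)+
  have ind: "indicat_real (T ` S) z = indicat_real S (T' z)" for z
  proof -
    have "z \<in> T ` S \<longleftrightarrow> T' z \<in> S"
    proof
      show "z \<in> T ` S \<Longrightarrow> T' z \<in> S" using TT(1) by auto
      show "T' z \<in> S \<Longrightarrow> z \<in> T ` S" using TT(2)[of z] by (intro image_eqI[of _ _ "T' z"]) auto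
    qed
    then show ?thesis by (simp add: indicator_def)
  qed
  have "(\<lambda>z. (\<lambda>y. indicat_real S y *\<^sub>R F y) (T' z)) \<in> borel_measurable borel"
    using F by (intro measurable_compose[OF Tm(2)]) (simp add: set_borel_measurable_def)
  then show m: "set_borel_measurable borel (T ` S) (\<lambda>z. F (T' z))"
    by (simp add: set_borel_measurable_def ind)
  have d: "lborel = distr lborel borel T" unfolding T_def by (rule distr_reindex[OF \<sigma>, symmetric])
  have m': "(\<lambda>z. indicat_real (T ` S) z *\<^sub>R F (T' z)) \<in> borel_measurable borel"
    using m by (simp add: set_borel_measurable_def)
  have Tm': "T \<in> measurable lborel borel" using Tm(1) by simp
  show "same_int (T ` S) (\<lambda>z. F (T' z)) S F"
    unfolding same_int_def set_integrable_def set_lebesgue_integral_def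
    using integrable_distr_eq[OF Tm' m'] integral_distr[OF Tm' m'] d[symmetric]
    by (simp add: ind TT)
qed

text \<open>Conjugation with the relabelling of coordinates reduces to a well-ordered index type; the
  Jacobian matrix is reindexed by \<open>\<sigma>\<close> and keeps its determinant.\<close>

lemma change_of_variables_borel:
  fixes g :: "real^'k \<Rightarrow> real^'k" and F :: "real^'k \<Rightarrow> real"
  assumes S: "S \<in> sets borel" "\<And>x. x \<in> S \<Longrightarrow> (g has_derivative g' x) (at x)" "inj_on g S"
    and F: "set_borel_measurable borel (g ` S) F" "set_borel_measurable borel S (\<lambda>x. \<bar>det (matrix (g' x))\<bar> * F (g x))"
  shows "same_int S (\<lambda>x. \<bar>det (matrix (g' x))\<bar> * F (g x)) (g ` S) F"
proof -
  obtain \<sigma> :: "'k idx \<Rightarrow> 'k" where \<sigma>: "bij \<sigma>" by (rule idx_bij)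
  define T where "T = (\<lambda>y::real^'k. \<chi> i. y $ \<sigma> i)"
  define T' where "T' = (\<lambda>z::real^'k idx. \<chi> j. z $ inv \<sigma> j)"
  have TT: "T' (T y) = y" "T (T' z) = z" for y z
    using \<sigma> by (auto simp: T_def T'_def vec_eq_iff bij_is_surj surj_f_inv_f bij_is_inj inv_f_f)
  have Tl: "linear T" "linear T'" by (auto simp: T_def T'_def vec_eq_iff intro!: linearI)
  then have Tb: "bounded_linear T" "bounded_linear T'" by (simp_all add: linear_conv_bounded_linear)
  define G where "G = T \<circ> g \<circ> T'"
  define G' where "G' = (\<lambda>z v. T (g' (T' z) (T' v)))"
  have TS: "T ` S = T' -` S" using TT by (auto simp: image_iff) metis
  have "T' \<in> borel_measurable borel"
    using Tb(2) by (intro borel_measurable_continuous_onI linear_continuous_on)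
  then have TSm: "T ` S \<in> sets borel" using measurable_sets_borel[OF _ S(1)] TS by metis
  have dG: "(G has_derivative G' z) (at z)" if "z \<in> T ` S" for z
  proof -
    have "T' z \<in> S" using that TT by auto
    then have "(g has_derivative g' (T' z)) (at (T' z))" by (rule S(2))
    then have "((\<lambda>z. g (T' z)) has_derivative (\<lambda>v. g' (T' z) (T' v))) (at z)"
      by (rule has_derivative_compose[OF bounded_linear_imp_has_derivative[OF Tb(2)]])
    then show ?thesis
      unfolding G_def G'_def comp_def by (rule bounded_linear.has_derivative[OF Tb(1)])
  qed
  have injG: "inj_on G (T ` S)"
    using S(3) TT unfolding G_def inj_on_def by (metis comp_apply image_iff)
  have det: "det (matrix (G' z)) = det (matrix (g' (T' z)))" if "z \<in> T ` S" for z
  proof -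
    have ax: "T' (axis j 1) = axis (\<sigma> j) 1" for j
      using \<sigma> by (auto simp: T'_def vec_eq_iff axis_def bij_inv_eq_iff) (metis \<sigma> bij_inv_eq_iff)+
    have "matrix (G' z) = (\<chi> i j. matrix (g' (T' z)) $ \<sigma> i $ \<sigma> j)"
      by (simp add: matrix_def G'_def vec_eq_iff ax) (simp add: T_def)
    then show ?thesis by (simp add: det_reindex[OF \<sigma>])
  qed
  have GS: "G ` T ` S = T ` g ` S" by (simp add: G_def image_comp comp_def TT)
  have 1: "same_int (T ` S) (\<lambda>z. \<bar>det (matrix (g' (T' z)))\<bar> * F (g (T' z))) S (\<lambda>x. \<bar>det (matrix (g' x))\<bar> * F (g x))"
    and m1: "set_borel_measurable borel (T ` S) (\<lambda>z. \<bar>det (matrix (g' (T' z)))\<bar> * F (g (T' z)))"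
    using same_int_reindex[OF \<sigma> F(2)] by (simp_all add: T_def T'_def)
  have 2: "same_int (T ` g ` S) (\<lambda>z. F (T' z)) (g ` S) F"
    and m2: "set_borel_measurable borel (T ` g ` S) (\<lambda>z. F (T' z))"
    using same_int_reindex[OF \<sigma> F(1)] by (simp_all add: T_def T'_def)
  have eq: "\<bar>det (matrix (G' z))\<bar> * F (T' (G z)) = \<bar>det (matrix (g' (T' z)))\<bar> * F (g (T' z))" if "z \<in> T ` S" for z
    using det[OF that] by (simp add: G_def TT)
  have m1': "set_borel_measurable borel (T ` S) (\<lambda>z. \<bar>det (matrix (G' z))\<bar> * F (T' (G z)))"
  proof -
    have "(\<lambda>z. indicat_real (T ` S) z *\<^sub>R (\<bar>det (matrix (G' z))\<bar> * F (T' (G z)))) =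
       (\<lambda>z. indicat_real (T ` S) z *\<^sub>R (\<bar>det (matrix (g' (T' z)))\<bar> * F (g (T' z))))"
      using eq by (auto simp: indicator_def)
    then show ?thesis using m1 by (simp add: set_borel_measurable_def)
  qed
  have "same_int (T ` S) (\<lambda>z. \<bar>det (matrix (G' z))\<bar> * F (T' (G z))) (G ` T ` S) (\<lambda>z. F (T' z))"
    by (rule change_of_variables_wellorder[OF TSm dG injG]) (use m2 GS m1' in simp_all)
  moreover have "set_integrable lborel (T ` S) (\<lambda>z. \<bar>det (matrix (G' z))\<bar> * F (T' (G z))) =
       set_integrable lborel (T ` S) (\<lambda>z. \<bar>det (matrix (g' (T' z)))\<bar> * F (g (T' z)))"
    by (rule set_integrable_cong) (use eq in auto)
  moreover have "(LINT z:T ` S|lborel. \<bar>det (matrix (G' z))\<bar> * F (T' (G z))) =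
       (LINT z:T ` S|lborel. \<bar>det (matrix (g' (T' z)))\<bar> * F (g (T' z)))"
    by (rule set_lebesgue_integral_cong) (use eq TSm in auto)
  ultimately show ?thesis using 1 2 GS by (simp add: same_int_def)
qed

section \<open>Integration of densities\<close>

definition cont_dens :: "('m::topological_space, 'k::finite) chart set \<Rightarrow> ('m \<Rightarrow> ('m, 'k) dens) \<Rightarrow> bool" where
  "cont_dens A \<mu> \<longleftrightarrow> (\<forall>c\<in>A. continuous_on (cimg c) (\<lambda>y. \<mu> (cinv c y) c))"

definition pullback_dens :: "('m::topological_space, 'k::finite) chart set \<Rightarrow> ('m \<Rightarrow> 'm)
    \<Rightarrow> ('m \<Rightarrow> ('m, 'k) dens) \<Rightarrow> ('m \<Rightarrow> ('m, 'k) dens) \<Rightarrow> bool" where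
  "pullback_dens A \<phi> \<mu> \<nu> \<longleftrightarrow> (\<forall>x. \<forall>c\<in>A. \<forall>c'\<in>A. x \<in> cdom c \<longrightarrow> \<phi> x \<in> cdom c' \<longrightarrow>
     \<nu> x c = \<bar>det (matrix (tdiff c c' \<phi> x))\<bar> * \<mu> (\<phi> x) c')"

lemma chart_borel:
  fixes A :: "('m::topological_space, 'k::finite) chart set"
  assumes A: "smooth_atlas A" and c: "c \<in> A" and E: "E \<in> sets borel" "E \<subseteq> cdom c"
  shows "cmap c ` E \<in> sets borel"
proof -
  have eq: "cmap c ` E = cinv c -` E \<inter> space (restrict_space borel (cimg c))"
    using chart_image_eq[OF A c, of E] E(2) by (auto simp: space_restrict_space Int_absorb1)
  have "cinv c \<in> borel_measurable (restrict_space borel (cimg c))"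
    by (rule borel_measurable_continuous_on_restrict[OF cont_cinv[OF A c]])
  then have "cmap c ` E \<in> sets (restrict_space borel (cimg c))"
    unfolding eq by (rule measurable_sets[OF _ E(1)])
  then show ?thesis
    using atlas_open_img[OF A c] by (subst (asm) sets_restrict_space_iff) auto
qed

lemma disjoint_remainders:
  fixes m n :: nat assumes "m \<noteq> n"
  shows "(F m - (\<Union>j<m. F j)) \<inter> (F n - (\<Union>j<n. F j)) = {}"
  using assms by (cases "m < n") auto

lemma LINT_finite_Union:
  fixes f :: "'a \<Rightarrow> real"
  assumes "finite I" "disjoint_family_on E I" "\<And>i. i \<in> I \<Longrightarrow> set_integrable M (E i) f"
  shows "(LINT x:(\<Union>i\<in>I. E i)|M. f x) = (\<Sum>i\<in>I. LINT x:E i|M. f x)"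
proof -
  have "indicat_real (\<Union>i\<in>I. E i) x *\<^sub>R f x = (\<Sum>i\<in>I. indicat_real (E i) x *\<^sub>R f x)" for x
    using assms(1,2) by (subst indicator_UN_disjoint) (auto simp: sum_distrib_right)
  then show ?thesis
    using assms(3) unfolding set_lebesgue_integral_def set_integrable_def
    by (subst Bochner_Integration.integral_sum[symmetric]) auto
qed

lemma same_int_cong:
  assumes "\<And>y. y \<in> S \<Longrightarrow> F y = G y"
  shows "same_int S F S' F' = same_int S G S' F'"
proof -
  have "(\<lambda>y. indicat_real S y *\<^sub>R F y) = (\<lambda>y. indicat_real S y *\<^sub>R G y)"
    using assms by (auto simp: indicator_def)
  then show ?thesis by (simp add: same_int_def set_integrable_def set_lebesgue_integral_def)
qed

lemma diffeosD:
  assumes "\<phi> \<in> diffeos A"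
  shows "bij \<phi>" "smooth_map A A \<phi>" "smooth_map A A (inv \<phi>)" "continuous_on UNIV \<phi>" "continuous_on UNIV (inv \<phi>)"
  using assms by (auto simp: diffeos_def smooth_map_def)

lemma id_diffeo: "smooth_atlas A \<Longrightarrow> id \<in> diffeos A"
  by (simp add: diffeos_def smooth_map_id inv_id)

text \<open>On a set inside one chart of the source and one chart of the target, the pullback law is exactly
  the hypothesis of the change of variables formula.\<close>

lemma piece_pullback:
  fixes A :: "('m::topological_space, 'k::finite) chart set"
  assumes A: "smooth_atlas A" and c: "c \<in> A" "c' \<in> A" and \<phi>: "\<phi> \<in> diffeos A"
    and pb: "pullback_dens A \<phi> \<mu> \<nu>" and cont: "cont_dens A \<mu>" "cont_dens A \<nu>"
    and E: "E \<in> sets borel" "E \<subseteq> cdom c" "\<phi> ` E \<subseteq> cdom c'"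
  shows "same_int (cmap c ` E) (\<lambda>y. \<nu> (cinv c y) c) (cmap c' ` \<phi> ` E) (\<lambda>y. \<mu> (cinv c' y) c')"
proof -
  let ?g = "cmap c' \<circ> \<phi> \<circ> cinv c" and ?g' = "\<lambda>y. tdiff c c' \<phi> (cinv c y)"
  have inv: "cinv c (cmap c x) = x" if "x \<in> E" for x using cinv_cmap[OF A c(1)] that E by auto
  have gE: "?g ` cmap c ` E = cmap c' ` \<phi> ` E" using inv by (force simp: image_iff)
  have fE: "\<phi> ` E \<in> sets borel"
  proof -
    have "\<phi> ` E = inv \<phi> -` E" using diffeosD(1)[OF \<phi>] by (simp add: bij_vimage_eq_inv_image bij_imp_bij_inv inv_inv_eq)
    moreover have "inv \<phi> \<in> borel_measurable borel"
      using diffeosD(5)[OF \<phi>] by (rule borel_measurable_continuous_onI)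
    ultimately show ?thesis using measurable_sets_borel[OF _ E(1)] by metis
  qed
  have b: "cmap c ` E \<in> sets borel" "cmap c' ` \<phi> ` E \<in> sets borel"
    using chart_borel[OF A c(1) E(1,2)] chart_borel[OF A c(2) fE E(3)] by auto
  have der: "(?g has_derivative ?g' y) (at y)" if "y \<in> cmap c ` E" for y
    using that E inv tdiff_has[OF diffeosD(2)[OF \<phi>] c, of "cinv c y"] by (auto simp: subset_iff)
  have inj: "inj_on ?g (cmap c ` E)"
  proof (rule inj_onI)
    fix y z assume "y \<in> cmap c ` E" "z \<in> cmap c ` E" and eq: "?g y = ?g z"
    then obtain x w where x: "x \<in> E" "y = cmap c x" and w: "w \<in> E" "z = cmap c w" by blast
    then have e: "cmap c' (\<phi> x) = cmap c' (\<phi> w)" using eq inv by simp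
    have "\<phi> x \<in> cdom c'" "\<phi> w \<in> cdom c'" using x w E(3) by auto
    then have "\<phi> x = \<phi> w" using e cinv_cmap[OF A c(2)] by metis
    then show "y = z" using diffeosD(1)[OF \<phi>] x w by (simp add: bij_def inj_eq)
  qed
  have m1: "set_borel_measurable borel (cmap c' ` \<phi> ` E) (\<lambda>y. \<mu> (cinv c' y) c')"
    unfolding set_borel_measurable_def
  proof (rule borel_measurable_continuous_on_indicator[OF b(2)])
    show "continuous_on (cmap c' ` \<phi> ` E) (\<lambda>y. \<mu> (cinv c' y) c')"
      using cont(1) c(2) image_mono[OF E(3), of "cmap c'"] unfolding cont_dens_def
      by (blast intro: continuous_on_subset)
  qed
  have m2: "set_borel_measurable borel (cmap c ` E) (\<lambda>y. \<nu> (cinv c y) c)"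
    unfolding set_borel_measurable_def
  proof (rule borel_measurable_continuous_on_indicator[OF b(1)])
    show "continuous_on (cmap c ` E) (\<lambda>y. \<nu> (cinv c y) c)"
      using cont(2) c(1) image_mono[OF E(2), of "cmap c"] unfolding cont_dens_def
      by (blast intro: continuous_on_subset)
  qed
  have eq: "\<bar>det (matrix (?g' y))\<bar> * \<mu> (cinv c' (?g y)) c' = \<nu> (cinv c y) c" if "y \<in> cmap c ` E" for y
  proof -
    from that obtain x where x: "x \<in> E" "y = cmap c x" by blast
    then have "x \<in> cdom c" "\<phi> x \<in> cdom c'" using E by auto
    then show ?thesis
      using pb c x by (simp add: pullback_dens_def inv cinv_cmap[OF A c(2)])
  qed
  have m3: "set_borel_measurable borel (cmap c ` E) (\<lambda>y. \<bar>det (matrix (?g' y))\<bar> * \<mu> (cinv c' (?g y)) c')"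
  proof -
    have "(\<lambda>y. indicat_real (cmap c ` E) y *\<^sub>R (\<bar>det (matrix (?g' y))\<bar> * \<mu> (cinv c' (?g y)) c')) =
      (\<lambda>y. indicat_real (cmap c ` E) y *\<^sub>R (\<nu> (cinv c y) c))"
      using eq by (auto simp: indicator_def)
    then show ?thesis using m2 by (simp only: set_borel_measurable_def)
  qed
  have s: "same_int (cmap c ` E) (\<lambda>y. \<bar>det (matrix (?g' y))\<bar> * \<mu> (cinv c' (?g y)) c') (?g ` cmap c ` E) (\<lambda>y. \<mu> (cinv c' y) c')"
    by (rule change_of_variables_borel[OF b(1) der inj]) (use m1 m3 gE in simp_all)
  show ?thesis by (rule iffD1[OF same_int_cong s[unfolded gE]]) (rule eq)
qed

text \<open>The image of a chart may be unbounded, and a continuous density on it need not be bounded. On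
  pieces that lie in compact subsets of the chart domains it is.\<close>

definition compact_pieces :: "('m::topological_space, 'k::finite) chart set \<Rightarrow> nat \<Rightarrow> (nat \<Rightarrow> ('m, 'k) chart)
    \<Rightarrow> (nat \<Rightarrow> 'm set) \<Rightarrow> bool" where
  "compact_pieces A n d S \<longleftrightarrow> disjoint_family_on S {..<n} \<and>
     (\<forall>j<n. d j \<in> A \<and> S j \<in> sets borel \<and> (\<exists>K. compact K \<and> S j \<subseteq> K \<and> K \<subseteq> cdom (d j)))"

lemma cont_dens_integrable:
  fixes A :: "('m::topological_space, 'k::finite) chart set"
  assumes A: "smooth_atlas A" and c: "c \<in> A" and \<mu>: "continuous_on (cimg c) (\<lambda>y. \<mu> (cinv c y) c)"
    and K: "compact K" "K \<subseteq> cdom c" and S: "S \<in> sets borel" "S \<subseteq> K"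
  shows "set_integrable lborel (cmap c ` S) (\<lambda>y. \<mu> (cinv c y) c :: real)"
proof -
  have "compact (cmap c ` K)"
    using K continuous_on_subset[OF cont_cmap[OF A c]] by (intro compact_continuous_image) auto
  moreover have "continuous_on (cmap c ` K) (\<lambda>y. \<mu> (cinv c y) c)"
    using K by (intro continuous_on_subset[OF \<mu>]) auto
  ultimately have "set_integrable lborel (cmap c ` K) (\<lambda>y. \<mu> (cinv c y) c)"
    unfolding set_integrable_def by (rule borel_integrable_compact)
  then show ?thesis
    using chart_borel[OF A c S(1)] S K by (elim set_integrable_subset) auto
qed

lemma chart_cover_props:
  fixes A :: "('m::topological_space, 'k::finite) chart set"
  assumes A: "smooth_atlas A" and "compact (UNIV :: 'm set)"
  shows "set (chart_cover A) \<subseteq> A" "(\<Union>c\<in>set (chart_cover A). cdom c) = UNIV"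
proof -
  have "\<exists>T\<subseteq>A. finite T \<and> UNIV \<subseteq> (\<Union>c\<in>T. cdom c)"
  proof (rule compactE_image[OF assms(2), of A cdom])
    show "open (cdom c)" if "c \<in> A" for c using atlas_open[OF A that] .
    show "UNIV \<subseteq> (\<Union>c\<in>A. cdom c)" using atlas_cover[OF A] by blast
  qed blast
  then obtain cs where "set cs \<subseteq> A \<and> (\<Union>c\<in>set cs. cdom c) = UNIV"
    using finite_list by (metis top.extremum_uniqueI)
  then have "set (chart_cover A) \<subseteq> A \<and> (\<Union>c\<in>set (chart_cover A). cdom c) = UNIV"
    unfolding chart_cover_def by (rule someI)
  then show "set (chart_cover A) \<subseteq> A" "(\<Union>c\<in>set (chart_cover A). cdom c) = UNIV" by auto
qed

text \<open>The pieces \<open>E i\<close> of the chart cover and the preimages of the pieces \<open>S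
  j\<close> have the common refinement \<open>R i j\<close>. Integrability on \<open>R i
  j\<close> is obtained on the side of \<open>S j\<close>, where the density is bounded, and
  carried over by the change of variables. With \<open>\<phi> = id\<close> this shows that the
  integral does not depend on the cover.\<close>

lemma density_integral_pullback:
  fixes A :: "('m::topological_space, 'k::finite) chart set"
  assumes A: "smooth_atlas A" and M: "compact (UNIV :: 'm set)" and \<phi>: "\<phi> \<in> diffeos A"
    and pb: "pullback_dens A \<phi> \<mu> \<nu>" and cont: "cont_dens A \<mu>" "cont_dens A \<nu>"
    and S: "compact_pieces A n d S" and out: "\<And>x c. x \<notin> (\<Union>j<n. S j) \<Longrightarrow> \<mu> x c = 0"
  shows "density_integral A \<nu> = (\<Sum>j<n. LINT y:cmap (d j) ` S j|lborel. \<mu> (cinv (d j) y) (d j))"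
proof -
  define cs where "cs = chart_cover A"
  note cs = chart_cover_props[OF A M, folded cs_def]
  define E where "E = (\<lambda>i. cdom (cs ! i) - (\<Union>j<i. cdom (cs ! j)))"
  define R where "R = (\<lambda>i j. E i \<inter> \<phi> -` S j)"
  have csA: "cs ! i \<in> A" if "i < length cs" for i using cs(1) that by auto
  have Eb: "E i \<in> sets borel" if "i < length cs" for i
  proof -
    have "cdom (cs ! k) \<in> sets borel" if "k < length cs" for k
      using csA[OF that] by (intro borel_open atlas_open[OF A])
    then show ?thesis using that unfolding E_def by (intro sets.Diff sets.finite_UN) auto
  qed
  have Ed: "disjoint_family_on E I" for I
    unfolding disjoint_family_on_def E_def by (intro ballI impI, rule disjoint_remainders)
  have Eu: "(\<Union>i<length cs. E i) = UNIV"
  proof -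
    have "x \<in> (\<Union>i<length cs. E i)" for x
    proof -
      have "\<exists>i. i < length cs \<and> x \<in> cdom (cs ! i)"
      proof -
        have "x \<in> (\<Union>c\<in>set cs. cdom c)" unfolding cs(2) by (rule UNIV_I)
        then show ?thesis unfolding UN_iff Bex_def in_set_conv_nth by blast
      qed
      then have "\<exists>i. (i < length cs \<and> x \<in> cdom (cs ! i)) \<and> (\<forall>k<i. \<not> (k < length cs \<and> x \<in> cdom (cs ! k)))"
        by (rule exists_least_iff[THEN iffD1])
      then obtain i where "i < length cs" "x \<in> cdom (cs ! i)" "\<And>k. k < i \<Longrightarrow> x \<notin> cdom (cs ! k)"
        using less_trans by blast
      then show ?thesis by (auto simp: E_def)
    qed
    then show ?thesis by auto
  qed
  have dA: "d j \<in> A" and Sb: "S j \<in> sets borel" and SK: "\<exists>K. compact K \<and> S j \<subseteq> K \<and> K \<subseteq> cdom (d j)" if "j < n" for j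
    using S that by (auto simp: compact_pieces_def)
  have Sd: "S j \<subseteq> cdom (d j)" if "j < n" for j using SK[OF that] by blast
  have Sdisj: "disjoint_family_on S {..<n}" using S by (simp add: compact_pieces_def)
  have Rb: "R i j \<in> sets borel" if "i < length cs" "j < n" for i j
  proof -
    have "\<phi> \<in> borel_measurable borel" by (rule borel_measurable_continuous_onI[OF diffeosD(4)[OF \<phi>]])
    then have "\<phi> -` S j \<in> sets borel" by (rule measurable_sets_borel) (rule Sb[OF that(2)])
    then show ?thesis using Eb that by (auto simp: R_def)
  qed
  have RE: "R i j \<subseteq> cdom (cs ! i)" "\<phi> ` R i j \<subseteq> S j" for i j by (auto simp: R_def E_def)
  have sub: "\<phi> ` R i j \<in> sets borel" if "i < length cs" "j < n" for i j
  proof -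
    have "\<phi> ` R i j = inv \<phi> -` R i j" using diffeosD(1)[OF \<phi>] by (simp add: bij_vimage_eq_inv_image bij_imp_bij_inv inv_inv_eq)
    moreover have "inv \<phi> \<in> borel_measurable borel"
      using diffeosD(5)[OF \<phi>] by (rule borel_measurable_continuous_onI)
    ultimately show ?thesis using measurable_sets_borel[OF _ Rb[OF that]] by metis
  qed
  have intS: "set_integrable lborel (cmap (d j) ` \<phi> ` R i j) (\<lambda>y. \<mu> (cinv (d j) y) (d j))"
    if "i < length cs" "j < n" for i j
  proof -
    obtain K where K: "compact K" "S j \<subseteq> K" "K \<subseteq> cdom (d j)" using SK[OF \<open>j < n\<close>] by blast
    then show ?thesis
      using RE(2)[of i j] cont(1) dA[OF that(2)] cont_dens_integrable[OF A dA[OF that(2)] _ K(1,3) sub[OF that], of \<mu>]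
      by (auto simp: cont_dens_def)
  qed
  have same: "same_int (cmap (cs ! i) ` R i j) (\<lambda>y. \<nu> (cinv (cs ! i) y) (cs ! i))
       (cmap (d j) ` \<phi> ` R i j) (\<lambda>y. \<mu> (cinv (d j) y) (d j))" if "i < length cs" "j < n" for i j
    using RE Sd[OF that(2)] by (intro piece_pullback[OF A csA[OF that(1)] dA[OF that(2)] \<phi> pb cont Rb[OF that]]) blast+
  have 1: "(LINT y:cmap (cs ! i) ` E i|lborel. \<nu> (cinv (cs ! i) y) (cs ! i)) =
      (\<Sum>j<n. LINT y:cmap (cs ! i) ` R i j|lborel. \<nu> (cinv (cs ! i) y) (cs ! i))" if i: "i < length cs" for i
  proof -
    let ?F = "\<lambda>y. \<nu> (cinv (cs ! i) y) (cs ! i)"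
    have inj: "inj_on (cmap (cs ! i)) (cdom (cs ! i))"
      using cinv_cmap[OF A csA[OF i]] by (metis inj_onI)
    have "indicat_real (cmap (cs ! i) ` E i) y *\<^sub>R ?F y = indicat_real (\<Union>j<n. cmap (cs ! i) ` R i j) y *\<^sub>R ?F y" for y
    proof (cases "y \<in> cmap (cs ! i) ` E i \<and> y \<notin> (\<Union>j<n. cmap (cs ! i) ` R i j)")
      case True
      then obtain x where x: "x \<in> E i" "y = cmap (cs ! i) x" by auto
      then have xc: "x \<in> cdom (cs ! i)" by (auto simp: E_def)
      have "x \<notin> R i j" if "j < n" for j using True x that by auto
      then have "\<phi> x \<notin> (\<Union>j<n. S j)" using x by (auto simp: R_def)
      moreover obtain c' where "c' \<in> A" "\<phi> x \<in> cdom c'" using atlas_cover[OF A] by blast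
      ultimately have "\<nu> x (cs ! i) = 0"
        using pb csA[OF i] xc out by (auto simp: pullback_dens_def)
      then show ?thesis using x by (simp add: cinv_cmap[OF A csA[OF i] xc])
    next
      case False
      moreover have "(\<Union>j<n. cmap (cs ! i) ` R i j) \<subseteq> cmap (cs ! i) ` E i" by (auto simp: R_def)
      ultimately have "y \<in> cmap (cs ! i) ` E i \<longleftrightarrow> y \<in> (\<Union>j<n. cmap (cs ! i) ` R i j)" by blast
      then show ?thesis by (simp add: indicator_def)
    qed
    then have "(LINT y:cmap (cs ! i) ` E i|lborel. ?F y) = (LINT y:(\<Union>j<n. cmap (cs ! i) ` R i j)|lborel. ?F y)"
      by (simp only: set_lebesgue_integral_def)
    also have "\<dots> = (\<Sum>j<n. LINT y:cmap (cs ! i) ` R i j|lborel. ?F y)"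
    proof (rule LINT_finite_Union)
      show "disjoint_family_on (\<lambda>j. cmap (cs ! i) ` R i j) {..<n}"
      proof (unfold disjoint_family_on_def, intro ballI impI)
        fix j k assume "j \<in> {..<n}" "k \<in> {..<n}" "j \<noteq> k"
        then have "R i j \<inter> R i k = {}" using Sdisj by (auto simp: R_def disjoint_family_on_def)
        then show "cmap (cs ! i) ` R i j \<inter> cmap (cs ! i) ` R i k = {}"
          using inj_on_image_Int[OF inj RE(1)[of i j] RE(1)[of i k]] by simp
      qed
      show "set_integrable lborel (cmap (cs ! i) ` R i j) ?F" if "j \<in> {..<n}" for j
        using same[OF i, of j] intS[OF i, of j] that by (simp add: same_int_def)
    qed simp
    finally show ?thesis .
  qed
  have 2: "(\<Sum>i<length cs. LINT y:cmap (d j) ` \<phi> ` R i j|lborel. \<mu> (cinv (d j) y) (d j)) =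
     (LINT y:cmap (d j) ` S j|lborel. \<mu> (cinv (d j) y) (d j))" if j: "j < n" for j
  proof -
    have inj: "inj_on (cmap (d j)) (cdom (d j))" using cinv_cmap[OF A dA[OF j]] by (metis inj_onI)
    have "S j = (\<Union>i<length cs. \<phi> ` R i j)"
    proof -
      have "s \<in> (\<Union>i<length cs. \<phi> ` R i j)" if "s \<in> S j" for s
      proof -
        obtain x where x: "\<phi> x = s" using diffeosD(1)[OF \<phi>] by (metis bij_pointE)
        obtain i where "i < length cs" "x \<in> E i" using Eu by blast
        then show ?thesis using x that by (auto simp: R_def)
      qed
      then show ?thesis using RE(2) by blast
    qed
    then have U: "cmap (d j) ` S j = (\<Union>i<length cs. cmap (d j) ` \<phi> ` R i j)" by (metis image_UN)
    show ?thesis unfolding U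
    proof (rule LINT_finite_Union[symmetric])
      show "disjoint_family_on (\<lambda>i. cmap (d j) ` \<phi> ` R i j) {..<length cs}"
      proof (unfold disjoint_family_on_def, intro ballI impI)
        fix i k assume "i \<in> {..<length cs}" "k \<in> {..<length cs}" "i \<noteq> k"
        then have "R i j \<inter> R k j = {}" using Ed[of UNIV] by (auto simp: R_def disjoint_family_on_def)
        then have "\<phi> ` R i j \<inter> \<phi> ` R k j = {}"
          using diffeosD(1)[OF \<phi>] by (simp add: bij_def image_Int[symmetric])
        moreover have "\<phi> ` R i j \<subseteq> cdom (d j)" "\<phi> ` R k j \<subseteq> cdom (d j)"
          using RE(2) Sd[OF j] by blast+
        ultimately show "cmap (d j) ` \<phi> ` R i j \<inter> cmap (d j) ` \<phi> ` R k j = {}"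
          using inj_on_image_Int[OF inj] by (metis image_empty)
      qed
    qed (use intS j in auto)
  qed
  have "density_integral A \<nu> = (\<Sum>i<length cs. LINT y:cmap (cs ! i) ` E i|lborel. \<nu> (cinv (cs ! i) y) (cs ! i))"
    by (simp add: density_integral_def cs_def[symmetric] Let_def E_def)
  also have "\<dots> = (\<Sum>i<length cs. \<Sum>j<n. LINT y:cmap (cs ! i) ` R i j|lborel. \<nu> (cinv (cs ! i) y) (cs ! i))"
    using 1 by simp
  also have "\<dots> = (\<Sum>i<length cs. \<Sum>j<n. LINT y:cmap (d j) ` \<phi> ` R i j|lborel. \<mu> (cinv (d j) y) (d j))"
    using same by (intro sum.cong refl) (auto simp: same_int_def)
  also have "\<dots> = (\<Sum>j<n. \<Sum>i<length cs. LINT y:cmap (d j) ` \<phi> ` R i j|lborel. \<mu> (cinv (d j) y) (d j))"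
    by (rule sum.swap)
  also have "\<dots> = (\<Sum>j<n. LINT y:cmap (d j) ` S j|lborel. \<mu> (cinv (d j) y) (d j))"
    using 2 by simp
  finally show ?thesis .
qed

text \<open>Finitely many closed coordinate balls cover the manifold; they are made disjoint one after the
  other.\<close>

lemma compact_pieces_exist:
  fixes A :: "('m::t2_space, 'k::finite) chart set"
  assumes A: "smooth_atlas A" and M: "compact (UNIV :: 'm set)"
  obtains n d S where "compact_pieces A n d S" "(\<Union>j<n. S j) = UNIV"
proof -
  have "\<exists>c K U. c \<in> A \<and> compact K \<and> K \<subseteq> cdom c \<and> open U \<and> x \<in> U \<and> U \<subseteq> K" for x
  proof -
    obtain c where c: "c \<in> A" "x \<in> cdom c" using atlas_cover[OF A] by blast
    then have "cmap c x \<in> cimg c" by auto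
    then obtain r where r: "r > 0" "cball (cmap c x) r \<subseteq> cimg c"
      using atlas_open_img[OF A c(1)] open_contains_cball by blast
    let ?K = "cinv c ` cball (cmap c x) r" and ?U = "cdom c \<inter> cmap c -` ball (cmap c x) r"
    have "compact ?K"
      by (rule compact_continuous_image[OF continuous_on_subset[OF cont_cinv[OF A c(1)] r(2)] compact_cball])
    moreover have "?K \<subseteq> cdom c" by (rule image_subsetI, rule cinv_in, rule subsetD[OF r(2)])
    moreover have "open ?U"
      by (intro continuous_open_preimage cont_cmap[OF A c(1)] atlas_open[OF A c(1)]) auto
    moreover have "?U \<subseteq> ?K"
    proof
      fix z assume "z \<in> ?U"
      then show "z \<in> ?K" using cinv_cmap[OF A c(1), of z] by (intro image_eqI[of _ _ "cmap c z"]) auto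
    qed
    ultimately show ?thesis using c r(1) by (intro exI[of _ c] exI[of _ ?K] exI[of _ ?U]) auto
  qed
  then have "\<forall>x. \<exists>t. fst t \<in> A \<and> compact (fst (snd t)) \<and> fst (snd t) \<subseteq> cdom (fst t) \<and>
      open (snd (snd t)) \<and> x \<in> snd (snd t) \<and> snd (snd t) \<subseteq> fst (snd t)"
    unfolding split_paired_Ex fst_conv snd_conv by simp
  then obtain t where t: "\<And>x. fst (t x) \<in> A \<and> compact (fst (snd (t x))) \<and> fst (snd (t x)) \<subseteq> cdom (fst (t x)) \<and>
      open (snd (snd (t x))) \<and> x \<in> snd (snd (t x)) \<and> snd (snd (t x)) \<subseteq> fst (snd (t x))"
    unfolding choice_iff by blast
  define C K U where CKU_def: "C = fst \<circ> t" "K = fst \<circ> snd \<circ> t" "U = snd \<circ> snd \<circ> t"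
  have CKU: "C x \<in> A \<and> compact (K x) \<and> K x \<subseteq> cdom (C x) \<and> open (U x) \<and> x \<in> U x \<and> U x \<subseteq> K x" for x
    using t[of x] by (simp add: CKU_def)
  have "\<exists>T\<subseteq>UNIV. finite T \<and> UNIV \<subseteq> (\<Union>x\<in>T. U x)"
    by (rule compactE_image[OF M, of UNIV U]) (use CKU in blast)+
  then obtain T where T: "finite T" "UNIV \<subseteq> (\<Union>x\<in>T. U x)" by blast
  obtain xs where xs: "set xs = T" using finite_list[OF T(1)] by blast
  define S where "S = (\<lambda>j. K (xs ! j) - (\<Union>i<j. K (xs ! i)))"
  have "compact_pieces A (length xs) (\<lambda>j. C (xs ! j)) S"
    unfolding compact_pieces_def
  proof (intro conjI allI impI)
    show "disjoint_family_on S {..<length xs}"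
      unfolding disjoint_family_on_def S_def by (intro ballI impI, rule disjoint_remainders)
    fix j assume "j < length xs"
    show "S j \<in> sets borel"
      unfolding S_def using borel_compact[of "K (xs ! k)" for k] CKU by (intro sets.Diff sets.finite_UN) auto
    show "\<exists>Ka. compact Ka \<and> S j \<subseteq> Ka \<and> Ka \<subseteq> cdom (C (xs ! j))"
      using CKU by (intro exI[of _ "K (xs ! j)"]) (auto simp: S_def)
  qed (use CKU in auto)
  moreover have "(\<Union>j<length xs. S j) = UNIV"
  proof -
    have "x \<in> (\<Union>j<length xs. S j)" for x
    proof -
      have "\<exists>i. i < length xs \<and> x \<in> K (xs ! i)"
        using T(2) xs CKU by (metis UNIV_I UN_E in_set_conv_nth subset_iff)
      then have "\<exists>i. (i < length xs \<and> x \<in> K (xs ! i)) \<and> (\<forall>k<i. \<not> (k < length xs \<and> x \<in> K (xs ! k)))"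
        by (rule exists_least_iff[THEN iffD1])
      then obtain i where "i < length xs" "x \<in> K (xs ! i)" "\<And>k. k < i \<Longrightarrow> x \<notin> K (xs ! k)"
        using less_trans by blast
      then show ?thesis by (auto simp: S_def)
    qed
    then show ?thesis by auto
  qed
  ultimately show ?thesis by (rule that)
qed

lemma continuous_on_slice:
  assumes "continuous_on (U \<times> C) (\<lambda>(p, y). F p y)" "p \<in> U"
  shows "continuous_on C (F p)"
proof -
  have "continuous_on C (\<lambda>y. (p, y))" by (intro continuous_on_Pair continuous_on_const continuous_on_id)
  then have "continuous_on C (\<lambda>y. (\<lambda>(p, y). F p y) (p, y))"
    by (rule continuous_on_compose2[OF assms(1)]) (use assms(2) in auto)
  then show ?thesis by simp
qed

text \<open>On the compact image of \<open>K\<close> the integrands converge uniformly.\<close>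

lemma LINT_param_continuous:
  fixes A :: "('m::topological_space, 'k::finite) chart set" and \<mu> :: "'p::topological_space \<Rightarrow> 'm \<Rightarrow> ('m, 'k) dens"
  assumes A: "smooth_atlas A" and c: "c \<in> A"
    and \<mu>: "continuous_on (U \<times> cimg c) (\<lambda>(p, y). \<mu> p (cinv c y) c)"
    and K: "compact K" "K \<subseteq> cdom c" and S: "S \<in> sets borel" "S \<subseteq> K"
  shows "continuous_on U (\<lambda>p. LINT y:cmap c ` S|lborel. \<mu> p (cinv c y) c)"
  unfolding continuous_on_def
proof (intro ballI tendstoI)
  fix p0 and e :: real assume p0: "p0 \<in> U" and e: "e > 0"
  let ?C = "cmap c ` K" and ?S = "cmap c ` S"
  have C: "compact ?C" "?C \<subseteq> cimg c"
    using K continuous_on_subset[OF cont_cmap[OF A c]] by (auto intro!: compact_continuous_image)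
  have Sm: "?S \<in> sets lborel" using chart_borel[OF A c S(1)] S K by auto
  have cs: "continuous_on (cimg c) (\<lambda>y. \<mu> p (cinv c y) c)" if "p \<in> U" for p
    by (rule continuous_on_slice[OF \<mu> that])
  have int: "set_integrable lborel ?S (\<lambda>y. \<mu> p (cinv c y) c)" if "p \<in> U" for p
    by (rule cont_dens_integrable[where \<mu>="\<mu> p", OF A c cs[OF that] K S])
  have int1: "set_integrable lborel ?S (\<lambda>y. e :: real)" for e
    using cont_dens_integrable[OF A c _ K S, of "\<lambda>_ _. e"] by simp
  define L where "L = (LINT y:?S|lborel. (1::real))"
  have L: "L \<ge> 0" unfolding L_def set_lebesgue_integral_def by (intro Bochner_Integration.integral_nonneg) auto
  define e' where "e' = e / (L + 1)"
  have e': "e' > 0" "e' * L < e" using e L by (auto simp: e'_def field_simps)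
  have "continuous_on (U \<times> ?C) (\<lambda>(p, y). \<mu> p (cinv c y) c)"
    by (rule continuous_on_subset[OF \<mu>]) (use C in auto)
  from continuous_on_prod_compactE[OF this C(1) p0 e'(1)]
  obtain X0 where X0: "p0 \<in> X0" "open X0"
    "\<forall>p\<in>X0 \<inter> U. \<forall>y\<in>?C. dist ((\<lambda>(p, y). \<mu> p (cinv c y) c) (p, y)) ((\<lambda>(p, y). \<mu> p (cinv c y) c) (p0, y)) \<le> e'" .
  have "dist (LINT y:?S|lborel. \<mu> p (cinv c y) c) (LINT y:?S|lborel. \<mu> p0 (cinv c y) c) < e"
    if p: "p \<in> X0 \<inter> U" for p
  proof -
    have d: "set_integrable lborel ?S (\<lambda>y. \<mu> p (cinv c y) c - \<mu> p0 (cinv c y) c)"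
      using int p p0 by (intro set_integral_diff) auto
    have "dist (LINT y:?S|lborel. \<mu> p (cinv c y) c) (LINT y:?S|lborel. \<mu> p0 (cinv c y) c)
      = norm (LINT y:?S|lborel. \<mu> p (cinv c y) c - \<mu> p0 (cinv c y) c)"
      using int p p0 by (subst set_integral_diff(2)) (auto simp: dist_norm)
    also have "\<dots> \<le> (LINT y:?S|lborel. norm (\<mu> p (cinv c y) c - \<mu> p0 (cinv c y) c))"
      by (rule set_integral_norm_bound[OF d])
    also have "\<dots> \<le> (LINT y:?S|lborel. e')"
      using X0(3) p S by (intro set_integral_mono set_integrable_norm[OF d] int1) (auto simp: dist_norm)
    also have "\<dots> = e' * L"
      using set_integral_mult_right[of lborel ?S e' "\<lambda>_. 1"] by (simp add: L_def)
    finally show ?thesis using e' by linarith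
  qed
  then show "\<forall>\<^sub>F p in at p0 within U. dist (LINT y:?S|lborel. \<mu> p (cinv c y) c) (LINT y:?S|lborel. \<mu> p0 (cinv c y) c) < e"
    using X0(1,2) by (auto simp: eventually_at_topological)
qed

lemma density_integral_pieces:
  fixes A :: "('m::topological_space, 'k::finite) chart set"
  assumes "smooth_atlas A" "compact (UNIV :: 'm set)" "pullback_dens A id \<mu> \<mu>" "cont_dens A \<mu>"
    "compact_pieces A n d S" "(\<Union>j<n. S j) = UNIV"
  shows "density_integral A \<mu> = (\<Sum>j<n. LINT y:cmap (d j) ` S j|lborel. \<mu> (cinv (d j) y) (d j))"
  using assms by (intro density_integral_pullback[OF _ _ id_diffeo]) auto

lemma density_integral_diffeo:
  fixes A :: "('m::t2_space, 'k::finite) chart set"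
  assumes "smooth_atlas A" "compact (UNIV :: 'm set)" "\<phi> \<in> diffeos A"
    "pullback_dens A id \<mu> \<mu>" "pullback_dens A \<phi> \<mu> \<nu>" "cont_dens A \<mu>" "cont_dens A \<nu>"
  shows "density_integral A \<nu> = density_integral A \<mu>"
proof -
  obtain n d S where "compact_pieces A n d S" "(\<Union>j<n. S j) = UNIV"
    using compact_pieces_exist[OF assms(1,2)] by blast
  then show ?thesis
    using density_integral_pullback[OF assms(1,2,3,5,6,7), of n d S]
      density_integral_pieces[OF assms(1,2,4,6), of n d S] by simp
qed

lemma density_integral_chart:
  fixes A :: "('m::t2_space, 'k::finite) chart set"
  assumes "smooth_atlas A" "compact (UNIV :: 'm set)" "pullback_dens A id \<mu> \<mu>" "cont_dens A \<mu>"
    and "c \<in> A" "compact K" "K \<subseteq> cdom c" "\<And>x c. x \<notin> K \<Longrightarrow> \<mu> x c = 0"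
  shows "density_integral A \<mu> = (LINT y:cmap c ` K|lborel. \<mu> (cinv c y) c)"
proof -
  have "compact_pieces A 1 (\<lambda>_. c) (\<lambda>_. K)"
    using assms(5-7) by (auto simp: compact_pieces_def disjoint_family_on_def borel_compact)
  then show ?thesis
    using density_integral_pullback[OF assms(1,2) id_diffeo[OF assms(1)] assms(3,4,4), of 1 "\<lambda>_. c" "\<lambda>_. K"] assms(8)
    by (auto simp: lessThan_Suc)
qed

lemma density_integral_lincomb:
  fixes A :: "('m::t2_space, 'k::finite) chart set"
  assumes A: "smooth_atlas A" and M: "compact (UNIV :: 'm set)"
    and \<mu>: "pullback_dens A id \<mu> \<mu>" "cont_dens A \<mu>" and \<nu>: "pullback_dens A id \<nu> \<nu>" "cont_dens A \<nu>"
  shows "density_integral A (\<lambda>x c. a * \<mu> x c + b * \<nu> x c) = a * density_integral A \<mu> + b * density_integral A \<nu>"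
proof -
  obtain n d S where S: "compact_pieces A n d S" "(\<Union>j<n. S j) = UNIV"
    using compact_pieces_exist[OF A M] by blast
  have s: "pullback_dens A id (\<lambda>x c. a * \<mu> x c + b * \<nu> x c) (\<lambda>x c. a * \<mu> x c + b * \<nu> x c)"
    unfolding pullback_dens_def
  proof (intro allI ballI impI)
    fix x c c' assume *: "c \<in> A" "c' \<in> A" "x \<in> cdom c" "id x \<in> cdom c'"
    have "\<mu> x c = \<bar>det (matrix (tdiff c c' id x))\<bar> * \<mu> (id x) c'"
      "\<nu> x c = \<bar>det (matrix (tdiff c c' id x))\<bar> * \<nu> (id x) c'"
      using \<mu>(1) \<nu>(1) * unfolding pullback_dens_def by blast+
    then show "a * \<mu> x c + b * \<nu> x c = \<bar>det (matrix (tdiff c c' id x))\<bar> * (a * \<mu> (id x) c' + b * \<nu> (id x) c')"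
      by (simp only: algebra_simps)
  qed
  have c: "cont_dens A (\<lambda>x c. a * \<mu> x c + b * \<nu> x c)"
    using \<mu>(2) \<nu>(2) unfolding cont_dens_def by (intro ballI continuous_intros) auto
  have int: "set_integrable lborel (cmap (d j) ` S j) (\<lambda>y. \<mu> (cinv (d j) y) (d j))" if "j < n" "cont_dens A \<mu>" for \<mu> j
    using S(1) that cont_dens_integrable[OF A, of "d j" \<mu> _ "S j"] unfolding compact_pieces_def cont_dens_def by blast
  have "(LINT y:cmap (d j) ` S j|lborel. a * \<mu> (cinv (d j) y) (d j) + b * \<nu> (cinv (d j) y) (d j)) =
      a * (LINT y:cmap (d j) ` S j|lborel. \<mu> (cinv (d j) y) (d j)) + b * (LINT y:cmap (d j) ` S j|lborel. \<nu> (cinv (d j) y) (d j))"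
    if "j < n" for j
    using int[OF that \<mu>(2)] int[OF that \<nu>(2)] by (subst set_integral_add(2)) auto
  then have "density_integral A (\<lambda>x c. a * \<mu> x c + b * \<nu> x c) =
     (\<Sum>j<n. a * (LINT y:cmap (d j) ` S j|lborel. \<mu> (cinv (d j) y) (d j)) + b * (LINT y:cmap (d j) ` S j|lborel. \<nu> (cinv (d j) y) (d j)))"
    unfolding density_integral_pieces[OF A M s c S] by (intro sum.cong) auto
  then show ?thesis
    by (simp only: sum.distrib sum_distrib_left density_integral_pieces[OF A M \<mu> S] density_integral_pieces[OF A M \<nu> S])
qed

lemma density_integral_continuous:
  fixes A :: "('m::t2_space, 'k::finite) chart set" and \<mu> :: "'p::topological_space \<Rightarrow> 'm \<Rightarrow> ('m, 'k) dens"
  assumes A: "smooth_atlas A" and M: "compact (UNIV :: 'm set)"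
    and \<mu>: "\<And>p. p \<in> U \<Longrightarrow> pullback_dens A id (\<mu> p) (\<mu> p)"
      "\<And>c. c \<in> A \<Longrightarrow> continuous_on (U \<times> cimg c) (\<lambda>(p, y). \<mu> p (cinv c y) c)"
  shows "continuous_on U (\<lambda>p. density_integral A (\<mu> p))"
proof -
  obtain n d S where S: "compact_pieces A n d S" "(\<Union>j<n. S j) = UNIV"
    using compact_pieces_exist[OF A M] by blast
  have c: "cont_dens A (\<mu> p)" if "p \<in> U" for p
    unfolding cont_dens_def
    using continuous_on_slice[OF \<mu>(2) that] by blast
  have "continuous_on U (\<lambda>p. \<Sum>j<n. LINT y:cmap (d j) ` S j|lborel. \<mu> p (cinv (d j) y) (d j))"
  proof (rule continuous_on_sum)
    fix j assume "j \<in> {..<n}"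
    then obtain K where "d j \<in> A" "S j \<in> sets borel" "compact K" "S j \<subseteq> K" "K \<subseteq> cdom (d j)"
      using S(1) by (auto simp: compact_pieces_def)
    then show "continuous_on U (\<lambda>p. LINT y:cmap (d j) ` S j|lborel. \<mu> p (cinv (d j) y) (d j))"
      by (intro LINT_param_continuous[OF A _ \<mu>(2)]) auto
  qed
  then show ?thesis
    by (rule continuous_on_eq) (simp add: density_integral_pieces[OF A M \<mu>(1) c S])
qed

section \<open>The metric and the H0 product\<close>

lemma
  assumes "riemannian_metric B gb" "u \<in> tangent_space B q" "v \<in> tangent_space B q"
  shows gb_sym: "gb q u v = gb q v u"
    and gb_lincomb: "w \<in> tangent_space B q \<Longrightarrow> gb q (lincomb a u b v) w = a * gb q u w + b * gb q v w"
    and gb_pos: "u \<noteq> (\<lambda>_. 0) \<Longrightarrow> gb q u u > 0"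
  using assms unfolding riemannian_metric_def by blast+

lemma gb_lincomb_right:
  assumes "riemannian_metric B gb" "smooth_atlas B" "u \<in> tangent_space B q" "v \<in> tangent_space B q" "w \<in> tangent_space B q"
  shows "gb q w (lincomb a u b v) = a * gb q w u + b * gb q w v"
  using gb_sym[OF assms(1,5) lincomb_in[OF assms(2-4)]] gb_lincomb[OF assms(1,3,4,5)]
    gb_sym[OF assms(1,5,3)] gb_sym[OF assms(1,5,4)] by simp

lemma gb_coord:
  assumes "smooth_atlas B" "u \<in> tangent_space B q" "v \<in> tangent_space B q" "d \<in> B" "q \<in> cdom d"
  shows "gb q u v = metric_coord B gb d (cmap d q) (u d) (v d)"
  using tangent_eq_coord_vec[OF assms(1,2,4,5)] tangent_eq_coord_vec[OF assms(1,3,4,5)] cinv_cmap[OF assms(1,4,5)]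
  by (simp add: metric_coord_def)

lemma metric_coord_linear:
  assumes g: "riemannian_metric B gb" and B: "smooth_atlas B" and d: "d \<in> B" and y: "y \<in> cimg d"
  shows "bounded_linear (\<lambda>a. metric_coord B gb d y a b)" "bounded_linear (metric_coord B gb d y a)"
proof -
  note cv = coord_vec_in[OF B d cinv_in[OF y]]
  note cl = coord_vec_lincomb[OF B d cinv_in[OF y]]
  have 1: "metric_coord B gb d y (s *\<^sub>R a + t *\<^sub>R a') b = s * metric_coord B gb d y a b + t * metric_coord B gb d y a' b" for s t a a' b
    unfolding metric_coord_def cl by (rule gb_lincomb[OF g cv cv cv])
  have 2: "metric_coord B gb d y b (s *\<^sub>R a + t *\<^sub>R a') = s * metric_coord B gb d y b a + t * metric_coord B gb d y b a'" for s t a a' b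
    unfolding metric_coord_def cl by (rule gb_lincomb_right[OF g B cv cv cv])
  show "bounded_linear (\<lambda>a. metric_coord B gb d y a b)"
    using 1[of 1 _ 1 _ b] 1[of _ _ 0 _ b] by (intro linear_conv_bounded_linear[THEN iffD1] linearI) auto
  show "bounded_linear (metric_coord B gb d y a)"
    using 2[of a 1 _ 1] 2[of a _ _ 0] by (intro linear_conv_bounded_linear[THEN iffD1] linearI) auto
qed

text \<open>Sections along a map whose source is the product of a parameter space and a chart image: this is
  how joint continuity in parameters and in points of \<open>M\<close> is expressed.\<close>

definition cont_along :: "('n::topological_space, 'l::finite) chart set \<Rightarrow> 'q::topological_space set \<Rightarrow> ('q \<Rightarrow> 'n)
    \<Rightarrow> ('q \<Rightarrow> ('n, 'l) tvec) \<Rightarrow> bool" where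
  "cont_along B S F h \<longleftrightarrow> continuous_on S F \<and> (\<forall>q\<in>S. h q \<in> tangent_space B (F q)) \<and>
     (\<forall>d\<in>B. continuous_on {q \<in> S. F q \<in> cdom d} (\<lambda>q. h q d))"

text \<open>In a chart around \<open>F q\<close> the product is a bilinear expression in the coordinates
  with continuous coefficients.\<close>

lemma gb_continuous:
  fixes S :: "'q::euclidean_space set"
  assumes g: "riemannian_metric B gb" and B: "smooth_atlas B" and S: "open S"
    and h: "cont_along B S F h" and k: "cont_along B S F k"
  shows "continuous_on S (\<lambda>q. gb (F q) (h q) (k q))"
proof -
  have "Ck_on 0 S (\<lambda>q. gb (F q) (h q) (k q))"
  proof (rule Ck_on_local)
    fix q0 assume q0: "q0 \<in> S"
    obtain d where d: "d \<in> B" "F q0 \<in> cdom d" using atlas_cover[OF B] by blast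
    define T where "T = {q \<in> S. F q \<in> cdom d}"
    have "continuous_on S F" using h by (simp add: cont_along_def)
    then have "open (S \<inter> F -` cdom d)" by (intro continuous_open_preimage S atlas_open[OF B d(1)])
    moreover have "S \<inter> F -` cdom d = T" by (auto simp: T_def)
    ultimately have T: "open T" by simp
    have cF: "continuous_on T F" using h by (auto simp: cont_along_def T_def intro: continuous_on_subset)
    have hk: "continuous_on T (\<lambda>q. h q d)" "continuous_on T (\<lambda>q. k q d)"
      using h k d by (auto simp: cont_along_def T_def)
    have y: "cmap d (F q) \<in> cimg d" if "q \<in> T" for q using that by (auto simp: T_def)
    have m: "continuous_on T (\<lambda>q. metric_coord B gb d (cmap d (F q)) a b)" for a b
    proof -
      have "smooth_on (cimg d) (\<lambda>y. metric_coord B gb d y a b)"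
        using g d(1) unfolding riemannian_metric_def by blast
      then have "continuous_on (cimg d) (\<lambda>y. metric_coord B gb d y a b)" by (rule smooth_on_imp_continuous)
      moreover have "continuous_on T (\<lambda>q. cmap d (F q))"
        by (rule continuous_on_compose2[OF cont_cmap[OF B d(1)] cF]) (auto simp: T_def)
      ultimately show ?thesis by (rule continuous_on_compose2) (use y in blast)
    qed
    have 1: "continuous_on T (\<lambda>q. metric_coord B gb d (cmap d (F q)) (h q d) b)" for b
      by (rule continuous_on_linear_dir[OF metric_coord_linear(1)[OF g B d(1) y] m hk(1)])
    have "continuous_on T (\<lambda>q. metric_coord B gb d (cmap d (F q)) (h q d) (k q d))"
      by (rule continuous_on_linear_dir[where L="\<lambda>q. metric_coord B gb d (cmap d (F q)) (h q d)",
            OF metric_coord_linear(2)[OF g B d(1) y] 1 hk(2)])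
    then have "continuous_on T (\<lambda>q. gb (F q) (h q) (k q))"
      by (rule continuous_on_eq) (use h k d in \<open>auto simp: cont_along_def T_def intro!: gb_coord[OF B, symmetric]\<close>)
    then show "\<exists>T. open T \<and> q0 \<in> T \<and> Ck_on 0 T (\<lambda>q. gb (F q) (h q) (k q))"
      using T q0 d by (intro exI[of _ T]) (auto simp: T_def)
  qed
  then show ?thesis by simp
qed

lemma section_cont_along:
  fixes U :: "'p::euclidean_space set"
  assumes A: "smooth_atlas A" and F: "smooth_family A B U F" and h: "smooth_section_family A B U F h" and c: "c \<in> A"
  shows "cont_along B (U \<times> cimg c) (\<lambda>(p, y). F p (cinv c y)) (\<lambda>(p, y). h p (cinv c y))"
  unfolding cont_along_def
proof (intro conjI ballI)
  show "continuous_on (U \<times> cimg c) (\<lambda>(p, y). F p (cinv c y))"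
    by (rule family_cont_chart[OF A smooth_familyD(1)[OF F] c])
  show "(\<lambda>(p, y). h p (cinv c y)) q \<in> tangent_space B ((\<lambda>(p, y). F p (cinv c y)) q)" if "q \<in> U \<times> cimg c" for q
    using section_familyD(1)[OF h] that by (auto simp: case_prod_beta')
  fix d assume d: "d \<in> B"
  have "continuous_on (fset c d U F) (\<lambda>(p, y). h p (cinv c y) d)"
    by (rule smooth_on_imp_continuous[OF section_familyD(2)[OF h c d]])
  moreover have "{q \<in> U \<times> cimg c. (\<lambda>(p, y). F p (cinv c y)) q \<in> cdom d} = fset c d U F" by auto
  ultimately show "continuous_on {q \<in> U \<times> cimg c. (\<lambda>(p, y). F p (cinv c y)) q \<in> cdom d} (\<lambda>q. (\<lambda>(p, y). h p (cinv c y)) q d)"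
    by (simp add: case_prod_beta')
qed

lemma coord_cont_along:
  fixes U :: "'p::euclidean_space set"
  assumes A: "smooth_atlas A" and B: "smooth_atlas B" and F: "smooth_family A B U F" and c: "c \<in> A"
  shows "cont_along B (U \<times> cimg c) (\<lambda>(p, y). F p (cinv c y))
     (\<lambda>(p, y). tangent_map A B (F p) (cinv c y) (coord_vec A c (cinv c y) a))"
  unfolding cont_along_def
proof (intro conjI ballI)
  show "continuous_on (U \<times> cimg c) (\<lambda>(p, y). F p (cinv c y))"
    by (rule family_cont_chart[OF A smooth_familyD(1)[OF F] c])
  show "(\<lambda>(p, y). tangent_map A B (F p) (cinv c y) (coord_vec A c (cinv c y) a)) q \<in> tangent_space B ((\<lambda>(p, y). F p (cinv c y)) q)"
    if "q \<in> U \<times> cimg c" for q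
    using tangent_map_in[OF A B family_slice[OF A B F] coord_vec_in[OF A c cinv_in]] that by (auto simp: case_prod_beta')
  fix d assume d: "d \<in> B"
  have "continuous_on (fset c d U F) (\<lambda>z. frechet_derivative (frep c d F) (at z) (0, a))"
    by (rule smooth_on_imp_continuous[OF smooth_on_frechet[OF smooth_familyD(2)[OF F c d]]])
  then have "continuous_on (fset c d U F) (\<lambda>q. (\<lambda>(p, y). tangent_map A B (F p) (cinv c y) (coord_vec A c (cinv c y) a)) q d)"
  proof (rule continuous_on_eq)
    fix z assume z: "z \<in> fset c d U F"
    obtain p y where py: "z = (p, y)" by fastforce
    with z have *: "p \<in> U" "y \<in> cimg c" "F p (cinv c y) \<in> cdom d" by auto
    show "frechet_derivative (frep c d F) (at z) (0, a) =
       (\<lambda>(p, y). tangent_map A B (F p) (cinv c y) (coord_vec A c (cinv c y) a)) z d"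
      using tangent_map_at[OF A B family_slice[OF A B F *(1)] coord_vec_in[OF A c cinv_in[OF *(2)]] c d cinv_in[OF *(2)] *(3), of a]
        tdiff_frep[OF A B F c d cinv_in[OF *(2)] *(3,1), of a]
      by (simp add: py coord_vec_same[OF A c cinv_in[OF *(2)]] cmap_cinv[OF *(2)])
  qed
  moreover have "{q \<in> U \<times> cimg c. (\<lambda>(p, y). F p (cinv c y)) q \<in> cdom d} = fset c d U F" by auto
  ultimately show "continuous_on {q \<in> U \<times> cimg c. (\<lambda>(p, y). F p (cinv c y)) q \<in> cdom d}
     (\<lambda>q. (\<lambda>(p, y). tangent_map A B (F p) (cinv c y) (coord_vec A c (cinv c y) a)) q d)"
    by simp
qed

lemma vol_eq:
  assumes A: "smooth_atlas A" and c: "c \<in> A" "x \<in> cdom c"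
  shows "vol A (pullback_metric A B gb f) x c =
     sqrt (det (\<chi> i j. gb (f x) (tangent_map A B f x (coord_vec A c x (axis i 1)))
        (tangent_map A B f x (coord_vec A c x (axis j 1)))))"
  using c by (simp add: vol_def metric_coord_def pullback_metric_def cinv_cmap[OF A c])

lemma vol_continuous:
  fixes U :: "'p::euclidean_space set"
  assumes A: "smooth_atlas A" and B: "smooth_atlas B" and g: "riemannian_metric B gb"
    and F: "smooth_family A B U F" and U: "open U" and c: "c \<in> A"
  shows "continuous_on (U \<times> cimg c) (\<lambda>(p, y). vol A (pullback_metric A B gb (F p)) (cinv c y) c)"
proof -
  have o: "open (U \<times> cimg c)" by (intro open_Times U atlas_open_img[OF A c])
  let ?T = "\<lambda>i. \<lambda>(p, y). tangent_map A B (F p) (cinv c y) (coord_vec A c (cinv c y) (axis i 1))"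
  have m: "continuous_on (U \<times> cimg c) (\<lambda>q. gb ((\<lambda>(p, y). F p (cinv c y)) q) (?T i q) (?T j q))" for i j
    by (intro gb_continuous[OF g B o] coord_cont_along[OF A B F c])
  have "continuous_on (U \<times> cimg c) (\<lambda>q. sqrt (det (\<chi> i j. gb ((\<lambda>(p, y). F p (cinv c y)) q) (?T i q) (?T j q))))"
    unfolding det_def by (intro continuous_intros) (simp add: m)
  then show ?thesis
    by (rule continuous_on_eq) (auto simp: vol_eq[OF A c cinv_in])
qed

definition h0_dens :: "('m::topological_space, 'k::finite) chart set \<Rightarrow> ('n::topological_space, 'l::finite) chart set
    \<Rightarrow> ('n, 'l) metric \<Rightarrow> ('m \<Rightarrow> 'n) \<Rightarrow> ('m \<Rightarrow> ('n, 'l) tvec) \<Rightarrow> ('m \<Rightarrow> ('n, 'l) tvec) \<Rightarrow> 'm \<Rightarrow> ('m, 'k) dens" where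
  "h0_dens A B gb f h k = (\<lambda>x c. gb (f x) (h x) (k x) * vol A (pullback_metric A B gb f) x c)"

lemma H0_eq: "H0 A B gb f h k = density_integral A (h0_dens A B gb f h k)"
  by (simp add: H0_def h0_dens_def)

lemma h0_dens_continuous:
  fixes U :: "'p::euclidean_space set"
  assumes A: "smooth_atlas A" and B: "smooth_atlas B" and g: "riemannian_metric B gb"
    and F: "smooth_family A B U F" and U: "open U" and c: "c \<in> A"
    and h: "smooth_section_family A B U F h" and k: "smooth_section_family A B U F k"
  shows "continuous_on (U \<times> cimg c) (\<lambda>(p, y). h0_dens A B gb (F p) (h p) (k p) (cinv c y) c)"
proof -
  have o: "open (U \<times> cimg c)" by (intro open_Times U atlas_open_img[OF A c])
  have "continuous_on (U \<times> cimg c) (\<lambda>q. gb ((\<lambda>(p, y). F p (cinv c y)) q) ((\<lambda>(p, y). h p (cinv c y)) q) ((\<lambda>(p, y). k p (cinv c y)) q)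
     * (\<lambda>(p, y). vol A (pullback_metric A B gb (F p)) (cinv c y) c) q)"
    by (intro continuous_on_mult gb_continuous[OF g B o] section_cont_along[OF A F _ c] h k
        vol_continuous[OF A B g F U c])
  then show ?thesis by (simp add: h0_dens_def case_prod_beta')
qed

lemma section_const_family:
  assumes A: "smooth_atlas A" and B: "smooth_atlas B" and f: "smooth_map A B f" and h: "h \<in> sections_along A B f"
    and V: "open V"
  shows "smooth_section_family A B V (\<lambda>_::'q::euclidean_space. f) (\<lambda>_. h)"
  unfolding smooth_section_family_def
proof (intro conjI ballI allI)
  show "h x \<in> tangent_space B (f x)" for x using h by (simp add: sections_along_def)
  fix c d assume c: "c \<in> A" "d \<in> B"
  have o: "open (fset c d V (\<lambda>_. f))"
    by (rule fset_open[OF A B smooth_familyD(1)[OF smooth_map_const_family[OF A B f V]] c V])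
  have "smooth_on (cmap c ` (cdom c \<inter> f -` cdom d)) (\<lambda>y. h (cinv c y) d)"
    using h c by (auto simp: sections_along_def)
  then have "smooth_on (fset c d V (\<lambda>_. f)) (\<lambda>z. h (cinv c (snd z)) d)"
    by (rule smooth_on_compose[OF o smooth_on_bounded_linear[OF bounded_linear_snd o]])
      (auto simp: chart_image_eq[OF A c(1)])
  then show "smooth_on (fset c d V (\<lambda>_. f)) (\<lambda>(p, y). h (cinv c y) d)" by (simp add: case_prod_beta')
qed

lemma h0_dens_cont:
  assumes A: "smooth_atlas A" and B: "smooth_atlas B" and g: "riemannian_metric B gb" and f: "smooth_map A B f"
    and h: "h \<in> sections_along A B f" and k: "k \<in> sections_along A B f"
  shows "cont_dens A (h0_dens A B gb f h k)"
  unfolding cont_dens_def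
proof
  fix c assume c: "c \<in> A"
  show "continuous_on (cimg c) (\<lambda>y. h0_dens A B gb f h k (cinv c y) c)"
    using continuous_on_slice[OF h0_dens_continuous[OF A B g smooth_map_const_family[OF A B f open_UNIV] open_UNIV c
        section_const_family[OF A B f h open_UNIV] section_const_family[OF A B f k open_UNIV]], of "0::real"]
    by simp
qed

lemma det_congruence:
  fixes J G :: "real^'k^'k"
  shows "sqrt (det (transpose J ** G ** J)) = \<bar>det J\<bar> * sqrt (det G)"
proof -
  have "det (transpose J ** G ** J) = (det J)\<^sup>2 * det G"
    by (simp add: det_mul det_transpose power2_eq_square)
  then show ?thesis by (simp add: real_sqrt_mult)
qed

text \<open>The Gram matrices in the two charts are congruent by the Jacobian matrix of
  \<open>\<phi>\<close>.\<close>

lemma vol_pullback: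
  assumes A: "smooth_atlas A" and B: "smooth_atlas B" and g: "riemannian_metric B gb" and f: "smooth_map A B f"
    and \<phi>: "smooth_map A A \<phi>" and c: "c \<in> A" "c' \<in> A" "x \<in> cdom c" "\<phi> x \<in> cdom c'"
  shows "vol A (pullback_metric A B gb (f \<circ> \<phi>)) x c =
     \<bar>det (matrix (tdiff c c' \<phi> x))\<bar> * vol A (pullback_metric A B gb f) (\<phi> x) c'"
proof -
  let ?q = "f (\<phi> x)"
  define J where "J = matrix (tdiff c c' \<phi> x)"
  define t where "t = (\<lambda>u. tangent_map A B f (\<phi> x) (coord_vec A c' (\<phi> x) u))"
  define G where "G = (\<chi> i j. gb ?q (t (axis i 1)) (t (axis j 1)))"
  have f\<phi>: "smooth_map A B (f \<circ> \<phi>)" by (rule smooth_map_comp[OF A A B \<phi> f])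
  have tT: "t u \<in> tangent_space B ?q" for u
    unfolding t_def by (intro tangent_map_in[OF A B f] coord_vec_in[OF A] c)
  have tl: "t (a *\<^sub>R u + b *\<^sub>R v) = lincomb a (t u) b (t v)" for a b u v
    unfolding t_def coord_vec_lincomb[OF A c(2,4)]
    by (intro tangent_map_lincomb[OF A B f] coord_vec_in[OF A] c)
  have e: "tangent_map A B (f \<circ> \<phi>) x (coord_vec A c x u) = t (tdiff c c' \<phi> x u)" for u
  proof -
    have v: "coord_vec A c x u \<in> tangent_space A x" by (rule coord_vec_in[OF A c(1,3)])
    have "tangent_map A A \<phi> x (coord_vec A c x u) = coord_vec A c' (\<phi> x) (tdiff c c' \<phi> x u)"
      by (rule tangent_eqI[OF tangent_map_in[OF A A \<phi> v] coord_vec_in[OF A c(2,4)] c(2,4)])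
        (simp add: tangent_map_at[OF A A \<phi> v c] coord_vec_same[OF A] c)
    then show ?thesis using tangent_map_comp[OF A A B \<phi> f f\<phi> v] by (simp add: t_def)
  qed
  have bl: "bilinear (\<lambda>u v. gb ?q (t u) (t v))"
    unfolding bilinear_def
  proof (intro conjI allI linearI)
    fix u v w :: "real^'b" and s :: real
    show "gb ?q (t u) (t (v + w)) = gb ?q (t u) (t v) + gb ?q (t u) (t w)"
      using gb_lincomb_right[OF g B tT tT tT, of u 1 v 1 w] tl[of 1 v 1 w] by simp
    show "gb ?q (t u) (t (s *\<^sub>R v)) = s *\<^sub>R gb ?q (t u) (t v)"
      using gb_lincomb_right[OF g B tT tT tT, of u s v 0 w] tl[of s v 0 w] by simp
    show "gb ?q (t (v + w)) (t u) = gb ?q (t v) (t u) + gb ?q (t w) (t u)"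
      using gb_lincomb[OF g tT tT tT, of 1 v 1 w u] tl[of 1 v 1 w] by simp
    show "gb ?q (t (s *\<^sub>R v)) (t u) = s *\<^sub>R gb ?q (t v) (t u)"
      using gb_lincomb[OF g tT tT tT, of s v 0 w u] tl[of s v 0 w] by simp
  qed
  have J: "tdiff c c' \<phi> x (axis i 1) = (\<Sum>r\<in>UNIV. J $ r $ i *\<^sub>R axis r 1)" for i
    by (simp add: J_def matrix_def vec_eq_iff axis_def if_distrib[of "\<lambda>z. _ * z"] sum.delta cong: if_cong)
  have "gb ?q (t (tdiff c c' \<phi> x (axis i 1))) (t (tdiff c c' \<phi> x (axis j 1))) = (transpose J ** G ** J) $ i $ j" for i j
  proof -
    have "gb ?q (t (tdiff c c' \<phi> x (axis i 1))) (t (tdiff c c' \<phi> x (axis j 1)))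
       = (\<Sum>(r, s)\<in>UNIV \<times> UNIV. gb ?q (t (J $ r $ i *\<^sub>R axis r 1)) (t (J $ s $ j *\<^sub>R axis s 1)))"
      unfolding J by (subst bilinear_sum[OF bl]) simp
    also have "\<dots> = (\<Sum>r\<in>UNIV. \<Sum>s\<in>UNIV. J $ r $ i * (J $ s $ j * G $ r $ s))"
      by (subst sum.cartesian_product[symmetric]) (simp add: bilinear_lmul[OF bl] bilinear_rmul[OF bl] G_def mult.left_commute)
    also have "\<dots> = (\<Sum>s\<in>UNIV. \<Sum>r\<in>UNIV. J $ r $ i * (J $ s $ j * G $ r $ s))" by (rule sum.swap)
    also have "\<dots> = (transpose J ** G ** J) $ i $ j"
      by (simp add: matrix_matrix_mult_def transpose_def sum_distrib_right sum_distrib_left mult_ac)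
    finally show ?thesis .
  qed
  then have "(\<chi> i j. gb ((f \<circ> \<phi>) x) (tangent_map A B (f \<circ> \<phi>) x (coord_vec A c x (axis i 1)))
      (tangent_map A B (f \<circ> \<phi>) x (coord_vec A c x (axis j 1)))) = transpose J ** G ** J"
    by (simp add: e vec_eq_iff)
  then show ?thesis
    unfolding vol_eq[OF A c(1,3)] vol_eq[OF A c(2,4)] by (simp add: det_congruence G_def t_def J_def)
qed

lemma h0_dens_pullback:
  assumes A: "smooth_atlas A" and B: "smooth_atlas B" and g: "riemannian_metric B gb" and f: "smooth_map A B f"
    and \<phi>: "smooth_map A A \<phi>"
  shows "pullback_dens A \<phi> (h0_dens A B gb f h k) (h0_dens A B gb (f \<circ> \<phi>) (h \<circ> \<phi>) (k \<circ> \<phi>))"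
  unfolding pullback_dens_def h0_dens_def using vol_pullback[OF A B g f \<phi>] by simp

lemma h0_dens_id:
  assumes A: "smooth_atlas A" and B: "smooth_atlas B" and g: "riemannian_metric B gb" and f: "smooth_map A B f"
  shows "pullback_dens A id (h0_dens A B gb f h k) (h0_dens A B gb f h k)"
  using h0_dens_pullback[OF A B g f smooth_map_id[OF A], of h k] by simp

lemma section_diffeo:
  assumes A: "smooth_atlas A" and B: "smooth_atlas B" and f: "smooth_map A B f" and \<phi>: "smooth_map A A \<phi>"
    and h: "h \<in> sections_along A B f"
  shows "h \<circ> \<phi> \<in> sections_along A B (f \<circ> \<phi>)"
  unfolding sections_along_def
proof (intro CollectI conjI ballI allI)
  show "(h \<circ> \<phi>) x \<in> tangent_space B ((f \<circ> \<phi>) x)" for x using h by (simp add: sections_along_def)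
  fix c d assume c: "c \<in> A" "d \<in> B"
  let ?S = "cmap c ` (cdom c \<inter> (f \<circ> \<phi>) -` cdom d)"
  have oS: "open ?S" by (rule smooth_map_open[OF A B smooth_map_comp[OF A A B \<phi> f] c])
  show "smooth_on ?S (\<lambda>y. (h \<circ> \<phi>) (cinv c y) d)"
  proof (rule smooth_on_local)
    fix y0 assume y0: "y0 \<in> ?S"
    obtain c' where c': "c' \<in> A" "\<phi> (cinv c y0) \<in> cdom c'" using atlas_cover[OF A] by blast
    define T where "T = ?S \<inter> cmap c ` (cdom c \<inter> \<phi> -` cdom c')"
    have T: "open T" unfolding T_def using oS smooth_map_open[OF A A \<phi> c(1) c'(1)] by auto
    have hs: "smooth_on (cmap c' ` (cdom c' \<inter> f -` cdom d)) (\<lambda>y. h (cinv c' y) d)"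
      using h c c' by (auto simp: sections_along_def)
    have "smooth_on T (\<lambda>y. h (cinv c' ((cmap c' \<circ> \<phi> \<circ> cinv c) y)) d)"
      by (rule smooth_on_compose[OF T smooth_on_mono[OF _ smooth_mapD[OF \<phi> c(1) c'(1)]] hs])
        (auto simp: T_def chart_image_eq[OF A c(1)] chart_image_eq[OF A c'(1)] cinv_cmap[OF A c'(1)])
    then have "smooth_on T (\<lambda>y. (h \<circ> \<phi>) (cinv c y) d)"
      by (rule smooth_on_cong[OF T, rotated]) (auto simp: T_def chart_image_eq[OF A c(1)] cinv_cmap[OF A c'(1)])
    moreover have "y0 \<in> T" using y0 c' by (auto simp: T_def chart_image_eq[OF A c(1)])
    ultimately show "\<exists>T. open T \<and> y0 \<in> T \<and> smooth_on T (\<lambda>y. (h \<circ> \<phi>) (cinv c y) d)" using T by blast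
  qed
qed

lemma section_lincomb:
  assumes A: "smooth_atlas A" and B: "smooth_atlas B" and f: "smooth_map A B f"
    and h: "h \<in> sections_along A B f" and k: "k \<in> sections_along A B f"
  shows "(\<lambda>x. lincomb a (h x) b (k x)) \<in> sections_along A B f"
  unfolding sections_along_def
proof (intro CollectI conjI ballI allI)
  show "lincomb a (h x) b (k x) \<in> tangent_space B (f x)" for x
    using h k by (intro lincomb_in[OF B]) (auto simp: sections_along_def)
  fix c d assume c: "c \<in> A" "d \<in> B"
  have o: "open (cmap c ` (cdom c \<inter> f -` cdom d))" by (rule smooth_map_open[OF A B f c])
  show "smooth_on (cmap c ` (cdom c \<inter> f -` cdom d)) (\<lambda>y. lincomb a (h (cinv c y)) b (k (cinv c y)) d)"
    using h k c unfolding lincomb_def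
    by (intro smooth_on_add[OF o] smooth_on_scaleR[OF o] smooth_on_const[OF o]) (auto simp: sections_along_def)
qed

lemma H0_sym:
  assumes g: "riemannian_metric B gb" and h: "h \<in> sections_along A B f" and k: "k \<in> sections_along A B f"
  shows "H0 A B gb f h k = H0 A B gb f k h"
proof -
  have "gb (f x) (h x) (k x) = gb (f x) (k x) (h x)" for x
    using h k by (intro gb_sym[OF g]) (auto simp: sections_along_def)
  then show ?thesis by (simp add: H0_def)
qed

lemma H0_lincomb:
  fixes A :: "('m::t2_space, 'k::finite) chart set"
  assumes A: "smooth_atlas A" and M: "compact (UNIV :: 'm set)"
    and B: "smooth_atlas B" and g: "riemannian_metric B gb" and f: "smooth_map A B f"
    and h: "h \<in> sections_along A B f" "h' \<in> sections_along A B f" and k: "k \<in> sections_along A B f"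
  shows "H0 A B gb f (\<lambda>x. lincomb a (h x) b (h' x)) k = a * H0 A B gb f h k + b * H0 A B gb f h' k"
proof -
  have "gb (f x) (lincomb a (h x) b (h' x)) (k x) = a * gb (f x) (h x) (k x) + b * gb (f x) (h' x) (k x)" for x
    using h k by (intro gb_lincomb[OF g]) (auto simp: sections_along_def)
  then have "h0_dens A B gb f (\<lambda>x. lincomb a (h x) b (h' x)) k =
     (\<lambda>x c. a * h0_dens A B gb f h k x c + b * h0_dens A B gb f h' k x c)"
    by (simp add: h0_dens_def algebra_simps)
  then show ?thesis
    using density_integral_lincomb[OF A M h0_dens_id[OF A B g f] h0_dens_cont[OF A B g f h(1) k]
      h0_dens_id[OF A B g f] h0_dens_cont[OF A B g f h(2) k], of a b] by (simp add: H0_eq)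
qed

lemma H0_diffeo:
  fixes A :: "('m::t2_space, 'k::finite) chart set"
  assumes A: "smooth_atlas A" and M: "compact (UNIV :: 'm set)"
    and B: "smooth_atlas B" and g: "riemannian_metric B gb" and f: "smooth_map A B f" and \<phi>: "\<phi> \<in> diffeos A"
    and h: "h \<in> sections_along A B f" and k: "k \<in> sections_along A B f"
  shows "H0 A B gb (f \<circ> \<phi>) (h \<circ> \<phi>) (k \<circ> \<phi>) = H0 A B gb f h k"
  unfolding H0_eq
  by (rule density_integral_diffeo[OF A M \<phi> h0_dens_id[OF A B g f] h0_dens_pullback[OF A B g f diffeosD(2)[OF \<phi>]]
     h0_dens_cont[OF A B g f h k] h0_dens_cont[OF A B g smooth_map_comp[OF A A B diffeosD(2)[OF \<phi>] f]
       section_diffeo[OF A B f diffeosD(2)[OF \<phi>] h] section_diffeo[OF A B f diffeosD(2)[OF \<phi>] k]]])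

lemma H0_continuous:
  fixes A :: "('m::t2_space, 'k::finite) chart set" and U :: "'p::euclidean_space set"
  assumes A: "smooth_atlas A" and M: "compact (UNIV :: 'm set)"
    and B: "smooth_atlas B" and g: "riemannian_metric B gb" and F: "smooth_family A B U F" and U: "open U"
    and h: "smooth_section_family A B U F h" and k: "smooth_section_family A B U F k"
  shows "continuous_on U (\<lambda>p. H0 A B gb (F p) (h p) (k p))"
  unfolding H0_eq
  by (rule density_integral_continuous[OF A M h0_dens_id[OF A B g family_slice[OF A B F]]
     h0_dens_continuous[OF A B g F U _ h k]])

section \<open>Diffeomorphisms supported in a chart\<close>

text \<open>The derivative is bounded on \<open>K\<close> by compactness and vanishes outside.\<close>

lemma compactly_supported_lipschitz:
  fixes \<omega> :: "'a::euclidean_space \<Rightarrow> real"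
  assumes s: "smooth_on UNIV \<omega>" and K: "compact K" and 0: "\<And>y. y \<notin> K \<Longrightarrow> \<omega> y = 0"
  obtains L where "L \<ge> 0" "\<And>y v. \<bar>frechet_derivative \<omega> (at y) v\<bar> \<le> L * norm v"
    "\<And>y z. \<bar>\<omega> y - \<omega> z\<bar> \<le> L * norm (y - z)"
proof -
  let ?D = "\<lambda>y. frechet_derivative \<omega> (at y)"
  have D: "(\<omega> has_derivative ?D y) (at y)" for y by (rule smooth_on_deriv[OF s]) simp
  have "continuous_on K (\<lambda>y. \<Sum>b\<in>Basis. \<bar>?D y b\<bar>)"
    using smooth_on_imp_continuous[OF smooth_on_frechet[OF s]]
    by (intro continuous_intros) (auto intro: continuous_on_subset)
  then have "bounded ((\<lambda>y. \<Sum>b\<in>Basis. \<bar>?D y b\<bar>) ` K)"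
    using K by (intro compact_imp_bounded compact_continuous_image)
  then obtain L0 where L0: "\<And>y. y \<in> K \<Longrightarrow> \<bar>\<Sum>b\<in>Basis. \<bar>?D y b\<bar>\<bar> \<le> L0"
    by (auto simp: bounded_iff)
  define L where "L = max L0 0"
  have out: "?D y v = 0" if "y \<notin> K" for y v
  proof -
    have "(\<omega> has_derivative (\<lambda>_. 0)) (at y)"
      by (rule has_derivative_transform_within_open[OF has_derivative_const, where s="- K"])
        (use that 0 compact_imp_closed[OF K] in auto)
    then have "?D y = (\<lambda>_. 0)" by (metis frechet_derivative_at)
    then show ?thesis by simp
  qed
  have b: "\<bar>?D y v\<bar> \<le> L * norm v" for y v
  proof (cases "y \<in> K")
    case True
    interpret bounded_linear "?D y" by (rule has_derivative_bounded_linear[OF D])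
    have "?D y v = ?D y (\<Sum>b\<in>Basis. (v \<bullet> b) *\<^sub>R b)" by (simp add: euclidean_representation)
    also have "\<dots> = (\<Sum>b\<in>Basis. (v \<bullet> b) * ?D y b)" by (simp add: sum scale)
    also have "\<bar>\<dots>\<bar> \<le> (\<Sum>b\<in>Basis. \<bar>(v \<bullet> b) * ?D y b\<bar>)" by (rule sum_abs)
    also have "\<dots> \<le> (\<Sum>b\<in>Basis. norm v * \<bar>?D y b\<bar>)"
      by (intro sum_mono) (auto simp: abs_mult intro!: mult_right_mono Basis_le_norm)
    also have "\<dots> = norm v * (\<Sum>b\<in>Basis. \<bar>?D y b\<bar>)" by (simp add: sum_distrib_left)
    also have "\<dots> \<le> norm v * L" using L0[OF True] by (intro mult_left_mono) (auto simp: L_def)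
    finally show ?thesis by (simp add: mult.commute)
  next
    case False
    then show ?thesis by (simp add: out L_def)
  qed
  have "norm (\<omega> y - \<omega> z) \<le> L * norm (y - z)" for y z
  proof (rule differentiable_bound[OF convex_UNIV])
    show "(\<omega> has_derivative ?D y) (at y within UNIV)" for y using D by simp
    show "onorm (?D y) \<le> L" for y using b by (intro onorm_le) simp
  qed auto
  then show ?thesis using b by (intro that[of L]) (auto simp: L_def)
qed

text \<open>For small \<open>\<sigma>\<close> the map \<open>y \<mapsto> y + \<sigma> \<omega>(y) e\<close> is a perturbation of the identity by a
  contraction.\<close>

locale push =
  fixes \<omega> :: "'a::euclidean_space \<Rightarrow> real" and e :: 'a and L :: real and K :: "'a set" and \<sigma> :: real
  assumes smooth: "smooth_on UNIV \<omega>" and L: "L \<ge> 0"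
    and deriv: "\<And>y v. \<bar>frechet_derivative \<omega> (at y) v\<bar> \<le> L * norm v"
    and lip: "\<And>y z. \<bar>\<omega> y - \<omega> z\<bar> \<le> L * norm (y - z)"
    and out: "\<And>y. y \<notin> K \<Longrightarrow> \<omega> y = 0"
    and small: "\<bar>\<sigma>\<bar> * (L * norm e) \<le> 1/2"
begin

definition push_map :: "'a \<Rightarrow> 'a" where "push_map y = y + (\<sigma> * \<omega> y) *\<^sub>R e"
definition push_inv :: "'a \<Rightarrow> 'a" where "push_inv = inv push_map"

lemma half: "norm ((\<sigma> * \<omega> y) *\<^sub>R e - (\<sigma> * \<omega> z) *\<^sub>R e) \<le> 1/2 * norm (y - z)"
proof -
  have "norm ((\<sigma> * \<omega> y) *\<^sub>R e - (\<sigma> * \<omega> z) *\<^sub>R e) = \<bar>\<sigma>\<bar> * \<bar>\<omega> y - \<omega> z\<bar> * norm e"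
    by (simp add: scaleR_left_diff_distrib[symmetric] right_diff_distrib[symmetric] abs_mult)
  also have "\<dots> \<le> \<bar>\<sigma>\<bar> * (L * norm (y - z)) * norm e"
    by (intro mult_right_mono mult_left_mono lip) auto
  also have "\<dots> = (\<bar>\<sigma>\<bar> * (L * norm e)) * norm (y - z)" by simp
  also have "\<dots> \<le> 1/2 * norm (y - z)" by (intro mult_right_mono small) auto
  finally show ?thesis .
qed

lemma expand: "norm (y - z) \<le> 2 * norm (push_map y - push_map z)"
proof -
  have "y - z = (push_map y - push_map z) - ((\<sigma> * \<omega> y) *\<^sub>R e - (\<sigma> * \<omega> z) *\<^sub>R e)" by (simp add: push_map_def)
  then have "norm (y - z) \<le> norm (push_map y - push_map z) + norm ((\<sigma> * \<omega> y) *\<^sub>R e - (\<sigma> * \<omega> z) *\<^sub>R e)"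
    by (metis norm_triangle_ineq4)
  then show ?thesis using half[of y z] by linarith
qed

lemma bij: "bij push_map"
proof (rule bijI)
  show "inj push_map"
  proof (rule injI)
    fix y z assume "push_map y = push_map z"
    then show "y = z" using expand[of y z] by simp
  qed
  show "surj push_map"
  proof (rule surjI[of _ "\<lambda>z. SOME y. z - (\<sigma> * \<omega> y) *\<^sub>R e = y"])
    fix z
    have "\<exists>!y. z - (\<sigma> * \<omega> y) *\<^sub>R e = y"
    proof (rule banach_fix_type[of "1/2"])
      show "\<forall>x y. dist (z - (\<sigma> * \<omega> x) *\<^sub>R e) (z - (\<sigma> * \<omega> y) *\<^sub>R e) \<le> 1/2 * dist x y"
        using half by (simp add: dist_norm norm_minus_commute)
    qed auto
    then have "z - (\<sigma> * \<omega> (SOME y. z - (\<sigma> * \<omega> y) *\<^sub>R e = y)) *\<^sub>R e = (SOME y. z - (\<sigma> * \<omega> y) *\<^sub>R e = y)"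
      by (rule someI_ex[OF ex1_implies_ex])
    from this[symmetric] show "push_map (SOME y. z - (\<sigma> * \<omega> y) *\<^sub>R e = y) = z"
      unfolding push_map_def by (simp only: eq_diff_eq)
  qed
qed

lemma push_push_inv: "push_map (push_inv z) = z" and push_inv_push: "push_inv (push_map y) = y"
  using bij by (simp_all add: push_inv_def bij_is_surj surj_f_inv_f bij_is_inj inv_f_f)

lemma push_map_out: "y \<notin> K \<Longrightarrow> push_map y = y" by (simp add: push_map_def out)
lemma push_inv_out: "y \<notin> K \<Longrightarrow> push_inv y = y" using push_inv_push[of y] push_map_out[of y] by simp
lemma push_map_in: "y \<in> K \<Longrightarrow> push_map y \<in> K" using push_inv_out[of "push_map y"] push_inv_push[of y] by metis
lemma push_inv_in: "y \<in> K \<Longrightarrow> push_inv y \<in> K" using push_map_out[of "push_inv y"] push_push_inv[of y] by metis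

lemma push_inv_close: "norm (push_inv z - z) = \<bar>\<sigma>\<bar> * \<bar>\<omega> (push_inv z)\<bar> * norm e"
proof -
  have "push_inv z - z = - ((\<sigma> * \<omega> (push_inv z)) *\<^sub>R e)" using push_push_inv[of z] by (simp add: push_map_def algebra_simps)
  then show ?thesis by (simp add: abs_mult)
qed

text \<open>The derivative of \<open>push_map\<close> is the identity plus an operator of rank one, so its inverse \<open>I\<close> is
  given by the Sherman-Morrison formula. It expresses the derivative of \<open>push_inv\<close> smoothly through
  \<open>push_inv\<close> itself, and regularity increases step by step.\<close>

lemma smooth_push_inv: "smooth_on UNIV push_inv"
proof -
  let ?D = "\<lambda>y. frechet_derivative \<omega> (at y)"
  define I where "I = (\<lambda>y v. v + (- (\<sigma> * ?D y v) * inverse (1 + \<sigma> * ?D y e)) *\<^sub>R e)"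
  have nz: "1 + \<sigma> * ?D y e \<noteq> 0" for y
  proof -
    have "\<bar>\<sigma> * ?D y e\<bar> \<le> \<bar>\<sigma>\<bar> * (L * norm e)"
      unfolding abs_mult by (intro mult_left_mono deriv) auto
    then show ?thesis using small by linarith
  qed
  have c: "continuous (at z) push_inv" for z
  proof -
    have "norm (push_inv z - push_inv w) \<le> 2 * norm (z - w)" for z w
      using expand[of "push_inv z" "push_inv w"] by (simp add: push_push_inv)
    then have "lipschitz_on 2 UNIV push_inv" by (intro lipschitz_onI) (auto simp: dist_norm)
    then have "continuous_on UNIV push_inv" by (rule lipschitz_on_continuous_on)
    then show ?thesis by (simp add: continuous_on_eq_continuous_at)
  qed
  have D: "(\<omega> has_derivative ?D y) (at y)" for y by (rule smooth_on_deriv[OF smooth]) simp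
  have lin: "linear (?D y)" for y by (rule has_derivative_linear[OF D])
  have der: "(push_inv has_derivative I (push_inv z)) (at z)" for z
  proof (rule has_derivative_inverse_basic[where T=UNIV and f=push_map and f'="\<lambda>v. v + (\<sigma> * ?D (push_inv z) v) *\<^sub>R e"])
    show "(push_map has_derivative (\<lambda>v. v + (\<sigma> * ?D (push_inv z) v) *\<^sub>R e)) (at (push_inv z))"
      unfolding push_map_def by (auto intro!: derivative_eq_intros D)
    show "bounded_linear (I (push_inv z))"
      unfolding I_def linear_conv_bounded_linear[symmetric]
      by (rule linearI) (simp_all add: linear_add[OF lin] linear_scale[OF lin] algebra_simps)
    show "I (push_inv z) \<circ> (\<lambda>v. v + (\<sigma> * ?D (push_inv z) v) *\<^sub>R e) = id"
    proof
      fix v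
      have "?D (push_inv z) (v + (\<sigma> * ?D (push_inv z) v) *\<^sub>R e) = ?D (push_inv z) v * (1 + \<sigma> * ?D (push_inv z) e)"
        by (simp add: linear_add[OF lin] linear_scale[OF lin] algebra_simps)
      then show "(I (push_inv z) \<circ> (\<lambda>v. v + (\<sigma> * ?D (push_inv z) v) *\<^sub>R e)) v = id v"
        using nz[of "push_inv z"] by (simp add: I_def)
    qed
  qed (auto simp: c push_push_inv)
  have Is: "smooth_on UNIV (\<lambda>y. I y v)" for v
  proof -
    have 1: "smooth_on UNIV (\<lambda>y. ?D y v)" for v by (rule smooth_on_frechet[OF smooth])
    have "smooth_on UNIV (\<lambda>y. 1 + \<sigma> *\<^sub>R ?D y e)"
      by (intro smooth_on_add smooth_on_scaleR smooth_on_const 1) auto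
    then have 2: "smooth_on UNIV (\<lambda>y. inverse (1 + \<sigma> *\<^sub>R ?D y e))"
      by (rule smooth_on_compose[OF open_UNIV _ smooth_on_inverse]) (use nz in auto)
    have "smooth_on UNIV (\<lambda>y. v + (((- \<sigma>) *\<^sub>R ?D y v) *\<^sub>R inverse (1 + \<sigma> *\<^sub>R ?D y e)) *\<^sub>R e)"
      by (intro smooth_on_add smooth_on_scaleR smooth_on_const 1 2) auto
    then show ?thesis by (simp add: I_def)
  qed
  show ?thesis unfolding smooth_on_def
  proof
    fix k show "Ck_on k UNIV push_inv"
    proof (induction k)
      case 0
      then show ?case using c by (simp add: continuous_at_imp_continuous_on)
    next
      case (Suc k)
      show ?case
      proof (rule Ck_on_SucI[OF open_UNIV der])
        show "Ck_on k UNIV (\<lambda>z. I (push_inv z) v)" for v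
          by (rule Ck_on_compose[OF open_UNIV Suc]) (use Is in \<open>auto simp: smooth_on_def\<close>)
      qed
    qed
  qed
qed

end

definition chart_ext :: "('m, 'k::finite) chart \<Rightarrow> (real^'k \<Rightarrow> real^'k) \<Rightarrow> 'm \<Rightarrow> 'm" where
  "chart_ext c \<Phi> x = (if x \<in> cdom c then cinv c (\<Phi> (cmap c x)) else x)"

text \<open>The map is smooth on the chart domain, where it is \<open>\<Phi>\<close> in coordinates, and on
  the complement of the copy of \<open>K\<close>, where it is the identity. The complement is
  open because the copy of \<open>K\<close> is compact in a Hausdorff space.\<close>

lemma chart_ext_family:
  fixes A :: "('m::t2_space, 'k::finite) chart set" and V :: "'p::euclidean_space set"
  assumes A: "smooth_atlas A" and c: "c \<in> A" and K: "compact K" "K \<subseteq> cimg c" and V: "open V"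
    and s: "smooth_on (V \<times> UNIV) (\<lambda>(p, y). \<Phi> p y)"
    and out: "\<And>p y. p \<in> V \<Longrightarrow> y \<notin> K \<Longrightarrow> \<Phi> p y = y" and inn: "\<And>p y. p \<in> V \<Longrightarrow> y \<in> K \<Longrightarrow> \<Phi> p y \<in> K"
  shows "smooth_family A A V (\<lambda>p. chart_ext c (\<Phi> p))"
proof -
  define KM where "KM = cinv c ` K"
  note cc = chart_compact[OF A c K, folded KM_def]
  have KM: "open (- KM)" using compact_imp_closed[OF cc(1)] by blast
  note KMc = cc(2) and notKM = cc(4)
  have cin: "\<Phi> p y \<in> cimg c" if "p \<in> V" "y \<in> cimg c" for p y
    using out[OF that(1)] inn[OF that(1)] K(2) that(2) by (metis subsetD)
  have ext_out: "chart_ext c (\<Phi> p) x = x" if "p \<in> V" "x \<notin> KM" for p x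
    using out[OF that(1) notKM[OF _ that(2)]] by (simp add: chart_ext_def cinv_cmap[OF A c])
  have C: "continuous_on (V \<times> UNIV) (\<lambda>(p, x). chart_ext c (\<Phi> p) x)"
  proof -
    have "continuous_on (V \<times> cdom c) (\<lambda>z. (fst z, cmap c (snd z)))"
      by (intro continuous_intros continuous_on_compose2[OF cont_cmap[OF A c]]) auto
    then have "continuous_on (V \<times> cdom c) (\<lambda>z. (\<lambda>(p, y). \<Phi> p y) (fst z, cmap c (snd z)))"
      by (rule continuous_on_compose2[OF smooth_on_imp_continuous[OF s]]) auto
    then have "continuous_on (V \<times> cdom c) (\<lambda>z. cinv c ((\<lambda>(p, y). \<Phi> p y) (fst z, cmap c (snd z))))"
      by (rule continuous_on_compose2[OF cont_cinv[OF A c]]) (use cin in auto)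
    then have 1: "continuous_on (V \<times> cdom c) (\<lambda>(p, x). chart_ext c (\<Phi> p) x)"
      by (rule continuous_on_eq) (auto simp: chart_ext_def)
    have 2: "continuous_on (V \<times> (- KM)) (\<lambda>(p, x). chart_ext c (\<Phi> p) x)"
      by (rule continuous_on_eq[where f=snd]) (auto simp: ext_out intro!: continuous_intros)
    have "continuous_on (V \<times> cdom c \<union> V \<times> (- KM)) (\<lambda>(p, x). chart_ext c (\<Phi> p) x)"
      by (rule continuous_on_open_Un[OF _ _ 1 2]) (intro open_Times V KM atlas_open[OF A c])+
    moreover have "V \<times> cdom c \<union> V \<times> (- KM) = V \<times> UNIV" using KMc by auto
    ultimately show ?thesis by simp
  qed
  show ?thesis unfolding smooth_family_def
  proof (intro conjI ballI C)
    fix c1 c2 assume c12: "c1 \<in> A" "c2 \<in> A"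
    let ?S = "fset c1 c2 V (\<lambda>p. chart_ext c (\<Phi> p))" and ?R = "frep c1 c2 (\<lambda>p. chart_ext c (\<Phi> p))"
    have oS: "open ?S" by (rule fset_open[OF A A C c12 V])
    note sm = smooth_mapD[OF smooth_map_id[OF A]]
    show "smooth_on ?S ?R"
    proof (rule smooth_on_local)
      fix z0 assume z0: "z0 \<in> ?S"
      obtain p0 y0 where z0': "z0 = (p0, y0)" by fastforce
      show "\<exists>T. open T \<and> z0 \<in> T \<and> smooth_on T ?R"
      proof (cases "cinv c1 y0 \<in> cdom c")
        case True
        define T where "T = ?S \<inter> (UNIV \<times> cmap c1 ` (cdom c1 \<inter> cdom c))"
        have T: "open T" unfolding T_def
          by (intro open_Int oS open_Times open_UNIV open_chart_image[OF A c12(1)] atlas_open[OF A c])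
        have Td: "fst z \<in> V" "snd z \<in> cimg c1" "cinv c1 (snd z) \<in> cdom c" "chart_ext c (\<Phi> (fst z)) (cinv c1 (snd z)) \<in> cdom c2" if "z \<in> T" for z
          using that by (auto simp: T_def chart_image_eq[OF A c12(1)])
        have "smooth_on T (\<lambda>z. (cmap c \<circ> id \<circ> cinv c1) (snd z))"
          by (rule smooth_on_compose[OF T smooth_on_bounded_linear[OF bounded_linear_snd T] sm[OF c12(1) c]])
            (use Td in \<open>auto simp: chart_image_eq[OF A c12(1)]\<close>)
        then have "smooth_on T (\<lambda>z. (fst z, (cmap c \<circ> id \<circ> cinv c1) (snd z)))"
          by (intro smooth_on_Pair smooth_on_bounded_linear[OF bounded_linear_fst] T)
        then have "smooth_on T (\<lambda>z. (\<lambda>(p, y). \<Phi> p y) (fst z, (cmap c \<circ> id \<circ> cinv c1) (snd z)))"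
          by (rule smooth_on_compose[OF T _ s]) (use Td in auto)
        then have "smooth_on T (\<lambda>z. (cmap c2 \<circ> id \<circ> cinv c) ((\<lambda>(p, y). \<Phi> p y) (fst z, (cmap c \<circ> id \<circ> cinv c1) (snd z))))"
          by (rule smooth_on_compose[OF T _ sm[OF c c12(2)]])
            (use Td cin in \<open>auto simp: chart_image_eq[OF A c] chart_ext_def\<close>)
        then have "smooth_on T ?R"
          by (rule smooth_on_cong[OF T, rotated]) (use Td in \<open>auto simp: chart_ext_def case_prod_beta'\<close>)
        moreover have "z0 \<in> T" using z0 True by (auto simp: T_def z0' chart_image_eq[OF A c12(1)])
        ultimately show ?thesis using T by blast
      next
        case False
        define T where "T = ?S \<inter> (UNIV \<times> cmap c1 ` (cdom c1 \<inter> (- KM)))"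
        have T: "open T" unfolding T_def
          by (intro open_Int oS open_Times open_UNIV open_chart_image[OF A c12(1)] KM)
        have Td: "fst z \<in> V" "snd z \<in> cimg c1" "cinv c1 (snd z) \<notin> KM" "chart_ext c (\<Phi> (fst z)) (cinv c1 (snd z)) \<in> cdom c2" if "z \<in> T" for z
          using that by (auto simp: T_def chart_image_eq[OF A c12(1)])
        have "smooth_on T (\<lambda>z. (cmap c2 \<circ> id \<circ> cinv c1) (snd z))"
          by (rule smooth_on_compose[OF T smooth_on_bounded_linear[OF bounded_linear_snd T] sm[OF c12]])
            (use Td in \<open>auto simp: chart_image_eq[OF A c12(1)] ext_out\<close>)
        then have "smooth_on T ?R"
          by (rule smooth_on_cong[OF T, rotated]) (use Td in \<open>auto simp: ext_out case_prod_beta'\<close>)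
        moreover have "z0 \<in> T" using z0 False KMc by (auto simp: T_def z0' chart_image_eq[OF A c12(1)])
        ultimately show ?thesis using T by blast
      qed
    qed
  qed
qed

definition chart_field :: "('m::topological_space, 'k::finite) chart set \<Rightarrow> ('m, 'k) chart \<Rightarrow> (real^'k \<Rightarrow> real^'k)
    \<Rightarrow> 'm \<Rightarrow> ('m, 'k) tvec" where
  "chart_field A c w x = (if x \<in> cdom c then coord_vec A c x (w (cmap c x)) else (\<lambda>_. 0))"

lemma chart_field_in:
  "smooth_atlas A \<Longrightarrow> c \<in> A \<Longrightarrow> chart_field A c w x \<in> tangent_space A x"
  by (simp add: chart_field_def coord_vec_in zero_in)

lemma chart_field_vector_field:
  fixes A :: "('m::t2_space, 'k::finite) chart set"
  assumes A: "smooth_atlas A" and c: "c \<in> A" and K: "compact K" "K \<subseteq> cimg c"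
    and w: "smooth_on UNIV w" and out: "\<And>y. y \<notin> K \<Longrightarrow> w y = 0"
  shows "chart_field A c w \<in> vector_fields A"
  unfolding vector_fields_def sections_along_def
proof (intro CollectI conjI ballI allI)
  show "chart_field A c w x \<in> tangent_space A (id x)" for x using chart_field_in[OF A c] by simp
  define KM where "KM = cinv c ` K"
  note cc = chart_compact[OF A c K, folded KM_def]
  have KM: "open (- KM)" using compact_imp_closed[OF cc(1)] by blast
  note KMc = cc(2) and notKM = cc(4)
  have f0: "chart_field A c w x = (\<lambda>_. 0)" if "x \<notin> KM" for x
  proof (cases "x \<in> cdom c")
    case True
    then have "coord_vec A c x 0 = (\<lambda>_. 0)"
      by (intro tangent_eqI[OF coord_vec_in[OF A c] zero_in[OF A] c]) (simp_all add: coord_vec_same[OF A c])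
    then show ?thesis using notKM[OF True that] out by (simp add: chart_field_def)
  qed (simp add: chart_field_def)
  fix c1 d assume c1: "c1 \<in> A" "d \<in> A"
  let ?S = "cmap c1 ` (cdom c1 \<inter> id -` cdom d)"
  have oS: "open ?S" by (rule smooth_map_open[OF A A smooth_map_id[OF A] c1])
  note sm = smooth_mapD[OF smooth_map_id[OF A]]
  show "smooth_on ?S (\<lambda>y. chart_field A c w (cinv c1 y) d)"
  proof (rule smooth_on_local)
    fix y0 assume y0: "y0 \<in> ?S"
    show "\<exists>T. open T \<and> y0 \<in> T \<and> smooth_on T (\<lambda>y. chart_field A c w (cinv c1 y) d)"
    proof (cases "cinv c1 y0 \<in> cdom c")
      case True
      define T where "T = ?S \<inter> cmap c1 ` (cdom c1 \<inter> cdom c)"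
      have T: "open T" unfolding T_def
        by (intro open_Int oS open_chart_image[OF A c1(1)] atlas_open[OF A c])
      have Td: "y \<in> cimg c1" "cinv c1 y \<in> cdom c" "cinv c1 y \<in> cdom d" if "y \<in> T" for y
        using that by (auto simp: T_def chart_image_eq[OF A c1(1)])
      let ?W = "cmap c ` (cdom c \<inter> id -` cdom d)"
      have oW: "open ?W" by (rule smooth_map_open[OF A A smooth_map_id[OF A] c c1(2)])
      have sW: "smooth_on ?W (\<lambda>z. frechet_derivative (cmap d \<circ> id \<circ> cinv c) (at z) (w z))"
        by (intro smooth_on_frechet_dir oW sm[OF c c1(2)] smooth_on_mono[OF _ w]) auto
      have "smooth_on T (\<lambda>y. (\<lambda>z. frechet_derivative (cmap d \<circ> id \<circ> cinv c) (at z) (w z)) ((cmap c \<circ> id \<circ> cinv c1) y))"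
        by (rule smooth_on_compose[OF T smooth_on_mono[OF _ sm[OF c1(1) c]] sW])
          (use Td in \<open>auto simp: chart_image_eq[OF A c] chart_image_eq[OF A c1(1)] cinv_cmap[OF A c]\<close>)
      then have "smooth_on T (\<lambda>y. chart_field A c w (cinv c1 y) d)"
        by (rule smooth_on_cong[OF T, rotated]) (use Td c1 in \<open>auto simp: chart_field_def coord_vec_eq tdiff_def\<close>)
      moreover have "y0 \<in> T" using y0 True by (auto simp: T_def chart_image_eq[OF A c1(1)])
      ultimately show ?thesis using T by blast
    next
      case False
      define T where "T = ?S \<inter> cmap c1 ` (cdom c1 \<inter> (- KM))"
      have T: "open T" unfolding T_def
        by (intro open_Int oS open_chart_image[OF A c1(1)] KM)
      have "smooth_on T (\<lambda>y. chart_field A c w (cinv c1 y) d)"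
        by (rule smooth_on_cong[OF T _ smooth_on_const[OF T, of 0]])
          (auto simp: T_def chart_image_eq[OF A c1(1)] f0)
      moreover have "y0 \<in> T" using y0 False KMc by (auto simp: T_def chart_image_eq[OF A c1(1)])
      ultimately show ?thesis using T by blast
    qed
  qed
qed

lemma chart_ext_diffeo:
  fixes A :: "('m::t2_space, 'k::finite) chart set"
  assumes A: "smooth_atlas A" and c: "c \<in> A" and K: "compact K" "K \<subseteq> cimg c"
    and s: "smooth_on UNIV \<Phi>" "smooth_on UNIV \<Psi>"
    and out: "\<And>y. y \<notin> K \<Longrightarrow> \<Phi> y = y" "\<And>y. y \<notin> K \<Longrightarrow> \<Psi> y = y"
    and inn: "\<And>y. y \<in> K \<Longrightarrow> \<Phi> y \<in> K" "\<And>y. y \<in> K \<Longrightarrow> \<Psi> y \<in> K"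
    and inv: "\<And>y. \<Phi> (\<Psi> y) = y" "\<And>y. \<Psi> (\<Phi> y) = y"
  shows "chart_ext c \<Phi> \<in> diffeos A" "inv (chart_ext c \<Phi>) = chart_ext c \<Psi>"
proof -
  have sm: "smooth_map A A (chart_ext c F)"
    if "smooth_on UNIV F" "\<And>y. y \<notin> K \<Longrightarrow> F y = y" "\<And>y. y \<in> K \<Longrightarrow> F y \<in> K" for F
  proof -
    have "smooth_on (UNIV \<times> UNIV) (\<lambda>z::real \<times> _. F (snd z))"
      by (rule smooth_on_compose[OF _ smooth_on_bounded_linear[OF bounded_linear_snd] that(1)]) auto
    then have "smooth_family A A (UNIV :: real set) (\<lambda>p. chart_ext c F)"
      by (intro chart_ext_family[OF A c K open_UNIV]) (auto simp: case_prod_beta' that)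
    then show ?thesis by (rule family_slice[OF A A, of UNIV _ 0]) simp
  qed
  have cin: "F y \<in> cimg c" if "y \<in> cimg c" "\<And>y. y \<notin> K \<Longrightarrow> F y = y" "\<And>y. y \<in> K \<Longrightarrow> F y \<in> K" for F y
    using that K(2) by (metis subsetD)
  have comp: "chart_ext c F (chart_ext c G x) = x"
    if "\<And>y. y \<notin> K \<Longrightarrow> G y = y" "\<And>y. y \<in> K \<Longrightarrow> G y \<in> K" "\<And>y. F (G y) = y" for F G x
  proof (cases "x \<in> cdom c")
    case True
    then have "G (cmap c x) \<in> cimg c" by (intro cin[of _ G, OF _ that(1,2)]) auto
    then show ?thesis using True cinv_in[of "G (cmap c x)" c] that(3)[of "cmap c x"]
      by (simp add: chart_ext_def cmap_cinv cinv_cmap[OF A c])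
  qed (simp add: chart_ext_def)
  have 1: "chart_ext c \<Phi> (chart_ext c \<Psi> x) = x" "chart_ext c \<Psi> (chart_ext c \<Phi> x) = x" for x
    by (rule comp[OF out(2) inn(2) inv(1)] comp[OF out(1) inn(1) inv(2)]; assumption)+
  then show i: "inv (chart_ext c \<Phi>) = chart_ext c \<Psi>" by (intro inv_equality) auto
  have "bij (chart_ext c \<Phi>)" using 1 by (intro o_bij[of "chart_ext c \<Psi>"]) auto
  then show "chart_ext c \<Phi> \<in> diffeos A"
    unfolding diffeos_def i using sm[OF s(1) out(1) inn(1)] sm[OF s(2) out(2) inn(2)] i by simp
qed

lemma bump_le_one: "bump y0 \<delta> y \<le> 1"
  by (simp add: bump_def flat_exp_def)

text \<open>The curve \<open>\<phi>\<close> moves points in the chart \<open>c\<close> in the direction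
  \<open>e\<close>; the role of \<open>\<psi> \<sigma>\<close> is that of the inverse of
  \<open>\<phi> \<sigma>\<close> in coordinates. The last clause identifies the field
  $(\partial_\sigma \varphi_\sigma) \circ \varphi_\sigma^{-1}$, and the one before it says how
  far it is from its value at $\sigma = 0$.\<close>

definition chart_push :: "('m::topological_space, 'k::finite) chart set \<Rightarrow> ('m, 'k) chart \<Rightarrow> real^'k \<Rightarrow> real
    \<Rightarrow> real^'k \<Rightarrow> real \<Rightarrow> real \<Rightarrow> (real \<Rightarrow> 'm \<Rightarrow> 'm) \<Rightarrow> (real \<Rightarrow> real^'k \<Rightarrow> real^'k) \<Rightarrow> bool" where
  "chart_push A c y0 \<delta> e \<epsilon> C \<phi> \<psi> \<longleftrightarrow>
     \<epsilon> > 0 \<and> C \<ge> 0 \<and> smooth_family A A {-\<epsilon><..<\<epsilon>} \<phi> \<and> \<phi> 0 = id \<and>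
     (\<forall>\<sigma>. \<bar>\<sigma>\<bar> < \<epsilon> \<longrightarrow> \<phi> \<sigma> \<in> diffeos A \<and> smooth_on UNIV (\<psi> \<sigma>) \<and>
        (\<forall>y. y \<notin> cball y0 \<delta> \<longrightarrow> \<psi> \<sigma> y = y) \<and>
        (\<forall>y. \<bar>bump y0 \<delta> (\<psi> \<sigma> y) - bump y0 \<delta> y\<bar> \<le> C * \<bar>\<sigma>\<bar>) \<and>
        (\<forall>x. velocity A \<phi> \<sigma> x = chart_field A c (\<lambda>y. bump y0 \<delta> (\<psi> \<sigma> y) *\<^sub>R e) (\<phi> \<sigma> x)))"

text \<open>At time \<open>\<sigma>\<close> the point with coordinates \<open>y\<close> moves with velocity
  \<open>\<omega>(y) e\<close>. It is then at \<open>z = y + \<sigma> \<omega>(y) e\<close>, so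
  that the velocity field at \<open>z\<close> is \<open>\<omega>(\<psi> \<sigma> z) e\<close>.\<close>

lemma chart_push_exists:
  fixes A :: "('m::t2_space, 'k::finite) chart set"
  assumes A: "smooth_atlas A" and c: "c \<in> A" and \<delta>: "\<delta> > 0" and K: "cball y0 \<delta> \<subseteq> cimg c"
  shows "\<exists>\<epsilon> C \<phi> \<psi>. chart_push A c y0 \<delta> e \<epsilon> C \<phi> \<psi>"
proof -
  let ?\<omega> = "bump y0 \<delta>" and ?K = "cball y0 \<delta>"
  have out: "?\<omega> y = 0" if "y \<notin> ?K" for y
    using that \<delta> by (intro bump_outside) (auto simp: dist_norm norm_minus_commute)
  obtain L where L: "L \<ge> 0" "\<And>y v. \<bar>frechet_derivative ?\<omega> (at y) v\<bar> \<le> L * norm v"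
    "\<And>y z. \<bar>?\<omega> y - ?\<omega> z\<bar> \<le> L * norm (y - z)"
    using compactly_supported_lipschitz[OF smooth_bump compact_cball out] by blast
  define \<epsilon> where "\<epsilon> = 1 / (2 * (L * norm e + 1))"
  have Le: "L * norm e \<ge> 0" using L(1) by simp
  then have \<epsilon>: "\<epsilon> > 0" by (simp add: \<epsilon>_def)
  define \<Phi> where "\<Phi> = (\<lambda>\<sigma> y. y + (\<sigma> * ?\<omega> y) *\<^sub>R e)"
  define \<psi> where "\<psi> = (\<lambda>\<sigma>. inv (\<Phi> \<sigma>))"
  define \<phi> where "\<phi> = (\<lambda>\<sigma>. chart_ext c (\<Phi> \<sigma>))"
  have push: "push ?\<omega> e L ?K \<sigma>" if "\<bar>\<sigma>\<bar> < \<epsilon>" for \<sigma>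
  proof
    have "\<bar>\<sigma>\<bar> * (L * norm e) \<le> \<epsilon> * (L * norm e)" using that Le by (intro mult_right_mono) auto
    also have "\<dots> \<le> 1/2" using Le by (simp add: \<epsilon>_def divide_simps)
    finally show "\<bar>\<sigma>\<bar> * (L * norm e) \<le> 1/2" .
  qed (use L out smooth_bump in auto)
  have P: "smooth_on UNIV (\<psi> \<sigma>)" "\<Phi> \<sigma> (\<psi> \<sigma> y) = y" "\<psi> \<sigma> (\<Phi> \<sigma> y) = y"
    "y \<notin> ?K \<Longrightarrow> \<Phi> \<sigma> y = y" "y \<notin> ?K \<Longrightarrow> \<psi> \<sigma> y = y" "y \<in> ?K \<Longrightarrow> \<Phi> \<sigma> y \<in> ?K" "y \<in> ?K \<Longrightarrow> \<psi> \<sigma> y \<in> ?K"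
    "norm (\<psi> \<sigma> y - y) = \<bar>\<sigma>\<bar> * \<bar>?\<omega> (\<psi> \<sigma> y)\<bar> * norm e" if "\<bar>\<sigma>\<bar> < \<epsilon>" for \<sigma> y
  proof -
    interpret push ?\<omega> e L ?K \<sigma> by (rule push[OF that])
    have 1: "push_map = \<Phi> \<sigma>" by (rule ext) (simp add: \<Phi>_def push_map_def)
    have 2: "push_inv = \<psi> \<sigma>" unfolding \<psi>_def push_inv_def 1 ..
    show "smooth_on UNIV (\<psi> \<sigma>)" "\<Phi> \<sigma> (\<psi> \<sigma> y) = y" "\<psi> \<sigma> (\<Phi> \<sigma> y) = y"
      "y \<notin> ?K \<Longrightarrow> \<Phi> \<sigma> y = y" "y \<notin> ?K \<Longrightarrow> \<psi> \<sigma> y = y" "y \<in> ?K \<Longrightarrow> \<Phi> \<sigma> y \<in> ?K" "y \<in> ?K \<Longrightarrow> \<psi> \<sigma> y \<in> ?K"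
      "norm (\<psi> \<sigma> y - y) = \<bar>\<sigma>\<bar> * \<bar>?\<omega> (\<psi> \<sigma> y)\<bar> * norm e"
      by (fact smooth_push_inv[unfolded 2] push_push_inv[unfolded 1 2] push_inv_push[unfolded 1 2] push_map_out[unfolded 1] push_inv_out[unfolded 2]
        push_map_in[unfolded 1] push_inv_in[unfolded 2] push_inv_close[unfolded 2])+
  qed
  have sj: "smooth_on UNIV (\<lambda>(\<sigma>, y). \<Phi> \<sigma> y)"
  proof -
    have "smooth_on UNIV (\<lambda>z::real \<times> (real^'k). ?\<omega> (snd z))"
      by (rule smooth_on_compose[OF open_UNIV smooth_on_bounded_linear[OF bounded_linear_snd open_UNIV] smooth_bump]) simp
    then have "smooth_on UNIV (\<lambda>z::real \<times> (real^'k). snd z + (fst z *\<^sub>R ?\<omega> (snd z)) *\<^sub>R e)"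
      by (intro smooth_on_add smooth_on_scaleR smooth_on_const smooth_on_bounded_linear[OF bounded_linear_snd]
          smooth_on_bounded_linear[OF bounded_linear_fst]) auto
    then show ?thesis by (simp add: \<Phi>_def case_prod_beta')
  qed
  have ss: "smooth_on UNIV (\<Phi> \<sigma>)" for \<sigma>
    using smooth_on_compose[OF open_UNIV smooth_on_Pair[OF open_UNIV smooth_on_const[OF open_UNIV, of \<sigma>]
      smooth_on_ident[OF open_UNIV]] sj] by simp
  have fam: "smooth_family A A {-\<epsilon><..<\<epsilon>} \<phi>"
    unfolding \<phi>_def
    by (rule chart_ext_family[OF A c compact_cball K open_greaterThanLessThan smooth_on_mono[OF _ sj]])
      (auto intro!: P simp del: mem_cball)
  have dif: "\<phi> \<sigma> \<in> diffeos A" if "\<bar>\<sigma>\<bar> < \<epsilon>" for \<sigma>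
    unfolding \<phi>_def by (rule chart_ext_diffeo(1)[OF A c compact_cball K ss P(1)]) (use P that in blast)+
  have "\<Phi> 0 = (\<lambda>y. y)" by (simp add: \<Phi>_def)
  then have id: "\<phi> 0 = id" by (auto simp: \<phi>_def chart_ext_def cinv_cmap[OF A c])
  have close: "\<bar>?\<omega> (\<psi> \<sigma> y) - ?\<omega> y\<bar> \<le> (L * norm e) * \<bar>\<sigma>\<bar>" if "\<bar>\<sigma>\<bar> < \<epsilon>" for \<sigma> y
  proof -
    have n: "norm (\<psi> \<sigma> y - y) \<le> \<bar>\<sigma>\<bar> * 1 * norm e"
      unfolding P(8)[OF that] using bump_le_one[of y0 \<delta> "\<psi> \<sigma> y"] bump_nonneg[of y0 \<delta> "\<psi> \<sigma> y"]
      by (intro mult_right_mono mult_left_mono) auto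
    have "\<bar>?\<omega> (\<psi> \<sigma> y) - ?\<omega> y\<bar> \<le> L * norm (\<psi> \<sigma> y - y)" by (rule L(3))
    also have "\<dots> \<le> L * (\<bar>\<sigma>\<bar> * 1 * norm e)" by (rule mult_left_mono[OF n L(1)])
    finally show ?thesis by (simp add: mult_ac)
  qed
  have vel: "velocity A \<phi> \<sigma> x = chart_field A c (\<lambda>y. ?\<omega> (\<psi> \<sigma> y) *\<^sub>R e) (\<phi> \<sigma> x)" if \<sigma>: "\<bar>\<sigma>\<bar> < \<epsilon>" for \<sigma> x
  proof (cases "x \<in> cdom c")
    case True
    define y where "y = cmap c x"
    have y: "y \<in> cimg c" using True by (simp add: y_def)
    have cin: "\<Phi> \<tau> y \<in> cimg c" if "\<bar>\<tau>\<bar> < \<epsilon>" for \<tau>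
    proof (cases "y \<in> ?K")
      case True
      then have "\<Phi> \<tau> y \<in> ?K" using P that by blast
      then show ?thesis using K by blast
    next
      case False
      then have "\<Phi> \<tau> y = y" using P that by blast
      then show ?thesis using y by simp
    qed
    have \<phi>x: "\<phi> \<tau> x = cinv c (\<Phi> \<tau> y)" for \<tau> using True by (simp add: \<phi>_def chart_ext_def y_def)
    have in_c: "\<phi> \<sigma> x \<in> cdom c" unfolding \<phi>x by (rule cinv_in[OF cin[OF \<sigma>]])
    have "((\<lambda>\<tau>. \<Phi> \<tau> y) has_vector_derivative ?\<omega> y *\<^sub>R e) (at \<sigma>)"
      unfolding \<Phi>_def by (auto intro!: derivative_eq_intros)
    then have "((\<lambda>\<tau>. cmap c (\<phi> \<tau> x)) has_vector_derivative ?\<omega> y *\<^sub>R e) (at \<sigma>)"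
      by (rule has_vector_derivative_transform_within_open[where S="{-\<epsilon><..<\<epsilon>}"])
        (use \<sigma> in \<open>auto simp: \<phi>x cmap_cinv[OF cin]\<close>)
    then have "velocity A \<phi> \<sigma> x c = ?\<omega> y *\<^sub>R e"
      using c in_c by (simp add: velocity_def vector_derivative_at)
    moreover have "chart_field A c (\<lambda>y. ?\<omega> (\<psi> \<sigma> y) *\<^sub>R e) (\<phi> \<sigma> x) c = ?\<omega> (\<psi> \<sigma> (\<Phi> \<sigma> y)) *\<^sub>R e"
      using in_c by (simp add: chart_field_def coord_vec_same[OF A c] \<phi>x cmap_cinv[OF cin[OF \<sigma>]])
    moreover have "\<psi> \<sigma> (\<Phi> \<sigma> y) = y" using P \<sigma> by blast
    ultimately show ?thesis
      using \<sigma> by (intro tangent_eqI[OF velocity_in[OF A A fam] chart_field_in[OF A c] c in_c]) auto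
  next
    case False
    then have "\<phi> \<tau> x = x" for \<tau> by (simp add: \<phi>_def chart_ext_def)
    then show ?thesis using False by (auto simp: velocity_def chart_field_def fun_eq_iff)
  qed
  have "chart_push A c y0 \<delta> e \<epsilon> (L * norm e) \<phi> \<psi>"
    unfolding chart_push_def
    by (intro conjI allI impI) (use \<epsilon> Le fam id dif close vel P in blast)+
  then show ?thesis by blast
qed

section \<open>Variational calculus in time\<close>

lemma smooth_sin: "smooth_on UNIV (sin :: real \<Rightarrow> real)"
proof -
  have "Ck_on k UNIV (sin :: real \<Rightarrow> real) \<and> Ck_on k UNIV (cos :: real \<Rightarrow> real)" for k
  proof (induction k)
    case 0
    then show ?case by (auto intro!: continuous_intros)
  next
    case (Suc k)
    have "Ck_on (Suc k) UNIV (sin :: real \<Rightarrow> real)"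
    proof (rule Ck_on_SucI[where f'="\<lambda>x v. cos x *\<^sub>R v"])
      show "(sin has_derivative (\<lambda>v. cos x *\<^sub>R v)) (at x)" for x :: real
        by (auto intro!: derivative_eq_intros)
      show "Ck_on k UNIV (\<lambda>x. cos x *\<^sub>R v)" for v :: real
        using Suc by (intro Ck_on_scaleR Ck_on_const) auto
    qed simp
    moreover have "Ck_on (Suc k) UNIV (cos :: real \<Rightarrow> real)"
    proof (rule Ck_on_SucI[where f'="\<lambda>x v. sin x *\<^sub>R (- v)"])
      show "(cos has_derivative (\<lambda>v. sin x *\<^sub>R (- v))) (at x)" for x :: real
        by (auto intro!: derivative_eq_intros)
      show "Ck_on k UNIV (\<lambda>x. sin x *\<^sub>R (- v))" for v :: real
        using Suc by (intro Ck_on_scaleR Ck_on_const) auto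
    qed simp
    ultimately show ?case ..
  qed
  then show ?thesis by (auto simp: smooth_on_def)
qed

text \<open>Smoothness of \<open>P\<close> is a statement about curves of immersions defined for all times.
  A smooth surjection of the line onto \<open>{a..b}\<close> with a continuous section carries
  it to paths over \<open>{a..b}\<close>; \<open>\<tau>\<close> is an affine image of the sine.\<close>

lemma time_reparam:
  fixes a b :: real
  assumes "a < b"
  shows "\<exists>\<tau> \<sigma> :: real \<Rightarrow> real. smooth_on UNIV \<tau> \<and> (\<forall>s. \<tau> s \<in> {a..b}) \<and>
    continuous_on {a..b} \<sigma> \<and> (\<forall>t\<in>{a..b}. \<tau> (\<sigma> t) = t)"
proof -
  define m r where "m = (a + b) / 2" and "r = (b - a) / 2"
  have r: "r > 0" "a = m - r" "b = m + r" using assms by (auto simp: m_def r_def field_simps)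
  define \<tau> where "\<tau> = (\<lambda>s. m + r *\<^sub>R sin s)"
  define \<sigma> where "\<sigma> = (\<lambda>t. arcsin ((t - m) / r))"
  have q: "-1 \<le> (t - m) / r \<and> (t - m) / r \<le> 1" if "t \<in> {a..b}" for t
    using that r by (auto simp: field_simps)
  show ?thesis
  proof (rule exI[of _ \<tau>], rule exI[of _ \<sigma>], intro conjI allI ballI)
    show "smooth_on UNIV \<tau>" unfolding \<tau>_def
      by (intro smooth_on_add smooth_on_scaleR smooth_on_const smooth_sin open_UNIV)
    show "\<tau> s \<in> {a..b}" for s
    proof -
      have "r * sin s \<le> r * 1" "r * (- 1) \<le> r * sin s" using r(1) by (intro mult_left_mono; simp)+
      then show ?thesis using r by (simp add: \<tau>_def)
    qed
    show "continuous_on {a..b} \<sigma>" unfolding \<sigma>_def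
      using q r(1) by (intro continuous_on_arcsin continuous_intros) auto
    show "\<tau> (\<sigma> t) = t" if "t \<in> {a..b}" for t
      using q[OF that] r(1) by (simp add: \<tau>_def \<sigma>_def)
  qed
qed

lemma smooth_on_polynomial: "smooth_on UNIV (\<lambda>t::real. \<Sum>i\<le>n. c i * t ^ i)"
proof -
  have "smooth_on UNIV (\<lambda>t::real. t ^ i)" for i
  proof (induction i)
    case (Suc i)
    have "smooth_on UNIV (\<lambda>t::real. t *\<^sub>R t ^ i)" by (intro smooth_on_scaleR smooth_on_ident Suc open_UNIV)
    then show ?case by simp
  qed (simp add: smooth_on_const)
  then have "smooth_on UNIV (\<lambda>t::real. \<Sum>i\<le>n. c i *\<^sub>R t ^ i)"
    by (intro smooth_on_sum smooth_on_scaleR smooth_on_const open_UNIV)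
  then show ?thesis by simp
qed

text \<open>The derivatives of admissible polynomials \<open>\<eta>\<close> are the polynomials with mean
  value 0. Thus \<open>m\<close> minus its mean value is orthogonal to all polynomials, hence to
  itself by the Weierstrass theorem.\<close>

lemma du_bois_reymond:
  fixes m :: "real \<Rightarrow> real"
  assumes ab: "a < b" and m: "continuous_on {a..b} m"
    and H: "\<And>\<eta> \<eta>'. smooth_on UNIV \<eta> \<Longrightarrow> (\<And>t. (\<eta> has_real_derivative \<eta>' t) (at t)) \<Longrightarrow> continuous_on UNIV \<eta>' \<Longrightarrow>
       \<eta> a = 0 \<Longrightarrow> \<eta> b = 0 \<Longrightarrow> integral {a..b} (\<lambda>t. \<eta>' t * m t) = 0"
    and t: "t \<in> {a..b}" "t' \<in> {a..b}"
  shows "m t = m t'"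
proof -
  define \<mu> where "\<mu> = integral {a..b} m / (b - a)"
  define n where "n = (\<lambda>t. m t - \<mu>)"
  have mi: "m integrable_on {a..b}" using m by (rule integrable_continuous_real)
  have nc: "continuous_on {a..b} n" unfolding n_def by (intro continuous_intros m)
  have n0: "integral {a..b} n = 0"
    unfolding n_def using ab mi by (subst integral_diff) (auto simp: \<mu>_def)
  have poly0: "integral {a..b} (\<lambda>t. p t * n t) = 0" if "real_polynomial_function p" for p
  proof -
    obtain c N where p: "p = (\<lambda>x. \<Sum>i\<le>N. c i * x ^ i)"
      using \<open>real_polynomial_function p\<close> real_polynomial_function_iff_sum by blast
    define q where "q = (\<lambda>x. \<Sum>i\<le>N. (c i / (i + 1)) * x ^ (i + 1))"
    define k where "k = (q b - q a) / (b - a)"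
    define \<eta> where "\<eta> = (\<lambda>t. q t - q a - k * (t - a))"
    have dq: "(q has_real_derivative p t) (at t)" for t
    proof -
      have "((\<lambda>x. (c i / (i + 1)) * x ^ (i + 1)) has_real_derivative c i * t ^ i) (at t)" for i
        by (rule DERIV_cong[OF DERIV_cmult[OF DERIV_pow]]) (simp add: add_eq_0_iff field_simps)
      then show ?thesis unfolding q_def p by (intro DERIV_sum)
    qed
    have pc: "continuous_on S p" for S unfolding p by (intro continuous_intros)
    have qe: "q = (\<lambda>x. \<Sum>i\<le>Suc N. (if i = 0 then 0 else c (i - 1) / i) * x ^ i)"
      unfolding q_def by (subst sum.atMost_Suc_shift) simp
    have qs: "smooth_on UNIV q" unfolding qe by (rule smooth_on_polynomial)
    have \<eta>s: "smooth_on UNIV \<eta>"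
    proof -
      have "smooth_on UNIV (\<lambda>t. q t + (- q a + (- k) *\<^sub>R (t + (- a))))"
        by (intro smooth_on_add qs smooth_on_const smooth_on_scaleR smooth_on_ident open_UNIV)
      then show ?thesis by (simp add: \<eta>_def algebra_simps)
    qed
    have d\<eta>: "(\<eta> has_real_derivative p t - k) (at t)" for t
      unfolding \<eta>_def by (auto intro!: derivative_eq_intros dq)
    have "integral {a..b} (\<lambda>t. (p t - k) * m t) = 0"
      by (rule H[OF \<eta>s d\<eta>]) (use ab in \<open>auto simp: \<eta>_def k_def intro!: continuous_intros pc\<close>)
    moreover have "integral {a..b} (\<lambda>t. p t - k) = 0"
    proof -
      have "((\<lambda>t. p t - k) has_integral (\<eta> b - \<eta> a)) {a..b}"
        using ab d\<eta> by (intro fundamental_theorem_of_calculus)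
          (auto simp: has_real_derivative_iff_has_vector_derivative[symmetric] intro: has_field_derivative_at_within)
      then show ?thesis using ab by (simp add: integral_unique \<eta>_def k_def)
    qed
    moreover have "(\<lambda>t. (p t - k) * m t) integrable_on {a..b}" "(\<lambda>t. p t - k) integrable_on {a..b}" "n integrable_on {a..b}"
      by (intro integrable_continuous_real continuous_intros m pc nc)+
    ultimately have "((\<lambda>t. (p t - k) * m t) has_integral 0) {a..b}" "((\<lambda>t. p t - k) has_integral 0) {a..b}"
      "(n has_integral 0) {a..b}"
      using n0 by (metis integrable_integral)+
    then have "((\<lambda>t. (p t - k) * m t - \<mu> * (p t - k) + k * n t) has_integral (0 - \<mu> * 0 + k * 0)) {a..b}"
      by (intro has_integral_add has_integral_diff has_integral_mult_right)
    moreover have "(p t - k) * m t - \<mu> * (p t - k) + k * n t = p t * n t" for t by (simp add: n_def algebra_simps)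
    ultimately show ?thesis by (simp add: integral_unique)
  qed
  have ni: "n integrable_on {a..b}" "(\<lambda>t. \<bar>n t\<bar>) integrable_on {a..b}" "(\<lambda>t. n t * n t) integrable_on {a..b}"
    by (intro integrable_continuous_real continuous_intros nc)+
  define I where "I = integral {a..b} (\<lambda>t. \<bar>n t\<bar>)"
  have I: "I \<ge> 0" unfolding I_def by (intro integral_nonneg ni) auto
  have "integral {a..b} (\<lambda>t. n t * n t) \<le> \<epsilon>" if "\<epsilon> > 0" for \<epsilon>
  proof -
    define \<epsilon>' where "\<epsilon>' = \<epsilon> / (I + 1)"
    have \<epsilon>': "\<epsilon>' > 0" "\<epsilon>' * I \<le> \<epsilon>" using that I by (auto simp: \<epsilon>'_def field_simps)
    obtain p where p: "real_polynomial_function p" "\<And>t. t \<in> {a..b} \<Longrightarrow> \<bar>n t - p t\<bar> < \<epsilon>'"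
      using Stone_Weierstrass_real_polynomial_function[OF compact_Icc nc \<epsilon>'(1)] by blast
    have pc: "continuous_on {a..b} p"
      using continuous_on_polymonial_function[of p] p(1) real_polynomial_function_eq by blast
    have "integral {a..b} (\<lambda>t. n t * n t) = integral {a..b} (\<lambda>t. (n t - p t) * n t)"
    proof -
      have "(\<lambda>t. (n t - p t) * n t) integrable_on {a..b}" "(\<lambda>t. p t * n t) integrable_on {a..b}"
        by (intro integrable_continuous_real continuous_intros nc pc)+
      moreover have "n t * n t = (n t - p t) * n t + p t * n t" for t by (simp add: algebra_simps)
      ultimately show ?thesis using poly0[OF p(1)] by (simp add: integral_add)
    qed
    also have "\<dots> \<le> integral {a..b} (\<lambda>t. \<epsilon>' * \<bar>n t\<bar>)"
    proof (rule integral_le)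
      show "(\<lambda>t. (n t - p t) * n t) integrable_on {a..b}" "(\<lambda>t. \<epsilon>' * \<bar>n t\<bar>) integrable_on {a..b}"
        by (intro integrable_continuous_real continuous_intros nc pc)+
      fix t assume "t \<in> {a..b}"
      then have "\<bar>(n t - p t) * n t\<bar> \<le> \<epsilon>' * \<bar>n t\<bar>"
        unfolding abs_mult using p(2)[of t] by (intro mult_right_mono) auto
      then show "(n t - p t) * n t \<le> \<epsilon>' * \<bar>n t\<bar>" by linarith
    qed
    also have "\<dots> = \<epsilon>' * I" by (simp add: I_def)
    finally show ?thesis using \<epsilon>'(2) by linarith
  qed
  then have "integral {a..b} (\<lambda>t. n t * n t) \<le> 0" using field_le_epsilon[of _ "0 :: real"] by simp
  moreover have "integral {a..b} (\<lambda>t. n t * n t) \<ge> 0" by (intro integral_nonneg ni) auto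
  ultimately have "integral {a..b} (\<lambda>t. n t * n t) = 0" by linarith
  moreover have "integral {a..b} (\<lambda>t. n t * n t) = 0 \<longleftrightarrow> (\<forall>t\<in>{a..b}. n t * n t = 0)"
    by (rule integral_eq_0_iff[OF continuous_on_mult[OF nc nc] ab]) auto
  ultimately have "\<forall>t\<in>{a..b}. n t * n t = 0" by simp
  then show ?thesis using t by (auto simp: n_def)
qed

section \<open>Immersions and the Sobolev metric\<close>

lemma tangent_map_id:
  assumes A: "smooth_atlas A" and v: "v \<in> tangent_space A x"
  shows "tangent_map A A id x v = v"
proof -
  obtain c where c: "c \<in> A" "x \<in> cdom c" using atlas_cover[OF A] by blast
  have "tangent_map A A id x v c = v c"
    using tangent_map_at[OF A A smooth_map_id[OF A] v c(1) c(1) c(2)] c tdiff_id_same[OF A c] by simp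
  then show ?thesis
    using tangent_map_in[OF A A smooth_map_id[OF A] v] v by (intro tangent_eqI[OF _ v c]) auto
qed

lemma immersionsD: "f \<in> immersions A B \<Longrightarrow> smooth_map A B f"
  by (simp add: immersions_def)

text \<open>The tangent map of a diffeomorphism has a left inverse, namely the tangent map of the inverse.\<close>

lemma immersion_diffeo:
  assumes A: "smooth_atlas A" and B: "smooth_atlas B" and f: "f \<in> immersions A B" and \<phi>: "\<phi> \<in> diffeos A"
  shows "f \<circ> \<phi> \<in> immersions A B"
proof -
  note fs = immersionsD[OF f] and \<phi>s = diffeosD(2)[OF \<phi>] and ps = diffeosD(3)[OF \<phi>]
  have fp: "smooth_map A B (f \<circ> \<phi>)" by (rule smooth_map_comp[OF A A B \<phi>s fs])
  have "inj_on (tangent_map A B (f \<circ> \<phi>) x) (tangent_space A x)" for x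
  proof (rule inj_onI)
    fix v w assume v: "v \<in> tangent_space A x" and w: "w \<in> tangent_space A x"
      and eq: "tangent_map A B (f \<circ> \<phi>) x v = tangent_map A B (f \<circ> \<phi>) x w"
    have "tangent_map A B f (\<phi> x) (tangent_map A A \<phi> x v) = tangent_map A B f (\<phi> x) (tangent_map A A \<phi> x w)"
      using eq tangent_map_comp[OF A A B \<phi>s fs fp v] tangent_map_comp[OF A A B \<phi>s fs fp w] by simp
    moreover have "inj_on (tangent_map A B f (\<phi> x)) (tangent_space A (\<phi> x))"
      using f by (simp add: immersions_def)
    ultimately have e: "tangent_map A A \<phi> x v = tangent_map A A \<phi> x w"
      using tangent_map_in[OF A A \<phi>s v] tangent_map_in[OF A A \<phi>s w] by (meson inj_onD)
    have ii: "inv \<phi> \<circ> \<phi> = id" using diffeosD(1)[OF \<phi>] by (simp add: bij_is_inj)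
    have "tangent_map A A (inv \<phi> \<circ> \<phi>) x u = tangent_map A A (inv \<phi>) (\<phi> x) (tangent_map A A \<phi> x u)"
      if "u \<in> tangent_space A x" for u
      by (rule tangent_map_comp[OF A A A \<phi>s ps _ that]) (simp add: ii smooth_map_id[OF A])
    then show "v = w" using e v w tangent_map_id[OF A] by (simp add: ii) metis
  qed
  then show ?thesis using fp by (simp add: immersions_def)
qed

locale sobolev_manifold =
  fixes A :: "('m::{t2_space,second_countable_topology}, 'k::finite) chart set"
    and B :: "('n::{t2_space,second_countable_topology}, 'l::finite) chart set"
    and gb :: "('n, 'l) metric"
    and P :: "('m, 'n, 'l) operator_field"
  assumes A: "smooth_atlas A" and M: "compact (UNIV :: 'm set)"
    and B: "smooth_atlas B" and gb: "riemannian_metric B gb"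
    and P: "sobolev_operator A B gb P"
begin

lemma P_op: "smooth_operator_field A B P" using P by (simp add: sobolev_operator_def)

lemma
  assumes "f \<in> immersions A B"
  shows P_sym: "h \<in> sections_along A B f \<Longrightarrow> k \<in> sections_along A B f \<Longrightarrow> H0 A B gb f (P f h) k = H0 A B gb f h (P f k)"
    and P_pos: "h \<in> sections_along A B f \<Longrightarrow> h \<noteq> (\<lambda>_ _. 0) \<Longrightarrow> H0 A B gb f (P f h) h > 0"
    and P_inv: "\<phi> \<in> diffeos A \<Longrightarrow> h \<in> sections_along A B f \<Longrightarrow> P f h \<circ> \<phi> = P (f \<circ> \<phi>) (h \<circ> \<phi>)"
    and P_in: "h \<in> sections_along A B f \<Longrightarrow> P f h \<in> sections_along A B f"
    and P_lin: "h \<in> sections_along A B f \<Longrightarrow> k \<in> sections_along A B f \<Longrightarrow>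
      P f (\<lambda>x. lincomb a (h x) b (k x)) = (\<lambda>x. lincomb a (P f h x) b (P f k x))"
  using assms P P_op unfolding sobolev_operator_def smooth_operator_field_def linear_on_sections_def by blast+

abbreviation "S f \<equiv> sections_along A B f"
abbreviation "G \<equiv> sobolev_metric A B gb P"
abbreviation "H \<equiv> H0 A B gb"

lemma G_nonneg:
  assumes f: "f \<in> immersions A B" and h: "h \<in> S f"
  shows "G f h h \<ge> 0"
proof (cases "h = (\<lambda>_ _. 0)")
  case True
  have "H0 A B gb f (P f h) (\<lambda>_ _. 0) = 0"
    using H0_lincomb[OF A M B gb immersionsD[OF f] h h P_in[OF f h], of 0 0]
      H0_sym[OF gb P_in[OF f h] h] by (simp add: lincomb_def True)
  then show ?thesis by (simp add: sobolev_metric_def True)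
next
  case False
  then show ?thesis using P_pos[OF f h] by (simp add: sobolev_metric_def)
qed

lemma G_invariant:
  assumes f: "f \<in> immersions A B" and \<phi>: "\<phi> \<in> diffeos A" and h: "h \<in> S f" and k: "k \<in> S f"
  shows "G (f \<circ> \<phi>) (h \<circ> \<phi>) (k \<circ> \<phi>) = G f h k"
  using H0_diffeo[OF A M B gb immersionsD[OF f] \<phi> P_in[OF f h] k] P_inv[OF f \<phi> h]
  by (simp add: sobolev_metric_def)

text \<open>The difference of the two sides is \<open>r\<^sup>2 * G f w w\<close>, which is not negative.\<close>

lemma G_tangent_bound:
  assumes f: "f \<in> immersions A B" and u: "u \<in> S f" and w: "w \<in> S f"
  shows "G f u u + 2 * r * H f (P f u) w \<le> G f (\<lambda>x. lincomb 1 (u x) r (w x)) (\<lambda>x. lincomb 1 (u x) r (w x))"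
proof -
  let ?z = "\<lambda>x. lincomb 1 (u x) r (w x)"
  note fs = immersionsD[OF f] and Pu = P_in[OF f u] and Pw = P_in[OF f w]
  have z: "?z \<in> S f" by (rule section_lincomb[OF A B fs u w])
  have right: "H f q ?z = H f q u + r * H f q w" if q: "q \<in> S f" for q
    using H0_lincomb[OF A M B gb fs u w q, of 1 r] H0_sym[OF gb q z] H0_sym[OF gb q u] H0_sym[OF gb q w] by simp
  have "G f ?z ?z = H f (P f u) ?z + r * H f (P f w) ?z"
    using H0_lincomb[OF A M B gb fs Pu Pw z, of 1 r] by (simp add: sobolev_metric_def P_lin[OF f u w])
  also have "\<dots> = H f (P f u) u + r * H f (P f u) w + r * (H f (P f w) u + r * H f (P f w) w)"
    by (simp add: right[OF Pu] right[OF Pw])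
  also have "H f (P f w) u = H f (P f u) w"
    using P_sym[OF f w u] H0_sym[OF gb w Pu] by simp
  finally have "G f ?z ?z = G f u u + 2 * r * H f (P f u) w + r\<^sup>2 * G f w w"
    by (simp add: sobolev_metric_def algebra_simps power2_eq_square)
  moreover have "r\<^sup>2 * G f w w \<ge> 0" using G_nonneg[OF f w] by simp
  ultimately show ?thesis by linarith
qed

lemma path_families:
  assumes F: "imm_path A B a b F" and \<tau>: "smooth_on UNIV \<tau>" "\<And>s. \<tau> s \<in> {a..b}"
  shows "smooth_family A B UNIV (\<lambda>s::real. F (\<tau> s))"
    and "smooth_section_family A B UNIV (\<lambda>s::real. F (\<tau> s)) (\<lambda>s. velocity B F (\<tau> s))"
    and "smooth_section_family A B UNIV (\<lambda>s::real. F (\<tau> s)) (\<lambda>s. P (F (\<tau> s)) (velocity B F (\<tau> s)))"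
proof -
  obtain e where e: "e > 0" "smooth_family A B {a-e<..<b+e} F"
    and imm: "\<And>t. t \<in> {a..b} \<Longrightarrow> F t \<in> immersions A B"
    using F by (auto simp: imm_path_def)
  have \<tau>': "\<tau> s \<in> {a-e<..<b+e}" for s using \<tau>(2)[of s] e(1) by auto
  show 1: "smooth_family A B UNIV (\<lambda>s. F (\<tau> s))"
    by (rule family_reparam[OF A B e(2) open_greaterThanLessThan open_UNIV \<tau>(1) \<tau>'])
  show 2: "smooth_section_family A B UNIV (\<lambda>s. F (\<tau> s)) (\<lambda>s. velocity B F (\<tau> s))"
    by (rule section_reparam[OF A B e(2) velocity_family[OF A B e(2)] open_greaterThanLessThan open_UNIV \<tau>(1) \<tau>']) simp
  have "imm_curve A B (\<lambda>s. F (\<tau> s))" using 1 imm \<tau>(2) by (simp add: imm_curve_def)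
  then show "smooth_section_family A B UNIV (\<lambda>s. F (\<tau> s)) (\<lambda>s. P (F (\<tau> s)) (velocity B F (\<tau> s)))"
    using 2 P_op unfolding smooth_operator_field_def by blast
qed

lemma velocity_section:
  assumes F: "imm_path A B a b F" and t: "t \<in> {a..b}"
  shows "velocity B F t \<in> S (F t)"
proof -
  obtain e where e: "e > 0" "smooth_family A B {a-e<..<b+e} F"
    using F by (auto simp: imm_path_def)
  show ?thesis
    by (rule section_slice[OF A B e(2) _ velocity_family[OF A B e(2)]]) (use t e in auto)
qed

lemma energy_density_continuous:
  assumes ab: "a < b" and F: "imm_path A B a b F"
  shows "continuous_on {a..b} (\<lambda>t. G (F t) (velocity B F t) (velocity B F t))"
proof -
  obtain \<tau> \<sigma> :: "real \<Rightarrow> real" where \<tau>: "smooth_on UNIV \<tau>" "\<And>s. \<tau> s \<in> {a..b}" and \<sigma>: "continuous_on {a..b} \<sigma>" "\<And>t. t \<in> {a..b} \<Longrightarrow> \<tau> (\<sigma> t) = t"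
    using time_reparam[OF ab] by blast
  note fam = path_families[OF F \<tau>]
  have "continuous_on UNIV (\<lambda>s. H (F (\<tau> s)) (P (F (\<tau> s)) (velocity B F (\<tau> s))) (velocity B F (\<tau> s)))"
    by (rule H0_continuous[OF A M B gb fam(1) open_UNIV fam(3,2)])
  then have "continuous_on {a..b} (\<lambda>t. H (F (\<tau> (\<sigma> t))) (P (F (\<tau> (\<sigma> t))) (velocity B F (\<tau> (\<sigma> t)))) (velocity B F (\<tau> (\<sigma> t))))"
    by (rule continuous_on_compose2[OF _ \<sigma>(1)]) simp
  then show ?thesis
    by (rule continuous_on_eq) (simp add: \<sigma>(2) sobolev_metric_def)
qed

text \<open>The coefficient of $g((P F_t)^\top)\,vol(g)$ in the chart \<open>c\<close> for the direction
  \<open>e\<close>.\<close>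

definition pmom :: "(real \<Rightarrow> 'm \<Rightarrow> 'n) \<Rightarrow> ('m, 'k) chart \<Rightarrow> real^'k \<Rightarrow> real \<Rightarrow> real^'k \<Rightarrow> real" where
  "pmom F c e t y = gb (F t (cinv c y)) (P (F t) (velocity B F t) (cinv c y))
      (tangent_map A B (F t) (cinv c y) (coord_vec A c (cinv c y) e))
    * vol A (pullback_metric A B gb (F t)) (cinv c y) c"

lemma pmom_continuous:
  assumes ab: "a < b" and F: "imm_path A B a b F" and c: "c \<in> A"
  shows "continuous_on ({a..b} \<times> cimg c) (\<lambda>(t, y). pmom F c e t y)"
proof -
  obtain \<tau> \<sigma> :: "real \<Rightarrow> real" where \<tau>: "smooth_on UNIV \<tau>" "\<And>s. \<tau> s \<in> {a..b}" and \<sigma>: "continuous_on {a..b} \<sigma>" "\<And>t. t \<in> {a..b} \<Longrightarrow> \<tau> (\<sigma> t) = t"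
    using time_reparam[OF ab] by blast
  note fam = path_families[OF F \<tau>]
  have o: "open ((UNIV :: real set) \<times> cimg c)" by (intro open_Times open_UNIV atlas_open_img[OF A c])
  have "continuous_on (UNIV \<times> cimg c) (\<lambda>q. gb ((\<lambda>(p, y). F (\<tau> p) (cinv c y)) q)
       ((\<lambda>(p, y). P (F (\<tau> p)) (velocity B F (\<tau> p)) (cinv c y)) q)
       ((\<lambda>(p, y). tangent_map A B (F (\<tau> p)) (cinv c y) (coord_vec A c (cinv c y) e)) q)
     * (\<lambda>(p, y). vol A (pullback_metric A B gb (F (\<tau> p))) (cinv c y) c) q)"
    by (intro continuous_on_mult gb_continuous[OF gb B o] section_cont_along[OF A fam(1,3) c]
        coord_cont_along[OF A B fam(1) c] vol_continuous[OF A B gb fam(1) open_UNIV c])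
  then have c1: "continuous_on (UNIV \<times> cimg c) (\<lambda>q. pmom F c e (\<tau> (fst q)) (snd q))"
    by (simp add: pmom_def case_prod_beta')
  have c2: "continuous_on ({a..b} \<times> cimg c) (\<lambda>q. (\<sigma> (fst q), snd q))"
    by (intro continuous_intros continuous_on_compose2[OF \<sigma>(1)]) auto
  have "continuous_on ({a..b} \<times> cimg c) (\<lambda>q. pmom F c e (\<tau> (\<sigma> (fst q))) (snd q))"
  proof -
    have "(\<lambda>q. (\<sigma> (fst q), snd q)) ` ({a..b} \<times> cimg c) \<subseteq> UNIV \<times> cimg c"
      by (intro image_subsetI) (simp only: mem_Times_iff fst_conv snd_conv UNIV_I simp_thms)
    then show ?thesis using continuous_on_compose2[OF c1 c2] by simp
  qed
  then show ?thesis by (rule continuous_on_eq) (auto simp: \<sigma>(2))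
qed

text \<open>The vector field is supported in the chart \<open>c\<close>, so the pairing is an integral in
  the coordinates of \<open>c\<close> alone.\<close>

lemma pmom_pairing:
  assumes F: "imm_path A B a b F" and t: "t \<in> {a..b}" and c: "c \<in> A" and K: "compact K" "K \<subseteq> cimg c"
    and u: "smooth_on UNIV u" "\<And>y. y \<notin> K \<Longrightarrow> u y = 0"
  shows "(\<lambda>x. tangent_map A B (F t) x (chart_field A c (\<lambda>y. u y *\<^sub>R e) x)) \<in> S (F t)"
    and "H (F t) (P (F t) (velocity B F t)) (\<lambda>x. tangent_map A B (F t) x (chart_field A c (\<lambda>y. u y *\<^sub>R e) x))
      = (LINT y:K|lborel. u y * pmom F c e t y)"
proof -
  let ?X = "chart_field A c (\<lambda>y. u y *\<^sub>R e)" and ?T = "tangent_map A B (F t)"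
  let ?q = "P (F t) (velocity B F t)"
  have imm: "F t \<in> immersions A B" using F t by (simp add: imm_path_def)
  note fs = immersionsD[OF imm]
  have X: "?X \<in> vector_fields A"
    by (rule chart_field_vector_field[OF A c K]) (auto intro!: smooth_on_scaleR u smooth_on_const)
  have fam: "smooth_family A B (UNIV::real set) (\<lambda>_. F t)" by (rule smooth_map_const_family[OF A B fs open_UNIV])
  show sec: "(\<lambda>x. ?T x (?X x)) \<in> S (F t)"
    using section_slice[OF A B fam UNIV_I tangent_family[OF A B fam open_UNIV X]] by simp
  have q: "?q \<in> S (F t)" by (rule P_in[OF imm velocity_section[OF F t]])
  have qT: "?q x \<in> tangent_space B (F t x)" for x using q by (simp add: sections_along_def)
  have Tx: "?T x (coord_vec A c x w) \<in> tangent_space B (F t x)" if "x \<in> cdom c" for x w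
    by (rule tangent_map_in[OF A B fs coord_vec_in[OF A c that]])
  have scale: "gb (F t x) (?q x) (?T x (coord_vec A c x (r *\<^sub>R e))) = r * gb (F t x) (?q x) (?T x (coord_vec A c x e))"
    if "x \<in> cdom c" for x r
  proof -
    note cv = coord_vec_in[OF A c that]
    have "coord_vec A c x (r *\<^sub>R e) = lincomb r (coord_vec A c x e) 0 (coord_vec A c x e)"
      using coord_vec_lincomb[OF A c that, of r e 0 e] by simp
    then have "?T x (coord_vec A c x (r *\<^sub>R e)) = lincomb r (?T x (coord_vec A c x e)) 0 (?T x (coord_vec A c x e))"
      using tangent_map_lincomb[OF A B fs cv cv] by simp
    then show ?thesis using gb_lincomb_right[OF gb B Tx[OF that] Tx[OF that] qT, of r e 0 e] by simp
  qed
  define KM where "KM = cinv c ` K"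
  note KM = chart_compact[OF A c K, folded KM_def]
  have zero: "h0_dens A B gb (F t) ?q (\<lambda>x. ?T x (?X x)) x c' = 0" if "x \<notin> KM" for x c'
  proof -
    have "gb (F t x) (?q x) (?T x (?X x)) = 0"
    proof (cases "x \<in> cdom c")
      case True
      then have "cmap c x \<notin> K" by (rule KM(4)[OF _ that])
      then show ?thesis using scale[OF True, of 0] True u(2) by (simp add: chart_field_def)
    next
      case False
      have "(\<lambda>_. 0) = lincomb 0 (\<lambda>_. 0) 0 ((\<lambda>_. 0) :: ('m, 'k) tvec)" by (simp add: lincomb_def)
      then have "?T x (\<lambda>_. 0) = lincomb 0 (?T x (\<lambda>_. 0)) 0 (?T x (\<lambda>_. 0))"
        using tangent_map_lincomb[OF A B fs zero_in[OF A] zero_in[OF A], of x 0 0] by simp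
      then have "gb (F t x) (?q x) (?T x (\<lambda>_. 0)) = 0"
        using gb_lincomb_right[OF gb B tangent_map_in[OF A B fs zero_in[OF A]] tangent_map_in[OF A B fs zero_in[OF A]] qT, of x 0 0]
        by simp
      then show ?thesis using False by (simp add: chart_field_def)
    qed
    then show ?thesis by (simp add: h0_dens_def)
  qed
  have "H (F t) ?q (\<lambda>x. ?T x (?X x)) = (LINT y:cmap c ` KM|lborel. h0_dens A B gb (F t) ?q (\<lambda>x. ?T x (?X x)) (cinv c y) c)"
    unfolding H0_eq by (rule density_integral_chart[OF A M h0_dens_id[OF A B gb fs] h0_dens_cont[OF A B gb fs q sec] c KM(1,2) zero])
  also have "\<dots> = (LINT y:K|lborel. u y * pmom F c e t y)"
    unfolding KM(3)
  proof (rule set_lebesgue_integral_cong)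
    show "K \<in> sets lborel" using K(1) by (simp add: borel_compact)
    show "\<forall>y. y \<in> K \<longrightarrow> h0_dens A B gb (F t) ?q (\<lambda>x. ?T x (?X x)) (cinv c y) c = u y * pmom F c e t y"
      using scale[OF cinv_in] K(2) by (auto simp: h0_dens_def pmom_def chart_field_def cinv_in cmap_cinv subset_iff)
  qed
  finally show "H (F t) ?q (\<lambda>x. ?T x (?X x)) = (LINT y:K|lborel. u y * pmom F c e t y)" .
qed

end

section \<open>Noether's argument\<close>

locale sobolev_geodesic = sobolev_manifold A B gb P
  for A :: "('m::{t2_space,second_countable_topology}, 'k::finite) chart set"
    and B :: "('n::{t2_space,second_countable_topology}, 'l::finite) chart set"
    and gb :: "('n, 'l) metric"
    and P :: "('m, 'n, 'l) operator_field" +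
  fixes f :: "real \<Rightarrow> 'm \<Rightarrow> 'n" and a b :: real
  assumes ab: "a < b" and geo: "geodesic A B gb P a b f"
begin

lemma path: "imm_path A B a b f" using geo by (simp add: geodesic_def)

lemma imm: "t \<in> {a..b} \<Longrightarrow> f t \<in> immersions A B" using path by (simp add: imm_path_def)

abbreviation "v t \<equiv> velocity B f t"
abbreviation "Q t \<equiv> P (f t) (v t)"
abbreviation "pm \<equiv> pmom f"

lemma smeared_integrable:
  assumes c: "c \<in> A" and K: "compact K" "K \<subseteq> cimg c" and t: "t \<in> {a..b}" and w: "continuous_on K w"
  shows "set_integrable lborel K (\<lambda>y. w y * pm c e t y)"
proof -
  have "continuous_on (cimg c) (pm c e t)"
    by (rule continuous_on_slice[OF pmom_continuous[OF ab path c] t])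
  then have "continuous_on K (\<lambda>y. w y * pm c e t y)"
    using continuous_on_subset[OF _ K(2)] by (intro continuous_on_mult w) auto
  then show ?thesis
    unfolding set_integrable_def by (rule borel_integrable_compact[OF K(1)])
qed

lemma smeared_continuous:
  assumes c: "c \<in> A" and K: "compact K" "K \<subseteq> cimg c" and w: "continuous_on UNIV w"
  shows "continuous_on {a..b} (\<lambda>t. LINT y:K|lborel. w y * pm c e t y)"
proof -
  let ?\<mu> = "\<lambda>t x c'. w (cmap c x) * pm c e t (cmap c x)"
  define KM where "KM = cinv c ` K"
  note KM = chart_compact[OF A c K, folded KM_def]
  have "continuous_on ({a..b} \<times> cimg c) (\<lambda>q. w (snd q) * (\<lambda>(t, y). pm c e t y) q)"
    by (intro continuous_on_mult pmom_continuous[OF ab path c] continuous_on_compose2[OF w])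
      (auto intro!: continuous_intros)
  then have 1: "continuous_on ({a..b} \<times> cimg c) (\<lambda>(t, y). ?\<mu> t (cinv c y) c)"
    by (rule continuous_on_eq) (auto simp: cmap_cinv)
  have "continuous_on {a..b} (\<lambda>t. LINT y:cmap c ` KM|lborel. ?\<mu> t (cinv c y) c)"
    by (rule LINT_param_continuous[where \<mu>="?\<mu>", OF A c 1 KM(1,2) borel_compact[OF KM(1)] order_refl])
  then show ?thesis
  proof (rule continuous_on_eq)
    fix t
    show "(LINT y:cmap c ` KM|lborel. ?\<mu> t (cinv c y) c) = (LINT y:K|lborel. w y * pm c e t y)"
      unfolding KM(3) using K by (intro set_lebesgue_integral_cong) (auto simp: borel_compact cmap_cinv subset_iff)
  qed
qed

text \<open>The core of Noether's argument. The estimate \<open>lower\<close> compares the energy density of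
  the varied path with that of the geodesic; integrated over time it says that the energy of the
  variation minus its expected linear part, plus a multiple of \<open>s\<^sup>2\<close>, has a
  minimum at \<open>s = 0\<close>.\<close>

lemma smeared_momentum_stationary:
  assumes c: "c \<in> A" and \<delta>: "\<delta> > 0" and K: "cball y0 \<delta> \<subseteq> cimg c"
    and \<eta>: "smooth_on UNIV \<eta>" "\<And>t. (\<eta> has_real_derivative \<eta>' t) (at t)" "continuous_on UNIV \<eta>'" "\<eta> a = 0" "\<eta> b = 0"
  shows "integral {a..b} (\<lambda>t. \<eta>' t * (LINT y:cball y0 \<delta>|lborel. bump y0 \<delta> y * pm c e t y)) = 0"
proof -
  let ?K = "cball y0 \<delta>" and ?\<omega> = "bump y0 \<delta>"
  define m where "m = (\<lambda>t. LINT y:?K|lborel. ?\<omega> y * pm c e t y)"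
  have \<omega>c: "continuous_on UNIV ?\<omega>" by (rule smooth_on_imp_continuous[OF smooth_bump])
  have mc: "continuous_on {a..b} m" unfolding m_def by (rule smeared_continuous[OF c compact_cball K \<omega>c])
  have out: "?\<omega> y = 0" if "y \<notin> ?K" for y
    using that \<delta> by (intro bump_outside) (auto simp: dist_norm norm_minus_commute)
  obtain \<epsilon> C \<phi> \<psi> where push: "chart_push A c y0 \<delta> e \<epsilon> C \<phi> \<psi>"
    using chart_push_exists[OF A c \<delta> K] by blast
  then have \<epsilon>: "\<epsilon> > 0" and C: "C \<ge> 0" and fam: "smooth_family A A {-\<epsilon><..<\<epsilon>} \<phi>" and \<phi>0: "\<phi> 0 = id"
    unfolding chart_push_def by blast+
  have dif: "\<phi> \<sigma> \<in> diffeos A" and \<psi>s: "smooth_on UNIV (\<psi> \<sigma>)"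
    and \<psi>o: "y \<notin> ?K \<Longrightarrow> \<psi> \<sigma> y = y" and \<psi>c: "\<bar>?\<omega> (\<psi> \<sigma> y) - ?\<omega> y\<bar> \<le> C * \<bar>\<sigma>\<bar>"
    and vel: "velocity A \<phi> \<sigma> x = chart_field A c (\<lambda>y. ?\<omega> (\<psi> \<sigma> y) *\<^sub>R e) (\<phi> \<sigma> x)"
    if "\<bar>\<sigma>\<bar> < \<epsilon>" for \<sigma> y x
    using push that unfolding chart_push_def by blast+
  obtain e0 where e0: "e0 > 0" "smooth_family A B {a-e0<..<b+e0} f"
    using path by (auto simp: imm_path_def)
  have "continuous_on {a-e0..b+e0} \<eta>"
    by (rule continuous_on_subset[OF smooth_on_imp_continuous[OF \<eta>(1)]]) simp
  then have "bounded (\<eta> ` {a-e0..b+e0})" by (intro compact_imp_bounded compact_continuous_image) auto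
  then obtain R where "\<forall>r\<in>\<eta> ` {a-e0..b+e0}. norm r \<le> R" unfolding bounded_iff by blast
  then have R: "\<bar>\<eta> t\<bar> \<le> R" if "t \<in> {a-e0..b+e0}" for t using that by fastforce
  have "bounded (\<eta>' ` {a..b})"
    using continuous_on_subset[OF \<eta>(3)] by (intro compact_imp_bounded compact_continuous_image) auto
  then obtain R' where "\<forall>r\<in>\<eta>' ` {a..b}. norm r \<le> R'" unfolding bounded_iff by blast
  then have R': "\<bar>\<eta>' t\<bar> \<le> R'" if "t \<in> {a..b}" for t using that by fastforce
  have R0: "R \<ge> 0" "R' \<ge> 0" using R[of a] R'[of a] ab e0 by auto
  have "bounded ((\<lambda>(t, y). pm c e t y) ` ({a..b} \<times> ?K))"
    using K by (intro compact_imp_bounded compact_continuous_image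
        continuous_on_subset[OF pmom_continuous[OF ab path c]] compact_Times) auto
  then obtain D where "\<forall>r\<in>(\<lambda>(t, y). pm c e t y) ` ({a..b} \<times> ?K). norm r \<le> D" unfolding bounded_iff by blast
  then have D: "\<bar>pm c e t y\<bar> \<le> D" if "t \<in> {a..b}" "y \<in> ?K" for t y using that by fastforce
  have D0: "D \<ge> 0" using D[of a y0] ab \<delta> by auto
  define V where "V = (LINT y:?K|lborel. (1::real))"
  have V: "V \<ge> 0" unfolding V_def set_lebesgue_integral_def by (intro Bochner_Integration.integral_nonneg) auto
  \<comment> \<open>The choice keeps the group parameter \<open>s * \<eta> t\<close> where \<open>\<phi>\<close> is defined; \<open>R\<close> may be 0, hence \<open>R + 1\<close>.\<close>
  define e1 where "e1 = min e0 (\<epsilon> / (R + 1))"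
  have e1: "e1 > 0" "e1 \<le> e0" using e0 \<epsilon> R0 by (auto simp: e1_def)
  have small: "\<bar>s * \<eta> t\<bar> < \<epsilon>" if "\<bar>s\<bar> < e1" "t \<in> {a-e1<..<b+e1}" for s t
  proof -
    have "\<bar>s * \<eta> t\<bar> \<le> \<bar>s\<bar> * R"
      unfolding abs_mult using R[of t] that e1 by (intro mult_left_mono) auto
    also have "\<dots> \<le> \<bar>s\<bar> * (R + 1)" using R0 by (intro mult_left_mono) auto
    also have "\<dots> < e1 * (R + 1)" using that R0 by (intro mult_strict_right_mono) auto
    also have "\<dots> \<le> \<epsilon> / (R + 1) * (R + 1)" using R0 by (intro mult_right_mono) (auto simp: e1_def)
    also have "\<dots> = \<epsilon>" using R0 by simp
    finally show ?thesis .
  qed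
  define F where "F = (\<lambda>s t. f t \<circ> \<phi> (s * \<eta> t))"
  have F0: "F 0 = f" by (simp add: F_def \<phi>0 fun_eq_iff)
  have Fend: "F s a = f a" "F s b = f b" for s by (simp_all add: F_def \<eta> \<phi>0)
  have tin: "t \<in> {a-e1<..<b+e1}" if "t \<in> {a..b}" for t using that e1 by auto
  have Fimm: "F s t \<in> immersions A B" if "\<bar>s\<bar> < e1" "t \<in> {a..b}" for s t
    unfolding F_def by (rule immersion_diffeo[OF A B imm[OF that(2)] dif[OF small[OF that(1) tin[OF that(2)]]]])
  have Ffam: "smooth_family A B ({-e1<..<e1} \<times> {a-e1<..<b+e1}) (\<lambda>(s, t). F s t)"
  proof -
    let ?W = "{-e1<..<e1} \<times> {a-e1<..<b+e1}"
    have W: "open ?W" by (intro open_Times) auto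
    have "smooth_on ?W (\<lambda>r. \<eta> (snd r))"
      by (rule smooth_on_compose[OF W smooth_on_bounded_linear[OF bounded_linear_snd W] \<eta>(1)]) simp
    then have be: "smooth_on ?W (\<lambda>r. fst r *\<^sub>R \<eta> (snd r))"
      by (intro smooth_on_scaleR[OF W] smooth_on_bounded_linear[OF bounded_linear_fst W])
    have "smooth_family A B ?W (\<lambda>r. f (snd r) \<circ> \<phi> (fst r *\<^sub>R \<eta> (snd r)))"
    proof (rule family_comp[OF A A B fam e0(2) open_greaterThanLessThan open_greaterThanLessThan W
          smooth_on_bounded_linear[OF bounded_linear_snd W] _ be])
      fix r assume r: "r \<in> ?W"
      show "snd r \<in> {a-e0<..<b+e0}" using r e1 by auto
      show "fst r *\<^sub>R \<eta> (snd r) \<in> {-\<epsilon><..<\<epsilon>}"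
        using small[of "fst r" "snd r"] r by (auto simp: abs_less_iff)
    qed
    then show ?thesis by (simp add: F_def case_prod_beta')
  qed
  have var: "variation A B a b f F"
    unfolding variation_def
  proof (intro conjI exI[of _ e1] ballI)
    show "F 0 t = f t" for t by (simp add: F0)
  qed (use e1 Ffam Fimm Fend in \<open>auto simp: abs_less_iff\<close>)
  have Fpath: "imm_path A B a b (F s)" if s: "\<bar>s\<bar> < e1" for s
  proof -
    have "smooth_family A B {a-e1<..<b+e1} (\<lambda>t. (\<lambda>(s, t). F s t) (s, t))"
      by (rule family_reparam[OF A B Ffam]) (use s in \<open>auto intro!: open_Times smooth_on_Pair smooth_on_const smooth_on_ident\<close>)
    then show ?thesis using e1 Fimm[OF s] by (auto simp: imm_path_def)
  qed
  \<comment> \<open>\<open>J \<sigma> t\<close> is the momentum at time \<open>t\<close> paired with $Y_\sigma$, so that \<open>m = J 0\<close>.\<close>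
  define J where "J = (\<lambda>\<sigma> t. LINT y:?K|lborel. ?\<omega> (\<psi> \<sigma> y) * pm c e t y)"
  have Jm: "\<bar>J \<sigma> t - m t\<bar> \<le> C * \<bar>\<sigma>\<bar> * D * V" if \<sigma>: "\<bar>\<sigma>\<bar> < \<epsilon>" and t: "t \<in> {a..b}" for \<sigma> t
  proof -
    have c1: "continuous_on ?K (\<lambda>y. ?\<omega> (\<psi> \<sigma> y))"
      using continuous_on_compose2[OF \<omega>c smooth_on_imp_continuous[OF \<psi>s[OF \<sigma>]]] continuous_on_subset by blast
    have c2: "continuous_on ?K ?\<omega>" by (rule continuous_on_subset[OF \<omega>c]) simp
    note i1 = smeared_integrable[OF c compact_cball K t c1] and i2 = smeared_integrable[OF c compact_cball K t c2]
    have i3: "set_integrable lborel ?K (\<lambda>y. ?\<omega> (\<psi> \<sigma> y) * pm c e t y - ?\<omega> y * pm c e t y)"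
      by (rule set_integral_diff(1)[OF i1 i2])
    have i4: "set_integrable lborel ?K (\<lambda>y. C * \<bar>\<sigma>\<bar> * D)"
      unfolding set_integrable_def by (rule borel_integrable_compact[OF compact_cball continuous_on_const])
    have "\<bar>J \<sigma> t - m t\<bar> = norm (LINT y:?K|lborel. ?\<omega> (\<psi> \<sigma> y) * pm c e t y - ?\<omega> y * pm c e t y)"
      unfolding J_def m_def set_integral_diff(2)[OF i1 i2] by simp
    also have "\<dots> \<le> (LINT y:?K|lborel. norm (?\<omega> (\<psi> \<sigma> y) * pm c e t y - ?\<omega> y * pm c e t y))"
      by (rule set_integral_norm_bound[OF i3])
    also have "\<dots> \<le> (LINT y:?K|lborel. C * \<bar>\<sigma>\<bar> * D)"
    proof (rule set_integral_mono[OF set_integrable_norm[OF i3] i4])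
      fix y assume y: "y \<in> ?K"
      have "norm (?\<omega> (\<psi> \<sigma> y) * pm c e t y - ?\<omega> y * pm c e t y) = \<bar>?\<omega> (\<psi> \<sigma> y) - ?\<omega> y\<bar> * \<bar>pm c e t y\<bar>"
        by (simp add: left_diff_distrib[symmetric] abs_mult)
      also have "\<dots> \<le> (C * \<bar>\<sigma>\<bar>) * D"
        using C by (intro mult_mono \<psi>c[OF \<sigma>] D[OF t y]) auto
      finally show "norm (?\<omega> (\<psi> \<sigma> y) * pm c e t y - ?\<omega> y * pm c e t y) \<le> C * \<bar>\<sigma>\<bar> * D" .
    qed
    also have "\<dots> = C * \<bar>\<sigma>\<bar> * D * V"
      using set_integral_mult_right[of lborel ?K "C * \<bar>\<sigma>\<bar> * D" "\<lambda>_. 1"] by (simp add: V_def)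
    finally show ?thesis .
  qed
  define k where "k = R' * (C * R * D * V)"
  define g where "g = (\<lambda>s t. G (F s t) (velocity B (F s) t) (velocity B (F s) t))"
  have lower: "g 0 t + 2 * s * (\<eta>' t * m t) - 2 * s\<^sup>2 * k \<le> g s t" if s: "\<bar>s\<bar> < e1" and t: "t \<in> {a..b}" for s t
  proof -
    define \<sigma> where "\<sigma> = s * \<eta> t"
    have \<sigma>: "\<bar>\<sigma>\<bar> < \<epsilon>" unfolding \<sigma>_def by (rule small[OF s tin[OF t]])
    let ?Y = "chart_field A c (\<lambda>y. ?\<omega> (\<psi> \<sigma> y) *\<^sub>R e)"
    let ?TY = "\<lambda>x. tangent_map A B (f t) x (?Y x)"
    let ?w = "\<lambda>x. lincomb 1 (v t x) (s * \<eta>' t) (?TY x)"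
    have us: "smooth_on UNIV (\<lambda>y. ?\<omega> (\<psi> \<sigma> y))"
      by (rule smooth_on_compose[OF open_UNIV \<psi>s[OF \<sigma>] smooth_bump]) simp
    have uo: "?\<omega> (\<psi> \<sigma> y) = 0" if "y \<notin> ?K" for y using \<psi>o[OF \<sigma> that] out[OF that] by simp
    note pair = pmom_pairing[OF path t c compact_cball K us uo]
    have vS: "v t \<in> S (f t)" by (rule velocity_section[OF path t])
    have wS: "?w \<in> S (f t)" by (rule section_lincomb[OF A B immersionsD[OF imm[OF t]] vS pair(1)])
    have "velocity B (F s) t = ?w \<circ> \<phi> \<sigma>"
    proof
      fix x
      have th: "((\<lambda>t. s * \<eta> t) has_real_derivative s * \<eta>' t) (at t)"
        using \<eta>(2) by (auto intro!: derivative_eq_intros)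
      have "velocity B (\<lambda>t. f t \<circ> \<phi> ((\<lambda>t. s * \<eta> t) t)) t x =
        lincomb 1 (v t (\<phi> (s * \<eta> t) x)) (s * \<eta>' t) (tangent_map A B (f t) (\<phi> (s * \<eta> t) x) (velocity A \<phi> (s * \<eta> t) x))"
        by (rule velocity_comp[OF A A B fam e0(2) open_greaterThanLessThan open_greaterThanLessThan _ _ th])
          (use t e0 \<sigma> in \<open>auto simp: \<sigma>_def abs_less_iff\<close>)
      then show "velocity B (F s) t x = (?w \<circ> \<phi> \<sigma>) x"
        using vel[OF \<sigma>, of x] by (simp add: F_def \<sigma>_def)
    qed
    then have "g s t = G (f t \<circ> \<phi> \<sigma>) (?w \<circ> \<phi> \<sigma>) (?w \<circ> \<phi> \<sigma>)" by (simp add: g_def F_def \<sigma>_def)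
    also have "\<dots> = G (f t) ?w ?w" by (rule G_invariant[OF imm[OF t] dif[OF \<sigma>] wS wS])
    finally have 1: "g s t = G (f t) ?w ?w" .
    have 2: "G (f t) (v t) (v t) + 2 * (s * \<eta>' t) * H (f t) (Q t) ?TY \<le> G (f t) ?w ?w"
      by (rule G_tangent_bound[OF imm[OF t] vS pair(1)])
    have 3: "H (f t) (Q t) ?TY = J \<sigma> t" unfolding J_def by (rule pair(2))
    have "\<bar>(s * \<eta>' t) * (J \<sigma> t - m t)\<bar> \<le> (\<bar>s\<bar> * R') * (C * (\<bar>s\<bar> * R) * D * V)"
    proof -
      have "\<bar>J \<sigma> t - m t\<bar> \<le> C * \<bar>\<sigma>\<bar> * D * V" by (rule Jm[OF \<sigma> t])
      also have "\<dots> \<le> C * (\<bar>s\<bar> * R) * D * V"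
      proof -
        have "\<bar>\<sigma>\<bar> \<le> \<bar>s\<bar> * R" unfolding \<sigma>_def abs_mult using R[of t] t e0 by (intro mult_left_mono) auto
        then show ?thesis using C D0 V by (intro mult_right_mono mult_left_mono) auto
      qed
      finally have j: "\<bar>J \<sigma> t - m t\<bar> \<le> C * (\<bar>s\<bar> * R) * D * V" .
      have "\<bar>s * \<eta>' t\<bar> \<le> \<bar>s\<bar> * R'" unfolding abs_mult using R'[OF t] by (intro mult_left_mono) auto
      then show ?thesis unfolding abs_mult[of "s * \<eta>' t"] using j R0 by (intro mult_mono) auto
    qed
    also have "\<dots> = (\<bar>s\<bar> * \<bar>s\<bar>) * k" by (simp only: k_def mult_ac)
    also have "\<dots> = s\<^sup>2 * k" by (simp add: power2_eq_square)
    finally have 4: "- (s\<^sup>2 * k) \<le> (s * \<eta>' t) * (J \<sigma> t - m t)" by (simp add: abs_le_iff)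
    have 5: "g 0 t = G (f t) (v t) (v t)" by (simp add: g_def F0)
    show ?thesis
      using 1 2 4 unfolding 3 5 by (simp add: algebra_simps)
  qed
  define I where "I = integral {a..b} (\<lambda>t. \<eta>' t * m t)"
  define E where "E = (\<lambda>s. energy A B gb P a b (F s))"
  have Eg: "E s = 1/2 * integral {a..b} (g s)" for s by (simp add: E_def energy_def g_def)
  have gi: "g s integrable_on {a..b}" if "\<bar>s\<bar> < e1" for s
    unfolding g_def by (rule integrable_continuous_real[OF energy_density_continuous[OF ab Fpath[OF that]]])
  have mi: "(\<lambda>t. \<eta>' t * m t) integrable_on {a..b}"
    using continuous_on_subset[OF \<eta>(3)] by (intro integrable_continuous_real continuous_on_mult mc) auto
  have Elower: "E 0 + s * I - s\<^sup>2 * (k * (b - a)) \<le> E s" if s: "\<bar>s\<bar> < e1" for s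
  proof -
    have h: "((\<lambda>t. g 0 t + 2 * s * (\<eta>' t * m t) - 2 * s\<^sup>2 * k) has_integral
       (integral {a..b} (g 0) + 2 * s * I - (b - a) *\<^sub>R (2 * s\<^sup>2 * k))) {a..b}"
      using ab e1 gi[of 0] mi unfolding I_def
      by (intro has_integral_add has_integral_diff has_integral_mult_right integrable_integral has_integral_const_real[THEN has_integral_eq_rhs]) auto
    have "integral {a..b} (g 0) + 2 * s * I - (b - a) *\<^sub>R (2 * s\<^sup>2 * k) \<le> integral {a..b} (g s)"
      by (rule has_integral_le[OF h integrable_integral[OF gi[OF s]] lower[OF s]])
    then show ?thesis unfolding Eg by (simp add: algebra_simps)
  qed
  have "(E has_real_derivative 0) (at 0)"
    using geo var unfolding geodesic_def E_def by blast
  then have der: "((\<lambda>s. E s - s * I + s\<^sup>2 * (k * (b - a))) has_real_derivative (0 - I)) (at 0)"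
    by (auto intro!: derivative_eq_intros)
  have "0 - I = 0"
  proof (rule DERIV_local_min[OF der e1(1)])
    show "\<forall>s. \<bar>0 - s\<bar> < e1 \<longrightarrow> E 0 - 0 * I + 0\<^sup>2 * (k * (b - a)) \<le> E s - s * I + s\<^sup>2 * (k * (b - a))"
    proof (intro allI impI)
      fix s assume "\<bar>0 - s\<bar> < e1"
      then show "E 0 - 0 * I + 0\<^sup>2 * (k * (b - a)) \<le> E s - s * I + s\<^sup>2 * (k * (b - a))"
        using Elower[of s] by simp
    qed
  qed
  then show ?thesis by (simp add: I_def m_def)
qed

lemma smeared_momentum_conserved:
  assumes c: "c \<in> A" and \<delta>: "\<delta> > 0" and K: "cball y0 \<delta> \<subseteq> cimg c" and t: "t \<in> {a..b}" "t' \<in> {a..b}"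
  shows "(LINT y:cball y0 \<delta>|lborel. bump y0 \<delta> y * pm c e t y) = (LINT y:cball y0 \<delta>|lborel. bump y0 \<delta> y * pm c e t' y)"
  by (rule du_bois_reymond[OF ab smeared_continuous[OF c compact_cball K smooth_on_imp_continuous[OF smooth_bump]]
     smeared_momentum_stationary[OF c \<delta> K] t])

text \<open>If the values at two times were different at \<open>y0\<close>, they would be so, with the same
  sign, on a small ball, and a bump on this ball would have different smeared momenta.\<close>

lemma pmom_le:
  assumes c: "c \<in> A" and y0: "y0 \<in> cimg c" and t: "t \<in> {a..b}" "t' \<in> {a..b}"
  shows "pm c e t y0 \<le> pm c e t' y0"
proof (rule ccontr)
  assume "\<not> ?thesis"
  then have gt: "pm c e t y0 - pm c e t' y0 > 0" by simp
  define q where "q = (\<lambda>y. pm c e t y - pm c e t' y)"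
  have qc: "continuous_on (cimg c) q" unfolding q_def
    by (intro continuous_on_diff continuous_on_slice[OF pmom_continuous[OF ab path c]] t)
  have "open (cimg c \<inter> q -` {0<..})"
    by (rule continuous_open_preimage[OF qc atlas_open_img[OF A c]]) simp
  moreover have "y0 \<in> cimg c \<inter> q -` {0<..}" using y0 gt by (simp add: q_def)
  ultimately obtain \<delta> where \<delta>: "\<delta> > 0" "cball y0 \<delta> \<subseteq> cimg c \<inter> q -` {0<..}"
    using open_contains_cball by blast
  let ?K = "cball y0 \<delta>" and ?\<omega> = "bump y0 \<delta>"
  have K: "?K \<subseteq> cimg c" using \<delta> by blast
  have \<omega>c: "continuous_on ?K ?\<omega>" by (rule continuous_on_subset[OF smooth_on_imp_continuous[OF smooth_bump]]) simp
  note i1 = smeared_integrable[OF c compact_cball K t(1) \<omega>c, of e] and i2 = smeared_integrable[OF c compact_cball K t(2) \<omega>c, of e]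
  have "(LINT y:?K|lborel. ?\<omega> y * pm c e t y - ?\<omega> y * pm c e t' y) = 0"
    unfolding set_integral_diff(2)[OF i1 i2] using smeared_momentum_conserved[OF c \<delta>(1) K t] by simp
  then have z: "(LINT y:?K|lborel. ?\<omega> y * q y) = 0" by (simp add: q_def right_diff_distrib)
  have int: "set_integrable lborel ?K (\<lambda>y. ?\<omega> y * q y)"
    using set_integral_diff(1)[OF i1 i2] by (simp add: q_def right_diff_distrib)
  have q0: "q y > 0" if "y \<in> ?K" for y using \<delta>(2) that by blast
  have nn: "0 \<le> indicat_real ?K y *\<^sub>R (?\<omega> y * q y)" for y
    using q0[of y] bump_nonneg[of y0 \<delta> y] by (auto simp: indicator_def)
  have "AE y in lborel. indicat_real ?K y *\<^sub>R (?\<omega> y * q y) = 0"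
    using integral_nonneg_eq_0_iff_AE[of lborel "\<lambda>y. indicat_real ?K y *\<^sub>R (?\<omega> y * q y)"] int z nn
    by (simp add: set_integrable_def set_lebesgue_integral_def)
  then have "AE y in lborel. y \<notin> ball y0 \<delta>"
  proof (rule AE_mp, intro AE_I2 impI notI)
    fix y assume "indicat_real ?K y *\<^sub>R (?\<omega> y * q y) = 0" and y: "y \<in> ball y0 \<delta>"
    moreover have "?\<omega> y > 0" using y by (intro bump_pos) (simp add: dist_norm norm_minus_commute)
    moreover have "q y > 0" using y by (intro q0) auto
    moreover have "y \<in> ?K" using y by auto
    ultimately show False by simp
  qed
  then have "ball y0 \<delta> \<in> null_sets lborel"
    by (subst AE_iff_null_sets) auto
  then have "measure lborel (ball y0 \<delta>) = 0" by (simp add: measure_eq_0_null_sets)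
  then show False using content_ball_pos[OF \<delta>(1), of y0] by simp
qed

lemma pmom_conserved:
  "c \<in> A \<Longrightarrow> y \<in> cimg c \<Longrightarrow> t \<in> {a..b} \<Longrightarrow> t' \<in> {a..b} \<Longrightarrow> pm c e t y = pm c e t' y"
  using pmom_le[of c y t t' e] pmom_le[of c y t' t e] by linarith

lemma momentum_density_conserved:
  assumes t: "t \<in> {a..b}" "t' \<in> {a..b}" and w: "w \<in> tangent_space A x"
  shows "gb (f t x) (Q t x) (tangent_map A B (f t) x w) * vol A (pullback_metric A B gb (f t)) x c =
     gb (f t' x) (Q t' x) (tangent_map A B (f t') x w) * vol A (pullback_metric A B gb (f t')) x c"
proof (cases "c \<in> A \<and> x \<in> cdom c")
  case True
  then have "w = coord_vec A c x (w c)" using tangent_eq_coord_vec[OF A w] by blast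
  then show ?thesis
    using pmom_conserved[of c "cmap c x" t t' "w c"] t True cinv_cmap[OF A, of c x] by (simp add: pmom_def)
next
  case False
  then show ?thesis by (auto simp: vol_def)
qed

end

section \<open>The tangential part\<close>

context sobolev_manifold
begin

text \<open>In coordinates the Gram map \<open>L\<close> of the pulled back metric is injective because the
  metric is positive definite and the tangent map injective; hence it is surjective, which
  provides the orthogonal projection.\<close>

lemma tan_part_props:
  assumes f: "f \<in> immersions A B" and h: "h x \<in> tangent_space B (f x)"
  shows "tan_part A B gb f h x \<in> tangent_space A x"
    and "w \<in> tangent_space A x \<Longrightarrow>
      pullback_metric A B gb f x (tan_part A B gb f h x) w = gb (f x) (h x) (tangent_map A B f x w)"
proof -
  let ?T = "tangent_map A B f x" and ?V = "tangent_space A x" and ?g = "gb (f x)"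
  note fs = immersionsD[OF f]
  have TV: "?T v \<in> tangent_space B (f x)" if "v \<in> ?V" for v by (rule tangent_map_in[OF A B fs that])
  have inj: "inj_on ?T ?V" using f by (simp add: immersions_def)
  have T0: "?T (\<lambda>_. 0) = (\<lambda>_. 0)"
    using tangent_map_lincomb[OF A B fs zero_in[OF A] zero_in[OF A], of x 0 0] by (simp add: lincomb_def)
  have definite: "v = (\<lambda>_. 0)" if "v \<in> ?V" "?g (?T v) (?T v) = 0" for v
  proof -
    have "?T v = (\<lambda>_. 0)" using gb_pos[OF gb TV[OF that(1)] TV[OF that(1)]] that(2) by force
    then show ?thesis using inj that(1) zero_in[OF A, of x] T0 by (metis inj_onD)
  qed
  obtain c where c: "c \<in> A" "x \<in> cdom c" using atlas_cover[OF A] by blast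
  note cv = coord_vec_in[OF A c]
  define t where "t = (\<lambda>u. ?T (coord_vec A c x u))"
  have tT: "t u \<in> tangent_space B (f x)" for u unfolding t_def by (rule TV[OF cv])
  have tl: "t (r *\<^sub>R u + s *\<^sub>R w) = lincomb r (t u) s (t w)" for r s u w
    unfolding t_def coord_vec_lincomb[OF A c] by (rule tangent_map_lincomb[OF A B fs cv cv])
  have lin: "linear (\<lambda>w. ?g q (t w))" if "q \<in> tangent_space B (f x)" for q
  proof (rule linearI)
    fix u w :: "real^'k" and r :: real
    show "?g q (t (u + w)) = ?g q (t u) + ?g q (t w)"
      using gb_lincomb_right[OF gb B tT tT that, of 1 u 1 w] tl[of 1 u 1 w] by simp
    show "?g q (t (r *\<^sub>R u)) = r *\<^sub>R ?g q (t u)"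
      using gb_lincomb_right[OF gb B tT tT that, of r u 0 u] tl[of r u 0 u] by simp
  qed
  define L where "L = (\<lambda>u. \<chi> j. ?g (t u) (t (axis j 1)))"
  have Llin: "linear L"
  proof (rule linearI)
    fix u w :: "real^'k" and r :: real
    show "L (u + w) = L u + L w"
      using gb_lincomb[OF gb tT tT tT, of 1 u 1 w] tl[of 1 u 1 w] by (simp add: L_def vec_eq_iff)
    show "L (r *\<^sub>R u) = r *\<^sub>R L u"
      using gb_lincomb[OF gb tT tT tT, of r u 0 u] tl[of r u 0 u] by (simp add: L_def vec_eq_iff)
  qed
  have axes: "(\<lambda>w. ?g q (t w)) = (\<lambda>w. ?g q' (t w))"
    if "q \<in> tangent_space B (f x)" "q' \<in> tangent_space B (f x)" "\<And>j. ?g q (t (axis j 1)) = ?g q' (t (axis j 1))" for q q'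
    using that by (intro linear_eq_stdbasis lin) (auto simp: Basis_vec_def)
  have "inj L"
    unfolding linear_injective_0[OF Llin]
  proof (intro allI impI)
    fix u assume "L u = 0"
    then have "?g (t u) (t (axis j 1)) = 0" for j by (simp add: L_def vec_eq_iff)
    moreover have "?g (\<lambda>_. 0) (t w) = 0" for w
      using gb_lincomb[OF gb tT tT tT, of 0 w 0 w w] by (simp add: lincomb_def)
    ultimately have "?g (t u) (t u) = 0"
      using axes[OF tT zero_in[OF B], of u] by (metis (no_types))
    then have "coord_vec A c x u = (\<lambda>_. 0)" using definite[OF cv] by (simp add: t_def)
    then show "u = 0" using coord_vec_same[OF A c, of u] by simp
  qed
  then have "surj L" using linear_injective_imp_surjective[OF Llin] by simp
  then obtain u where u: "L u = (\<chi> j. ?g (h x) (t (axis j 1)))" by (metis surjD)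
  have rep: "?g (t u) (t w) = ?g (h x) (t w)" for w
  proof -
    have "?g (t u) (t (axis j 1)) = ?g (h x) (t (axis j 1))" for j using u by (simp add: L_def vec_eq_iff)
    from axes[OF tT h this] show ?thesis by metis
  qed
  have orth: "?g (lincomb 1 (h x) (-1) (?T v)) (?T w) = 0 \<longleftrightarrow> ?g (?T v) (?T w) = ?g (h x) (?T w)"
    if "v \<in> ?V" "w \<in> ?V" for v w
    using gb_lincomb[OF gb h TV[OF that(1)] TV[OF that(2)], of 1 "-1"] by auto
  have ex: "\<exists>!v. v \<in> ?V \<and> (\<forall>w\<in>?V. ?g (lincomb 1 (h x) (-1) (?T v)) (?T w) = 0)"
  proof (rule ex1I[of _ "coord_vec A c x u"])
    show "coord_vec A c x u \<in> ?V \<and> (\<forall>w\<in>?V. ?g (lincomb 1 (h x) (-1) (?T (coord_vec A c x u))) (?T w) = 0)"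
    proof (intro conjI cv ballI)
      fix w assume w: "w \<in> ?V"
      have "?T w = t (w c)" unfolding t_def using tangent_eq_coord_vec[OF A w c] by simp
      then show "?g (lincomb 1 (h x) (-1) (?T (coord_vec A c x u))) (?T w) = 0"
        using rep[of "w c"] orth[OF cv w] by (simp add: t_def)
    qed
  next
    fix v assume v: "v \<in> ?V \<and> (\<forall>w\<in>?V. ?g (lincomb 1 (h x) (-1) (?T v)) (?T w) = 0)"
    let ?d = "lincomb 1 v (-1) (coord_vec A c x u)"
    have d: "?d \<in> ?V" using v by (intro lincomb_in[OF A] cv) auto
    have Td: "?T ?d = t (?d c)" unfolding t_def using tangent_eq_coord_vec[OF A d c] by simp
    have "?g (?T v) (?T ?d) = ?g (h x) (?T ?d)" using orth[of v ?d] v d by blast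
    moreover have "?g (?T (coord_vec A c x u)) (?T ?d) = ?g (h x) (?T ?d)"
      using rep[of "?d c"] unfolding Td by (simp add: t_def)
    moreover have "?T ?d = lincomb 1 (?T v) (-1) (?T (coord_vec A c x u))"
      using v by (intro tangent_map_lincomb[OF A B fs] cv) auto
    ultimately have "?g (?T ?d) (?T ?d) = 0"
      using gb_lincomb[OF gb TV TV[OF cv] TV[OF d], of v 1 "-1" u] v by simp
    then have "?d = (\<lambda>_. 0)" by (rule definite[OF d])
    then show "v = coord_vec A c x u" by (simp add: lincomb_def fun_eq_iff)
  qed
  have "tan_part A B gb f h x \<in> ?V \<and>
     (\<forall>w\<in>?V. ?g (lincomb 1 (h x) (-1) (?T (tan_part A B gb f h x))) (?T w) = 0)"
    unfolding tan_part_def by (rule theI'[OF ex])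
  then show "tan_part A B gb f h x \<in> ?V"
    and "w \<in> ?V \<Longrightarrow> pullback_metric A B gb f x (tan_part A B gb f h x) w = ?g (h x) (?T w)"
    using orth by (auto simp: pullback_metric_def)
qed

lemma infinitesimal_action:
  assumes g: "smooth_map A B g" and \<phi>: "diff_curve A \<phi> X"
  shows "velocity B (\<lambda>s. g \<circ> \<phi> s) 0 = (\<lambda>x. tangent_map A B g x (X x))"
proof
  fix x
  obtain e where e: "e > 0" "smooth_family A A {-e<..<e} \<phi>" and \<phi>0: "\<phi> 0 = id" "velocity A \<phi> 0 = X"
    using \<phi> by (auto simp: diff_curve_def)
  have "velocity B (\<lambda>t. (\<lambda>_. g) t \<circ> \<phi> ((\<lambda>s. s) t)) 0 x =
     lincomb 1 (velocity B (\<lambda>_. g) 0 (\<phi> 0 x)) 1 (tangent_map A B g (\<phi> 0 x) (velocity A \<phi> 0 x))"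
    by (rule velocity_comp[OF A A B e(2) smooth_map_const_family[OF A B g open_UNIV] open_UNIV open_greaterThanLessThan _ _ DERIV_ident])
      (use e in auto)
  moreover have "velocity B (\<lambda>_. g) 0 (\<phi> 0 x) = (\<lambda>_. 0)" by (auto simp: velocity_def)
  ultimately show "velocity B (\<lambda>s. g \<circ> \<phi> s) 0 x = tangent_map A B g x (X x)"
    by (simp add: \<phi>0 lincomb_def)
qed

lemma tangent_section:
  assumes f: "smooth_map A B f" and X: "X \<in> vector_fields A"
  shows "(\<lambda>x. tangent_map A B f x (X x)) \<in> S f"
proof -
  have fam: "smooth_family A B (UNIV::real set) (\<lambda>_. f)" by (rule smooth_map_const_family[OF A B f open_UNIV])
  show ?thesis
    using section_slice[OF A B fam UNIV_I tangent_family[OF A B fam open_UNIV X]] by simp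
qed

end

section \<open>Conservation of the reparametrization momentum\<close>

theorem mainTheorem9:
  fixes A :: "('m::{t2_space,second_countable_topology}, 'k::finite) chart set"
    and B :: "('n::{t2_space,second_countable_topology}, 'l::finite) chart set"
    and gb :: "('n, 'l) metric"
    and P :: "('m, 'n, 'l) operator_field"
    and f :: "real \<Rightarrow> 'm \<Rightarrow> 'n"
    and a b :: real
  assumes M: "smooth_atlas A" "connected (UNIV :: 'm set)" "compact (UNIV :: 'm set)"
    and N: "smooth_atlas B" "connected (UNIV :: 'n set)" "riemannian_metric B gb"
    and dim: "CARD('k) \<le> CARD('l)"
    and P: "sobolev_operator A B gb P"
    and f: "a < b" "geodesic A B gb P a b f"
  shows "(\<forall>X \<in> vector_fields A.
            (\<forall>\<phi>. diff_curve A \<phi> X \<longrightarrow>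
               (\<forall>t\<in>{a..b}. reparam_momentum A B gb P (f t) (velocity B f t) \<phi>
                  = H0 A B gb (f t) (\<lambda>x. tangent_map A B (f t) x (X x)) (P (f t) (velocity B f t)))) \<and>
            (\<lambda>t. H0 A B gb (f t) (\<lambda>x. tangent_map A B (f t) x (X x)) (P (f t) (velocity B f t)))
              constant_on {a..b}) \<and>
         (\<lambda>t. flat_vol A (pullback_metric A B gb (f t))
                (tan_part A B gb (f t) (P (f t) (velocity B f t)))) constant_on {a..b}"
proof -
  interpret sobolev_geodesic A B gb P f a b
    by unfold_locales (fact M N P f)+
  have vS: "v t \<in> S (f t)" if "t \<in> {a..b}" for t by (rule velocity_section[OF path that])
  have QS: "Q t \<in> S (f t)" if "t \<in> {a..b}" for t by (rule P_in[OF imm[OF that] vS[OF that]])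
  have a: "a \<in> {a..b}" using f(1) by simp
  have mom: "reparam_momentum A B gb P (f t) (v t) \<phi> = H (f t) (\<lambda>x. tangent_map A B (f t) x (X x)) (Q t)"
    if X: "X \<in> vector_fields A" and \<phi>: "diff_curve A \<phi> X" and t: "t \<in> {a..b}" for X \<phi> t
    unfolding reparam_momentum_def sobolev_metric_def infinitesimal_action[OF immersionsD[OF imm[OF t]] \<phi>]
    by (rule P_sym[OF imm[OF t] tangent_section[OF immersionsD[OF imm[OF t]] X] vS[OF t]])
  have const: "H (f t) (\<lambda>x. tangent_map A B (f t) x (X x)) (Q t) = H (f a) (\<lambda>x. tangent_map A B (f a) x (X x)) (Q a)"
    if X: "X \<in> vector_fields A" and t: "t \<in> {a..b}" for X t
  proof -
    have Xx: "X x \<in> tangent_space A x" for x using X by (auto simp: vector_fields_def sections_along_def)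
    have "h0_dens A B gb (f t) (Q t) (\<lambda>x. tangent_map A B (f t) x (X x))
       = h0_dens A B gb (f a) (Q a) (\<lambda>x. tangent_map A B (f a) x (X x))"
      unfolding h0_dens_def using momentum_density_conserved[OF t a Xx] by blast
    then have "H (f t) (Q t) (\<lambda>x. tangent_map A B (f t) x (X x)) = H (f a) (Q a) (\<lambda>x. tangent_map A B (f a) x (X x))"
      by (simp only: H0_eq)
    then show ?thesis
      using H0_sym[OF gb QS[OF t] tangent_section[OF immersionsD[OF imm[OF t]] X]]
        H0_sym[OF gb QS[OF a] tangent_section[OF immersionsD[OF imm[OF a]] X]] by simp
  qed
  have flat: "flat_vol A (pullback_metric A B gb (f t)) (tan_part A B gb (f t) (Q t))
      = flat_vol A (pullback_metric A B gb (f a)) (tan_part A B gb (f a) (Q a))" if t: "t \<in> {a..b}" for t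
  proof (intro ext)
    fix x w c
    show "flat_vol A (pullback_metric A B gb (f t)) (tan_part A B gb (f t) (Q t)) x w c
      = flat_vol A (pullback_metric A B gb (f a)) (tan_part A B gb (f a) (Q a)) x w c"
    proof (cases "w \<in> tangent_space A x")
      case True
      have q: "Q s x \<in> tangent_space B (f s x)" if "s \<in> {a..b}" for s
        using QS[OF that] by (simp add: sections_along_def)
      show ?thesis
        using True momentum_density_conserved[OF t a True, of c]
          tan_part_props(2)[where f="f t" and h="Q t" and x=x, OF imm[OF t] q[OF t] True]
          tan_part_props(2)[where f="f a" and h="Q a" and x=x, OF imm[OF a] q[OF a] True]
        by (simp add: flat_vol_def)
    qed (simp add: flat_vol_def)
  qed
  show ?thesis
    unfolding constant_on_def using mom const flat by blast
qed

end
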